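(* Let $X$ be a schematic finite space and $\tilde X=\operatorname{Spec}\mathcal O_X$. Then: (1) The intersection of two quasi-compact open subsets of $\tilde X$ is quasi-compact. (2) The family of quasi-compact open subsets of $\tilde X$ is a basis for the topology of $\tilde X$. (3) If $\bar V\subseteq\tilde X$ is a quasi-compact open subset, then $\bar V\cap\tilde U$ is quasi-compact for every open subset $U\subseteq X$.
   Context: A finite ringed space is a ringed space $(X,\mathcal O)$ (sheaf of commutative rings with unit) whose underlying topological space $X$ is finite. For $x\in X$, $U_x$ denotes the smallest open subset containing $x$; write $x\le y$ iff $U_y\subseteq U_x$, so $U_x=\{y: y\ge x\}$. The stalk is $\mathcal O_x=\mathcal O(U_x)$. Put $U_{xy}:=U_x\cap U_y$ and $\mathcal O_{xy}:=\mathcal O(U_{xy})$. A finite ringed space $(X,\mathcal O)$ is affine if: (i) $\mathcal O(X)\to\prod_{x\in X}\mathcal O_x$ is faithfully flat; (ii) the natural morphism $\mathcal O_x\otimes_{\mathcal O(X)}\mathcal O_y\to\mathcal O_{xy}$ is an isomorphism for all $x,y\in X$; (iii) $\mathcal O_{xy}\to\prod_{z\in U_{xy}}\mathcal O_z$ is faithfully flat for all $x,y\in X$ (an empty product is the zero ring). A finite ringed space is schematic (a schematic finite space) if it has an open covering by affine finite spaces. For a schematic finite space $X$, $\tilde X=\operatorname{Spec}\mathcal O_X:=\varinjlim_{x\in X}\operatorname{Spec}\mathcal O_x$ is the direct limit in the category of ringed spaces of the affine schemes $\operatorname{Spec}\mathcal O_x$, with transition morphisms $\operatorname{Spec}\mathcal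 O_y\to\operatorname{Spec}\mathcal O_x$ for $x\le y$. The maps $\operatorname{Spec}\mathcal O_x\to\tilde X$ are injective, $\tilde X=\bigcup_{x\in X}\operatorname{Spec}\mathcal O_x$, and a subset of $\tilde X$ is open iff its intersection with every $\operatorname{Spec}\mathcal O_x$ is open in $\operatorname{Spec}\mathcal O_x$. For an open subset $U\subseteq X$, $\tilde U=\operatorname{Spec}\mathcal O_U=\bigcup_{x\in U}\operatorname{Spec}\mathcal O_x$ is regarded as a subset of $\tilde X$ (its topology is the subspace topology). *)

theory Defs
  imports "HOL-Algebra.Algebra" "HOL-Analysis.Sum_Topology"
begin

section \<open>Tensor products\<close>

definition tensor_relations ::
  "('a, 'k) ring_scheme \<Rightarrow> ('a, 'm, 'u) module_scheme \<Rightarrow> ('a, 'n, 'v) module_scheme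
    \<Rightarrow> (('m \<times> 'n) \<Rightarrow>\<^sub>0 int) set" where
  "tensor_relations A M N =
     {frag_of (x \<oplus>\<^bsub>M\<^esub> x', y) - frag_of (x, y) - frag_of (x', y) | x x' y.
        x \<in> carrier M \<and> x' \<in> carrier M \<and> y \<in> carrier N}
   \<union> {frag_of (x, y \<oplus>\<^bsub>N\<^esub> y') - frag_of (x, y) - frag_of (x, y') | x y y'.
        x \<in> carrier M \<and> y \<in> carrier N \<and> y' \<in> carrier N}
   \<union> {frag_of (a \<odot>\<^bsub>M\<^esub> x, y) - frag_of (x, a \<odot>\<^bsub>N\<^esub> y) | a x y.
        a \<in> carrier A \<and> x \<in> carrier M \<and> y \<in> carrier N}"

definition tensor_kernel ::
  "('a, 'k) ring_scheme \<Rightarrow> ('a, 'm, 'u) module_scheme \<Rightarrow> ('a, 'n, 'v) module_scheme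
    \<Rightarrow> (('m \<times> 'n) \<Rightarrow>\<^sub>0 int) set" where
  "tensor_kernel A M N =
     generate (free_Abelian_group (carrier M \<times> carrier N)) (tensor_relations A M N)"

text \<open>The underlying abelian group of the tensor product of the modules \<open>M\<close> and \<open>N\<close> over \<open>A\<close>,
  written multiplicatively because it is a quotient group in the sense of \<open>Mod\<close>.\<close>

definition tensor ::
  "('a, 'k) ring_scheme \<Rightarrow> ('a, 'm, 'u) module_scheme \<Rightarrow> ('a, 'n, 'v) module_scheme
    \<Rightarrow> (('m \<times> 'n) \<Rightarrow>\<^sub>0 int) set monoid" where
  "tensor A M N = free_Abelian_group (carrier M \<times> carrier N) Mod tensor_kernel A M N"

definition pure_tensor ::
  "('a, 'k) ring_scheme \<Rightarrow> ('a, 'm, 'u) module_scheme \<Rightarrow> ('a, 'n, 'v) module_scheme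
    \<Rightarrow> 'm \<Rightarrow> 'n \<Rightarrow> (('m \<times> 'n) \<Rightarrow>\<^sub>0 int) set" where
  "pure_tensor A M N x y =
     tensor_kernel A M N #>\<^bsub>free_Abelian_group (carrier M \<times> carrier N)\<^esub> frag_of (x, y)"

text \<open>The map out of a tensor product that a balanced biadditive map \<open>b\<close> into a (multiplicatively
  written) commutative group \<open>T\<close> induces. Such a \<open>b\<close> extends to a homomorphism on the free abelian
  group that is constant on each coset \<open>C\<close>.\<close>

definition tensor_lift ::
  "('t, 's) monoid_scheme \<Rightarrow> ('m \<times> 'n \<Rightarrow> 't) \<Rightarrow> (('m \<times> 'n) \<Rightarrow>\<^sub>0 int) set \<Rightarrow> 't" where
  "tensor_lift T b C =
     the_elem ((\<lambda>z. finprod T (\<lambda>p. b p [^]\<^bsub>T\<^esub> Poly_Mapping.lookup z p) (Poly_Mapping.keys z)) ` C)"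

definition tensor_map ::
  "('a, 'k) ring_scheme \<Rightarrow> ('a, 'm, 'u) module_scheme \<Rightarrow> ('a, 'n, 'v) module_scheme
    \<Rightarrow> ('n' \<Rightarrow> 'n) \<Rightarrow> (('m \<times> 'n') \<Rightarrow>\<^sub>0 int) set \<Rightarrow> (('m \<times> 'n) \<Rightarrow>\<^sub>0 int) set" where
  "tensor_map A M N g = tensor_lift (tensor A M N) (\<lambda>(x, y). pure_tensor A M N x (g y))"

text \<open>The ring \<open>B\<close> as a module over the source of a ring homomorphism \<open>f\<close> into \<open>B\<close>.\<close>

definition algebra_module :: "('a \<Rightarrow> 'b) \<Rightarrow> ('b, 'k) ring_scheme \<Rightarrow> ('a, 'b) module" where
  "algebra_module f B =
     \<lparr>carrier = carrier B, monoid.mult = monoid.mult B, one = one B,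
      ring.zero = ring.zero B, ring.add = ring.add B, smult = (\<lambda>a b. f a \<otimes>\<^bsub>B\<^esub> b)\<rparr>"

text \<open>The tensor product of the algebras \<open>f : A \<rightarrow> B\<close> and \<open>g : A \<rightarrow> C\<close>, with the product
  determined by \<open>(b \<otimes> c) (b' \<otimes> c') = (b b') \<otimes> (c c')\<close>.\<close>

definition tensor_algebra ::
  "('a, 'k) ring_scheme \<Rightarrow> ('a \<Rightarrow> 'b) \<Rightarrow> ('b, 'u) ring_scheme \<Rightarrow> ('a \<Rightarrow> 'c) \<Rightarrow> ('c, 'v) ring_scheme
    \<Rightarrow> (('b \<times> 'c) \<Rightarrow>\<^sub>0 int) set ring" where
  "tensor_algebra A f B g C =
     (let M = algebra_module f B; N = algebra_module g C; T = tensor A M N in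
      \<lparr>carrier = carrier T,
       monoid.mult = (\<lambda>u v. tensor_lift T (\<lambda>(b, c).
          tensor_lift T (\<lambda>(b', c'). pure_tensor A M N (b \<otimes>\<^bsub>B\<^esub> b') (c \<otimes>\<^bsub>C\<^esub> c')) v) u),
       one = pure_tensor A M N \<one>\<^bsub>B\<^esub> \<one>\<^bsub>C\<^esub>,
       ring.zero = \<one>\<^bsub>T\<^esub>,
       ring.add = monoid.mult T\<rparr>)"


section \<open>Faithful flatness\<close>

definition module_homs ::
  "('a, 'k) ring_scheme \<Rightarrow> ('a, 'm, 'u) module_scheme \<Rightarrow> ('a, 'n, 'v) module_scheme
    \<Rightarrow> ('m \<Rightarrow> 'n) set" where
  "module_homs A M N =
     {h. h \<in> hom (add_monoid M) (add_monoid N) \<and>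
         (\<forall>a\<in>carrier A. \<forall>x\<in>carrier M. h (a \<odot>\<^bsub>M\<^esub> x) = a \<odot>\<^bsub>N\<^esub> h x)}"

text \<open>\<open>B\<close> is faithfully flat over \<open>A\<close> if a sequence of \<open>A\<close>-modules is exact exactly when it is so
  after tensoring with \<open>B\<close>. HOL cannot quantify over modules of all types inside a definition, so
  the carriers are drawn from \<open>(nat \<Rightarrow> 'a) set\<close>: every countably generated \<open>A\<close>-module is isomorphic
  to one of these, namely to a set of cosets of a submodule of the finitely supported sequences
  in \<open>A\<close>. As faithful flatness can be tested on sequences of finitely generated modules (even on
  the inclusions of ideals and on cyclic modules), nothing is lost.\<close>

definition faithfully_flat ::
  "('a, 'k) ring_scheme \<Rightarrow> ('a \<Rightarrow> 'b) \<Rightarrow> ('b, 'l) ring_scheme \<Rightarrow> bool" where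
  "faithfully_flat A f B \<longleftrightarrow>
     f \<in> ring_hom A B \<and>
     (\<forall>(L :: ('a, (nat \<Rightarrow> 'a) set) module) (M :: ('a, (nat \<Rightarrow> 'a) set) module)
       (N :: ('a, (nat \<Rightarrow> 'a) set) module) u v.
        Module.module A L \<and> Module.module A M \<and> Module.module A N \<and>
        u \<in> module_homs A L M \<and> v \<in> module_homs A M N \<longrightarrow>
        (let E = algebra_module f B in
         u ` carrier L = kernel (add_monoid M) (add_monoid N) v \<longleftrightarrow>
         tensor_map A E M u ` carrier (tensor A E L) =
           kernel (tensor A E M) (tensor A E N) (tensor_map A E N v)))"

definition product_ring :: "'i set \<Rightarrow> ('i \<Rightarrow> ('a, 'k) ring_scheme) \<Rightarrow> ('i \<Rightarrow> 'a) ring" where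
  "product_ring I R =
     \<lparr>carrier = (\<Pi>\<^sub>E i\<in>I. carrier (R i)),
      monoid.mult = (\<lambda>s t. \<lambda>i\<in>I. s i \<otimes>\<^bsub>R i\<^esub> t i),
      one = (\<lambda>i\<in>I. \<one>\<^bsub>R i\<^esub>),
      ring.zero = (\<lambda>i\<in>I. \<zero>\<^bsub>R i\<^esub>),
      ring.add = (\<lambda>s t. \<lambda>i\<in>I. s i \<oplus>\<^bsub>R i\<^esub> t i)\<rparr>"


section \<open>Schematic finite spaces\<close>

text \<open>\<open>F U\<close> is the ring of sections over \<open>U\<close>, and \<open>\<rho> U V\<close> the restriction from \<open>U\<close> to \<open>V\<close>; only
  their values on open sets matter. The covering \<open>\<U>\<close> in the sheaf axiom may be empty, so
  \<open>F {}\<close> is the zero ring.\<close>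

locale finite_ringed_space =
  fixes S :: "'x topology"
    and F :: "'x set \<Rightarrow> 'r ring"
    and \<rho> :: "'x set \<Rightarrow> 'x set \<Rightarrow> 'r \<Rightarrow> 'r"
  assumes finite_space: "finite (topspace S)"
    and sections_cring: "openin S U \<Longrightarrow> cring (F U)"
    and restriction_hom:
      "\<lbrakk>openin S U; openin S V; V \<subseteq> U\<rbrakk> \<Longrightarrow> \<rho> U V \<in> ring_hom (F U) (F V)"
    and restriction_id:
      "\<lbrakk>openin S U; s \<in> carrier (F U)\<rbrakk> \<Longrightarrow> \<rho> U U s = s"
    and restriction_comp:
      "\<lbrakk>openin S U; openin S V; openin S W; W \<subseteq> V; V \<subseteq> U; s \<in> carrier (F U)\<rbrakk>
        \<Longrightarrow> \<rho> V W (\<rho> U V s) = \<rho> U W s"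
    and sheaf:
      "\<lbrakk>\<And>V. V \<in> \<U> \<Longrightarrow> openin S V;
        \<And>V. V \<in> \<U> \<Longrightarrow> \<sigma> V \<in> carrier (F V);
        \<And>V W. \<lbrakk>V \<in> \<U>; W \<in> \<U>\<rbrakk> \<Longrightarrow> \<rho> V (V \<inter> W) (\<sigma> V) = \<rho> W (V \<inter> W) (\<sigma> W)\<rbrakk>
        \<Longrightarrow> \<exists>!t. t \<in> carrier (F (\<Union>\<U>)) \<and> (\<forall>V\<in>\<U>. \<rho> (\<Union>\<U>) V t = \<sigma> V)"

definition smallest_open :: "'x topology \<Rightarrow> 'x \<Rightarrow> 'x set" where
  "smallest_open S x = \<Inter>{U. openin S U \<and> x \<in> U}"

definition stalk :: "'x topology \<Rightarrow> ('x set \<Rightarrow> 'r ring) \<Rightarrow> 'x \<Rightarrow> 'r ring" where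
  "stalk S F x = F (smallest_open S x)"

definition faithfully_flat_over_stalks ::
  "'x topology \<Rightarrow> ('x set \<Rightarrow> 'r ring) \<Rightarrow> ('x set \<Rightarrow> 'x set \<Rightarrow> 'r \<Rightarrow> 'r) \<Rightarrow> 'x set \<Rightarrow> bool" where
  "faithfully_flat_over_stalks S F \<rho> U \<longleftrightarrow>
     faithfully_flat (F U) (\<lambda>s. \<lambda>z\<in>U. \<rho> U (smallest_open S z) s) (product_ring U (stalk S F))"

definition affine_finite_space ::
  "'x topology \<Rightarrow> ('x set \<Rightarrow> 'r ring) \<Rightarrow> ('x set \<Rightarrow> 'x set \<Rightarrow> 'r \<Rightarrow> 'r) \<Rightarrow> bool" where
  "affine_finite_space S F \<rho> \<longleftrightarrow>
     finite_ringed_space S F \<rho> \<and>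
     faithfully_flat_over_stalks S F \<rho> (topspace S) \<and>
     (\<forall>x\<in>topspace S. \<forall>y\<in>topspace S.
        let U = smallest_open S x; V = smallest_open S y in
        tensor_lift (add_monoid (F (U \<inter> V)))
            (\<lambda>(s, t). \<rho> U (U \<inter> V) s \<otimes>\<^bsub>F (U \<inter> V)\<^esub> \<rho> V (U \<inter> V) t)
          \<in> ring_iso (tensor_algebra (F (topspace S)) (\<rho> (topspace S) U) (stalk S F x)
                                      (\<rho> (topspace S) V) (stalk S F y))
                      (F (U \<inter> V))) \<and>
     (\<forall>x\<in>topspace S. \<forall>y\<in>topspace S.
        faithfully_flat_over_stalks S F \<rho> (smallest_open S x \<inter> smallest_open S y))"

text \<open>The restriction of \<open>(S, F)\<close> to an open \<open>U\<close> is \<open>subtopology S U\<close> with the same \<open>F\<close> and \<open>\<rho>\<close>.\<close>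

definition schematic_finite_space ::
  "'x topology \<Rightarrow> ('x set \<Rightarrow> 'r ring) \<Rightarrow> ('x set \<Rightarrow> 'x set \<Rightarrow> 'r \<Rightarrow> 'r) \<Rightarrow> bool" where
  "schematic_finite_space S F \<rho> \<longleftrightarrow>
     finite_ringed_space S F \<rho> \<and>
     (\<exists>\<U>. (\<forall>U\<in>\<U>. openin S U \<and> affine_finite_space (subtopology S U) F \<rho>) \<and> \<Union>\<U> = topspace S)"


section \<open>Prime spectra and their direct limit\<close>

definition Spec :: "('a, 'k) ring_scheme \<Rightarrow> 'a set set" where
  "Spec R = {p. primeideal p R}"

definition zariski :: "('a, 'k) ring_scheme \<Rightarrow> 'a set topology" where
  "zariski R = topology (\<lambda>W. \<exists>E\<subseteq>carrier R. W = {p \<in> Spec R. \<not> E \<subseteq> p})"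

lemma openin_zariski:
  "openin (zariski R) W \<longleftrightarrow> (\<exists>E\<subseteq>carrier R. W = {p \<in> Spec R. \<not> E \<subseteq> p})"
proof -
  have inter: "\<exists>E\<subseteq>carrier R. S \<inter> T = {p \<in> Spec R. \<not> E \<subseteq> p}"
    if S: "D \<subseteq> carrier R" "S = {p \<in> Spec R. \<not> D \<subseteq> p}"
      and T: "E \<subseteq> carrier R" "T = {p \<in> Spec R. \<not> E \<subseteq> p}" for S T D E
  proof (cases "Spec R = {}")
    case True
    then show ?thesis using S T by blast
  next
    case False
    then interpret cring R
      by (auto simp: Spec_def primeideal_def)
    let ?P = "{a \<otimes>\<^bsub>R\<^esub> b | a b. a \<in> D \<and> b \<in> E}"
    have "?P \<subseteq> p \<longleftrightarrow> D \<subseteq> p \<or> E \<subseteq> p" if p: "primeideal p R" for p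
    proof -
      interpret primeideal p R by (rule p)
      show ?thesis
      proof
        assume P: "?P \<subseteq> p"
        show "D \<subseteq> p \<or> E \<subseteq> p"
        proof (rule disjCI, rule subsetI)
          fix a assume "\<not> E \<subseteq> p" and a: "a \<in> D"
          then obtain b where "b \<in> E" "b \<notin> p" by blast
          with a P S(1) T(1) I_prime[of a b] show "a \<in> p" by blast
        qed
      next
        assume "D \<subseteq> p \<or> E \<subseteq> p"
        then show "?P \<subseteq> p"
          using S(1) T(1) I_l_closed I_r_closed by blast
      qed
    qed
    then have "S \<inter> T = {p \<in> Spec R. \<not> ?P \<subseteq> p}"
      unfolding S(2) T(2) Spec_def by blast
    moreover have "?P \<subseteq> carrier R"
      using S(1) T(1) by blast
    ultimately show ?thesis by blast
  qed
  have union: "\<exists>E\<subseteq>carrier R. \<Union>\<K> = {p \<in> Spec R. \<not> E \<subseteq> p}"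
    if K: "\<forall>K\<in>\<K>. \<exists>E\<subseteq>carrier R. K = {p \<in> Spec R. \<not> E \<subseteq> p}" for \<K>
  proof -
    from K obtain e where e: "\<forall>K\<in>\<K>. e K \<subseteq> carrier R \<and> K = {p \<in> Spec R. \<not> e K \<subseteq> p}"
      by metis
    then have mem: "p \<in> K \<longleftrightarrow> p \<in> Spec R \<and> \<not> e K \<subseteq> p" if "K \<in> \<K>" for K p
      using that by auto
    have "\<Union>\<K> = {p \<in> Spec R. \<not> (\<Union>K\<in>\<K>. e K) \<subseteq> p}"
      by (auto simp: mem subset_iff) blast+
    moreover have "(\<Union>K\<in>\<K>. e K) \<subseteq> carrier R"
      using e by (simp add: UN_subset_iff)
    ultimately show ?thesis by blast
  qed
  have "istopology (\<lambda>W. \<exists>E\<subseteq>carrier R. W = {p \<in> Spec R. \<not> E \<subseteq> p})"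
    unfolding istopology_def
  proof (intro conjI allI impI)
    fix S T
    assume "\<exists>E\<subseteq>carrier R. S = {p \<in> Spec R. \<not> E \<subseteq> p}" "\<exists>E\<subseteq>carrier R. T = {p \<in> Spec R. \<not> E \<subseteq> p}"
    then show "\<exists>E\<subseteq>carrier R. S \<inter> T = {p \<in> Spec R. \<not> E \<subseteq> p}"
      by (elim exE conjE) (rule inter)
  qed (rule union)
  then show ?thesis
    by (simp add: zariski_def)
qed

lemma topspace_zariski [simp]: "topspace (zariski R) = Spec R"
proof -
  have "openin (zariski R) (Spec R)"
    unfolding openin_zariski
  proof (intro exI conjI)
    show "Spec R = {p \<in> Spec R. \<not> carrier R \<subseteq> p}"
      by (auto simp: Spec_def)
        (metis additive_subgroup.a_subset ideal_def primeideal.I_notcarr primeideal_def subset_antisym)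
  qed simp
  moreover have "topspace (zariski R) \<subseteq> Spec R"
    using openin_topspace[of "zariski R"] unfolding openin_zariski by blast
  ultimately show ?thesis
    using openin_subset by blast
qed

definition Spec_map :: "('a, 'k) ring_scheme \<Rightarrow> ('a \<Rightarrow> 'b) \<Rightarrow> 'b set \<Rightarrow> 'a set" where
  "Spec_map A f q = {a \<in> carrier A. f a \<in> q}"

definition quotient_topology :: "'a topology \<Rightarrow> ('a \<Rightarrow> 'b) \<Rightarrow> 'b topology" where
  "quotient_topology T f =
     topology (\<lambda>W. W \<subseteq> f ` topspace T \<and> openin T {s \<in> topspace T. f s \<in> W})"

lemma openin_quotient_topology:
  "openin (quotient_topology T f) W \<longleftrightarrow>
     W \<subseteq> f ` topspace T \<and> openin T {s \<in> topspace T. f s \<in> W}"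
proof -
  have 1: "{s \<in> topspace T. f s \<in> V \<inter> W} = {s \<in> topspace T. f s \<in> V} \<inter> {s \<in> topspace T. f s \<in> W}"
    for V W by auto
  have 2: "{s \<in> topspace T. f s \<in> \<Union>\<K>} = (\<Union>K\<in>\<K>. {s \<in> topspace T. f s \<in> K})" for \<K>
    by auto
  have "istopology (\<lambda>W. W \<subseteq> f ` topspace T \<and> openin T {s \<in> topspace T. f s \<in> W})"
    unfolding istopology_def 1 2 by blast
  then show ?thesis
    by (simp add: quotient_topology_def)
qed

lemma quotient_map_quotient_topology: "quotient_map T (quotient_topology T f) f"
proof -
  have "{s \<in> topspace T. f s \<in> f ` topspace T} = topspace T" by auto
  then have "openin (quotient_topology T f) (f ` topspace T)"
    by (simp add: openin_quotient_topology)
  then have "topspace (quotient_topology T f) = f ` topspace T"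
    by (metis openin_quotient_topology openin_subset openin_topspace subset_antisym)
  then show ?thesis
    by (auto simp: quotient_map_def openin_quotient_topology)
qed

text \<open>The underlying space of the direct limit of the spectra of the stalks: the disjoint union of
  the spectra, modulo the equivalence relation generated by identifying a prime of the stalk at
  \<open>y\<close> with its image in the spectrum of the stalk at \<open>x\<close>, for \<open>x \<le> y\<close>.\<close>

definition limit_relation ::
  "'x topology \<Rightarrow> ('x set \<Rightarrow> 'r ring) \<Rightarrow> ('x set \<Rightarrow> 'x set \<Rightarrow> 'r \<Rightarrow> 'r) \<Rightarrow> ('x \<times> 'r set) rel" where
  "limit_relation S F \<rho> =
     {((x, Spec_map (stalk S F x) (\<rho> (smallest_open S x) (smallest_open S y)) p), (y, p)) | x y p.
        x \<in> topspace S \<and> y \<in> topspace S \<and> smallest_open S y \<subseteq> smallest_open S x \<and>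
        p \<in> Spec (stalk S F y)}"

definition limit_point ::
  "'x topology \<Rightarrow> ('x set \<Rightarrow> 'r ring) \<Rightarrow> ('x set \<Rightarrow> 'x set \<Rightarrow> 'r \<Rightarrow> 'r)
    \<Rightarrow> 'x \<times> 'r set \<Rightarrow> ('x \<times> 'r set) set" where
  "limit_point S F \<rho> s = (limit_relation S F \<rho> \<union> (limit_relation S F \<rho>)\<inverse>)\<^sup>* `` {s}"

definition Spec_space ::
  "'x topology \<Rightarrow> ('x set \<Rightarrow> 'r ring) \<Rightarrow> ('x set \<Rightarrow> 'x set \<Rightarrow> 'r \<Rightarrow> 'r)
    \<Rightarrow> ('x \<times> 'r set) set topology" where
  "Spec_space S F \<rho> =
     quotient_topology (sum_topology (\<lambda>x. zariski (stalk S F x)) (topspace S)) (limit_point S F \<rho>)"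

definition Spec_subset ::
  "'x topology \<Rightarrow> ('x set \<Rightarrow> 'r ring) \<Rightarrow> ('x set \<Rightarrow> 'x set \<Rightarrow> 'r \<Rightarrow> 'r) \<Rightarrow> 'x set
    \<Rightarrow> ('x \<times> 'r set) set set" where
  "Spec_subset S F \<rho> U = (\<Union>x\<in>U. (\<lambda>p. limit_point S F \<rho> (x, p)) ` Spec (stalk S F x))"

end

theory Submission
  imports Defs
begin

text \<open>The topology of the limit is studied through the traces of its subsets on the spectra of the
  stalks. Consider the open sets whose trace on every \<open>Spec O\<^sub>x\<close> is quasi-compact. Such a set is a
  finite union of continuous images of quasi-compact sets, hence quasi-compact. If these sets form
  a basis, then conversely every quasi-compact open set is a finite union of them, hence one of
  them (\<open>openin_compactin_Xt_iff\<close>). All three claims can then be read off on the traces, because the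
  quasi-compact open subsets of one spectrum are those cut out by finitely many ring elements, and
  these are stable under intersection.

  To find a basic neighbourhood of a point inside an open set \<open>W\<close>, start with a principal open subset of
  one \<open>Spec O\<^sub>x\<close> inside \<open>W\<close>, which is a quasi-compact open set of the part of the limit over \<open>U\<^sub>x\<close>, and
  extend it over \<open>U\<^sub>z\<close> for one point \<open>z\<close> after the other (\<open>quasicompact_extend\<close>). If \<open>V\<close> has been
  constructed over an open set \<open>Y\<close>, then the portion of \<open>V\<close> over \<open>Y \<inter> U\<^sub>z\<close> has to be cut out by
  finitely many elements of \<open>O\<^sub>z\<close>. Finitely many suffice by quasi-compactness. That one element is
  available at each point is the geometric core (\<open>obtain_basic_neighbourhood\<close>): the part over
  \<open>Y \<inter> U\<^sub>z\<close>, topologized by its pieces \<open>Spec O\<^sub>u\<close>, is a subspace of \<open>Spec O\<^sub>z\<close>. Indeed a closed subset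
  of this part is a finite union of images of closed subsets of the \<open>Spec O\<^sub>u\<close>, so every point \<open>p\<close> of
  its closure in \<open>Spec O\<^sub>z\<close> is a specialization of one of its points. If \<open>p\<close> lies in the image of
  \<open>Spec O\<^sub>v\<close>, then going down lifts this specialization to \<open>Spec O\<^sub>v\<close>, where the subset is closed.

  The argument needs two facts about the transition maps \<open>Spec O\<^sub>y \<rightarrow> Spec O\<^sub>x\<close>: going down, and
  that points of \<open>Spec O\<^sub>y\<close> and \<open>Spec O\<^sub>z\<close> with the same image in \<open>Spec O\<^sub>x\<close> come from a point of
  some \<open>Spec O\<^sub>t\<close> with \<open>t \<in> U\<^sub>y \<inter> U\<^sub>z\<close>. Both are proved over the ring \<open>A\<close> of sections of an affine
  chart. For the second one, primes of \<open>O\<^sub>y\<close> and \<open>O\<^sub>z\<close> with the same contraction to \<open>A\<close> lie under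
  a common prime of \<open>O\<^sub>y \<otimes>\<^sub>A O\<^sub>z \<cong> O\<^sub>y\<^sub>z\<close> (\<open>obtain_common_prime\<close>), and that prime lies under a prime
  of some \<open>O\<^sub>t\<close> because \<open>O\<^sub>y\<^sub>z \<rightarrow> \<Prod> O\<^sub>t\<close> is faithfully flat (\<open>chart_common_point\<close>). The case \<open>y = z\<close>
  shows that \<open>Spec O\<^sub>y \<rightarrow> Spec A\<close> is injective. Going down from \<open>A\<close> to \<open>O\<^sub>y\<close> follows from the flatness of
  \<open>A \<rightarrow> \<Prod> O\<^sub>x\<close> (\<open>chart_going_down\<close>), and injectivity turns it into going down from \<open>O\<^sub>x\<close> to \<open>O\<^sub>y\<close>.

  The commutative algebra is done with elements. Every prime ideal that is needed contains a given
  ideal and avoids a given multiplicative set, so only their disjointness has to be shown. For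
  faithfully flat homomorphisms and for tensor products this amounts to the non-vanishing of an
  element of a tensor product, which is detected by evaluating a balanced map, which need only be balanced modulo a subgroup
  (\<open>free_lift_kernel\<close>, \<open>obtain_separating_subgroup\<close>).\<close>

section \<open>Prime ideals and the Zariski topology\<close>

lemma (in cring) ideal_iff_closed:
  "ideal I R \<longleftrightarrow> I \<subseteq> carrier R \<and> \<zero> \<in> I \<and> (\<forall>a\<in>I. \<forall>b\<in>I. a \<oplus> b \<in> I)
     \<and> (\<forall>a\<in>I. \<forall>x\<in>carrier R. x \<otimes> a \<in> I)" (is "_ \<longleftrightarrow> ?closed")
proof
  assume "ideal I R"
  then interpret ideal I R .
  show ?closed
    using a_subset zero_closed a_closed I_l_closed by blast
next
  assume I: ?closed
  show "ideal I R"
  proof (rule idealI)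
    show "ring R" by (rule ring_axioms)
    show "subgroup I (add_monoid R)"
    proof (rule add.subgroupI)
      fix a assume a: "a \<in> I"
      then have "(\<ominus> \<one>) \<otimes> a \<in> I" "a \<in> carrier R" using I by auto
      moreover have "(\<ominus> \<one>) \<otimes> a = \<ominus> a" if "a \<in> carrier R" for a
        using that by (simp add: l_minus)
      ultimately show "\<ominus> a \<in> I" by simp
    qed (use I in auto)
    show "a \<otimes> x \<in> I" if "a \<in> I" "x \<in> carrier R" for a x
      using I that m_comm[of x a] by (metis subsetD)
  qed (use I in auto)
qed

lemma (in cring) Spec_closed:
  assumes "p \<in> Spec R"
  shows "p \<subseteq> carrier R" "\<zero> \<in> p" "\<one> \<notin> p"
    and "\<And>a b. a \<in> carrier R \<Longrightarrow> b \<in> carrier R \<Longrightarrow> a \<otimes> b \<in> p \<longleftrightarrow> a \<in> p \<or> b \<in> p"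
    and "\<And>a b. a \<in> p \<Longrightarrow> b \<in> p \<Longrightarrow> a \<oplus> b \<in> p"
    and "\<And>a b. a \<in> p \<Longrightarrow> b \<in> p \<Longrightarrow> a \<ominus> b \<in> p"
    and "\<And>a. a \<in> p \<Longrightarrow> \<ominus> a \<in> p"
proof -
  interpret primeideal p R using assms by (simp add: Spec_def)
  show "p \<subseteq> carrier R" "\<zero> \<in> p"
    "\<And>a b. a \<in> p \<Longrightarrow> b \<in> p \<Longrightarrow> a \<oplus> b \<in> p" "\<And>a. a \<in> p \<Longrightarrow> \<ominus> a \<in> p"
    "\<And>a b. a \<in> p \<Longrightarrow> b \<in> p \<Longrightarrow> a \<ominus> b \<in> p"
    using a_subset by (auto simp: minus_eq)
  show "\<one> \<notin> p" using one_imp_carrier I_notcarr by blast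
  show "\<And>a b. a \<in> carrier R \<Longrightarrow> b \<in> carrier R \<Longrightarrow> a \<otimes> b \<in> p \<longleftrightarrow> a \<in> p \<or> b \<in> p"
    using I_prime I_l_closed I_r_closed by blast
qed

lemma (in cring) SpecI:
  assumes "p \<subseteq> carrier R" "\<zero> \<in> p" "\<one> \<notin> p"
    and "\<And>a b. a \<in> p \<Longrightarrow> b \<in> p \<Longrightarrow> a \<oplus> b \<in> p"
    and "\<And>a x. a \<in> p \<Longrightarrow> x \<in> carrier R \<Longrightarrow> x \<otimes> a \<in> p"
    and "\<And>a b. a \<in> carrier R \<Longrightarrow> b \<in> carrier R \<Longrightarrow> a \<otimes> b \<in> p \<Longrightarrow> a \<in> p \<or> b \<in> p"
  shows "p \<in> Spec R"
proof -
  have "ideal p R"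
    unfolding ideal_iff_closed using assms(1,2,4,5) by blast
  moreover have "carrier R \<noteq> p" using assms(3) by blast
  ultimately show ?thesis
    unfolding Spec_def using assms(6) by (intro CollectI primeidealI is_cring)
qed

text \<open>Krull's theorem: an ideal that is maximal among those avoiding the multiplicative set is
  prime.\<close>

lemma (in cring) obtain_prime_disjoint:
  assumes I: "ideal I R"
    and S: "S \<subseteq> carrier R" "\<one> \<in> S" "\<And>s t. s \<in> S \<Longrightarrow> t \<in> S \<Longrightarrow> s \<otimes> t \<in> S"
    and disj: "I \<inter> S = {}"
  obtains p where "p \<in> Spec R" "I \<subseteq> p" "p \<inter> S = {}"
proof -
  let ?A = "{J. ideal J R \<and> I \<subseteq> J \<and> J \<inter> S = {}}"
  have "\<exists>M\<in>?A. \<forall>N\<in>?A. M \<subseteq> N \<longrightarrow> N = M"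
  proof (rule subset_Zorn_nonempty)
    show "?A \<noteq> {}" using I disj by blast
    fix C assume C: "C \<noteq> {}" "subset.chain ?A C"
    then have "C \<subseteq> ?A" "subset.chain {I. ideal I R} C"
      by (auto simp: pred_on.chain_def)
    then have "ideal (\<Union>C) R"
      using chain_Union_is_ideal[of C] C(1) by auto
    then show "\<Union>C \<in> ?A" using C(1) \<open>C \<subseteq> ?A\<close> by blast
  qed
  then obtain M where "M \<in> ?A" and max': "\<forall>N\<in>?A. M \<subseteq> N \<longrightarrow> N = M" by (elim bexE)
  then have M: "ideal M R" "I \<subseteq> M" "M \<inter> S = {}" by auto
  have max: "\<And>N. ideal N R \<Longrightarrow> N \<inter> S = {} \<Longrightarrow> M \<subseteq> N \<Longrightarrow> N = M"
    by (rule max'[rule_format]) (use M(2) in auto)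
  interpret M: ideal M R by (rule M(1))
  \<comment> \<open>Adjoining any further element to \<open>M\<close> produces an element of \<open>S\<close>; two such elements multiply into \<open>M\<close>.\<close>
  have meets: "\<exists>m\<in>M. \<exists>r\<in>carrier R. m \<oplus> r \<otimes> a \<in> S" if a: "a \<in> carrier R" "a \<notin> M" for a
  proof -
    let ?N = "M <+>\<^bsub>R\<^esub> PIdl a"
    have N: "ideal ?N R" by (intro add_ideals M(1) cgenideal_ideal a)
    have "M \<subseteq> ?N" "a \<in> ?N"
    proof -
      have z: "\<zero> \<in> PIdl a" using cgenideal_ideal[OF a(1)] by (simp add: ideal_iff_closed)
      show "M \<subseteq> ?N"
      proof
        fix m assume "m \<in> M"
        moreover from this have "m = m \<oplus> \<zero>" using M.Icarr by simp
        ultimately show "m \<in> ?N" using z unfolding set_add_def' by blast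
      qed
      have "a = \<zero> \<oplus> a" using a by simp
      then show "a \<in> ?N" using M.zero_closed cgenideal_self[OF a(1)] unfolding set_add_def' by blast
    qed
    then have "?N \<inter> S \<noteq> {}" using max[OF N] a(2) by blast
    then show ?thesis unfolding set_add_def' cgenideal_def by blast
  qed
  have "M \<in> Spec R"
  proof (rule SpecI)
    fix a b assume ab: "a \<in> carrier R" "b \<in> carrier R" "a \<otimes> b \<in> M"
    show "a \<in> M \<or> b \<in> M"
    proof (rule ccontr)
      assume "\<not> ?thesis"
      with meets ab obtain m r m' r' where m: "m \<in> M" "r \<in> carrier R" "m \<oplus> r \<otimes> a \<in> S"
        and m': "m' \<in> M" "r' \<in> carrier R" "m' \<oplus> r' \<otimes> b \<in> S" by metis
      have c: "m \<in> carrier R" "m' \<in> carrier R" using m m' M.Icarr by auto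
      have "(m \<oplus> r \<otimes> a) \<otimes> (m' \<oplus> r' \<otimes> b) =
        (m' \<oplus> r' \<otimes> b) \<otimes> m \<oplus> ((r \<otimes> a) \<otimes> m' \<oplus> (r \<otimes> r') \<otimes> (a \<otimes> b))"
        using c m(2) m'(2) ab by algebra
      also have "\<dots> \<in> M"
        using c m m' ab
        by (intro M.a_closed M.I_l_closed[OF m(1)] M.I_l_closed[OF m'(1)] M.I_l_closed[OF ab(3)]) auto
      finally show False using S(3)[OF m(3) m'(3)] M(3) by blast
    qed
  next
    show "\<one> \<notin> M" using M(3) S(2) by blast
  qed (use M.a_subset M.zero_closed M.a_closed M.I_l_closed in auto)
  then show thesis using that M by blast
qed

definition Spec_open :: "('a, 'k) ring_scheme \<Rightarrow> 'a set \<Rightarrow> 'a set set" where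
  "Spec_open R E = {p \<in> Spec R. \<not> E \<subseteq> p}"

lemma openin_zariski_iff: "openin (zariski R) W \<longleftrightarrow> (\<exists>E\<subseteq>carrier R. W = Spec_open R E)"
  by (simp add: openin_zariski Spec_open_def)

lemma openin_Spec_open: "E \<subseteq> carrier R \<Longrightarrow> openin (zariski R) (Spec_open R E)"
  by (auto simp: openin_zariski_iff)

lemma Spec_open_UN: "Spec_open R E = (\<Union>f\<in>E. Spec_open R {f})"
  by (auto simp: Spec_open_def)

lemma Spec_open_Int:
  assumes "cring R" "D \<subseteq> carrier R" "E \<subseteq> carrier R"
  shows "Spec_open R D \<inter> Spec_open R E = Spec_open R ((\<lambda>(a, b). a \<otimes>\<^bsub>R\<^esub> b) ` (D \<times> E))"
proof -
  interpret cring R by fact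
  show ?thesis
    using assms(2,3) Spec_closed(4) unfolding Spec_open_def by (fastforce simp: subset_iff)
qed

text \<open>The elements whose non-vanishing locus is covered by finitely many members of a given cover form an
  ideal. If it contains no power of \<open>f\<close>, some prime contains this ideal and avoids the powers of
  \<open>f\<close>. That prime lies in a member of the cover, hence has a principal neighbourhood inside this
  member. The element defining the neighbourhood belongs to the ideal but not to the prime, a
  contradiction.\<close>

lemma (in cring) compactin_basic_open:
  assumes f: "f \<in> carrier R"
  shows "compactin (zariski R) (Spec_open R {f})"
  unfolding compactin_def
proof (intro conjI allI impI)
  show "Spec_open R {f} \<subseteq> topspace (zariski R)" by (auto simp: Spec_open_def)
  fix \<U> assume \<U>: "(\<forall>U\<in>\<U>. openin (zariski R) U) \<and> Spec_open R {f} \<subseteq> \<Union>\<U>"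
  let ?fin = "\<lambda>a. \<exists>\<F>. finite \<F> \<and> \<F> \<subseteq> \<U> \<and> Spec_open R {a} \<subseteq> \<Union>\<F>"
  let ?I = "{a \<in> carrier R. ?fin a}"
  have I: "ideal ?I R"
    unfolding ideal_iff_closed
  proof (intro conjI ballI)
    have "Spec_open R {\<zero>} \<subseteq> \<Union>{}" using Spec_closed(2) by (auto simp: Spec_open_def)
    then show "\<zero> \<in> ?I" by blast
  next
    fix a b assume a: "a \<in> ?I" and b: "b \<in> ?I"
    then obtain \<F> \<G> where "finite \<F>" "\<F> \<subseteq> \<U>" "Spec_open R {a} \<subseteq> \<Union>\<F>"
      "finite \<G>" "\<G> \<subseteq> \<U>" "Spec_open R {b} \<subseteq> \<Union>\<G>" by blast
    moreover have "Spec_open R {a \<oplus> b} \<subseteq> Spec_open R {a} \<union> Spec_open R {b}"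
      using Spec_closed(5) by (auto simp: Spec_open_def)
    ultimately have "finite (\<F> \<union> \<G>)" "\<F> \<union> \<G> \<subseteq> \<U>" "Spec_open R {a \<oplus> b} \<subseteq> \<Union>(\<F> \<union> \<G>)"
      by auto
    then have "?fin (a \<oplus> b)" by blast
    then show "a \<oplus> b \<in> ?I" using a b by simp
  next
    fix a x assume a: "a \<in> ?I" and x: "x \<in> carrier R"
    then have "Spec_open R {x \<otimes> a} \<subseteq> Spec_open R {a}"
      using Spec_closed(4) by (auto simp: Spec_open_def)
    moreover obtain \<F> where "finite \<F>" "\<F> \<subseteq> \<U>" "Spec_open R {a} \<subseteq> \<Union>\<F>"
      using a by auto
    ultimately have "?fin (x \<otimes> a)" by (meson subset_trans)
    then show "x \<otimes> a \<in> ?I" using a x by simp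
  qed auto
  show "?fin f"
  proof (rule ccontr)
    assume nf: "\<not> ?fin f"
    let ?S = "{f [^] n | n :: nat. True}"
    have pow: "p \<in> Spec R \<Longrightarrow> f \<notin> p \<Longrightarrow> f [^] n \<notin> p" for p and n :: nat
      using f Spec_closed(3,4) by (induction n) auto
    obtain p where p: "p \<in> Spec R" "?I \<subseteq> p" "p \<inter> ?S = {}"
    proof (rule obtain_prime_disjoint[OF I, of ?S])
      show "\<one> \<in> ?S" using nat_pow_0[of f] by (metis (mono_tags, lifting) mem_Collect_eq)
      show "s \<otimes> t \<in> ?S" if "s \<in> ?S" "t \<in> ?S" for s t
        using that f by (auto simp: nat_pow_mult)
      show "?I \<inter> ?S = {}"
      proof -
        have "\<not> ?fin (f [^] n)" for n :: nat
        proof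
          assume "?fin (f [^] n)"
          moreover have "Spec_open R {f} \<subseteq> Spec_open R {f [^] n}"
            using pow by (auto simp: Spec_open_def)
          ultimately show False using nf by blast
        qed
        then show ?thesis by blast
      qed
    qed (use f in auto)
    have "f [^] (1::nat) \<in> ?S" by blast
    then have "f \<notin> p" using p f by auto
    then obtain U where U: "U \<in> \<U>" "p \<in> U" using \<U> p(1) by (auto simp: Spec_open_def)
    then obtain E where E: "E \<subseteq> carrier R" "U = Spec_open R E"
      using \<U> by (auto simp: openin_zariski_iff)
    then obtain e where e: "e \<in> E" "e \<notin> p" using U by (auto simp: Spec_open_def)
    have "Spec_open R {e} \<subseteq> \<Union>{U}" using e E by (auto simp: Spec_open_def)
    moreover have "finite {U}" "{U} \<subseteq> \<U>" using U by auto
    ultimately have "?fin e" by blast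
    then show False using e p(2) E by blast
  qed
qed

lemma openin_compactin_zariski_iff:
  assumes "cring R"
  shows "openin (zariski R) W \<and> compactin (zariski R) W \<longleftrightarrow>
    (\<exists>E\<subseteq>carrier R. finite E \<and> W = Spec_open R E)" (is "?l \<longleftrightarrow> ?r")
proof
  interpret cring R by fact
  assume ?r
  then obtain E where E: "E \<subseteq> carrier R" "finite E" "W = Spec_open R E" by blast
  have "compactin (zariski R) (\<Union>f\<in>E. Spec_open R {f})"
    by (rule compactin_Union) (use E compactin_basic_open in auto)
  then show ?l using E openin_Spec_open by (metis Spec_open_UN)
next
  assume l: ?l
  then obtain E where E: "E \<subseteq> carrier R" "W = Spec_open R E"
    by (auto simp: openin_zariski_iff)
  have "openin (zariski R) U" if "U \<in> (\<lambda>f. Spec_open R {f}) ` E" for U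
    using that E(1) by (auto intro: openin_Spec_open)
  moreover have "W \<subseteq> \<Union>((\<lambda>f. Spec_open R {f}) ` E)"
    using E(2) Spec_open_UN[of R E] by blast
  ultimately obtain \<F> where \<F>: "finite \<F>" "\<F> \<subseteq> (\<lambda>f. Spec_open R {f}) ` E" "W \<subseteq> \<Union>\<F>"
    using l compactinD[of "zariski R" W "(\<lambda>f. Spec_open R {f}) ` E"] by blast
  then obtain D where D: "D \<subseteq> E" "finite D" "\<F> = (\<lambda>f. Spec_open R {f}) ` D"
    using finite_subset_image[OF \<F>(1,2)] by blast
  have "W = Spec_open R D"
  proof
    show "W \<subseteq> Spec_open R D" using \<F>(3) D(3) by (auto simp: Spec_open_def)
    show "Spec_open R D \<subseteq> W" using E(2) D(1) by (auto simp: Spec_open_def)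
  qed
  then show ?r using D E by blast
qed

lemma Spec_map_in_Spec:
  assumes "cring A" "cring B" "f \<in> ring_hom A B" "q \<in> Spec B"
  shows "Spec_map A f q \<in> Spec A"
proof -
  interpret A: cring A by fact
  interpret B: cring B by fact
  interpret h: ring_hom_cring A B f
    by unfold_locales (rule assms)
  show ?thesis
    by (rule A.SpecI) (use B.Spec_closed[OF assms(4)] in \<open>auto simp: Spec_map_def\<close>)
qed

lemma Spec_map_mono: "q \<subseteq> q' \<Longrightarrow> Spec_map A f q \<subseteq> Spec_map A f q'"
  by (auto simp: Spec_map_def)

lemma Spec_map_comp:
  assumes "f \<in> ring_hom A B" "\<And>a. a \<in> carrier A \<Longrightarrow> g (f a) = h a"
  shows "Spec_map A f (Spec_map B g q) = Spec_map A h q"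
  using assms ring_hom_closed[OF assms(1)] by (auto simp: Spec_map_def)

lemma Spec_map_in_Spec_open_iff:
  assumes "cring A" "cring B" "f \<in> ring_hom A B" "q \<in> Spec B" "E \<subseteq> carrier A"
  shows "Spec_map A f q \<in> Spec_open A E \<longleftrightarrow> q \<in> Spec_open B (f ` E)"
  using Spec_map_in_Spec[OF assms(1-4)] assms(4,5)
  by (auto simp: Spec_open_def Spec_map_def subset_iff)

section \<open>Tensor products\<close>

text \<open>The homomorphism out of a free abelian group that is prescribed on the generators, with the
  multiplicative notation for its target.\<close>

definition free_lift :: "('t, 's) monoid_scheme \<Rightarrow> ('p \<Rightarrow> 't) \<Rightarrow> ('p \<Rightarrow>\<^sub>0 int) \<Rightarrow> 't" where
  "free_lift T b z = finprod T (\<lambda>p. b p [^]\<^bsub>T\<^esub> Poly_Mapping.lookup z p) (Poly_Mapping.keys z)"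

lemma tensor_lift_eq: "tensor_lift T b C = the_elem (free_lift T b ` C)"
  by (simp add: tensor_lift_def free_lift_def)

lemma (in comm_group) mult_inv_inv:
  assumes "x \<in> carrier G" "y \<in> carrier G"
  shows "x \<otimes> y \<otimes> inv x \<otimes> inv y = \<one>"
  using assms by (simp add: m_assoc m_comm[of x y] inv_mult_group[symmetric] m_lcomm)

lemma free_lift_superset:
  assumes "comm_group T" "b \<in> F \<rightarrow> carrier T" "Poly_Mapping.keys z \<subseteq> F" "finite F"
  shows "free_lift T b z = finprod T (\<lambda>p. b p [^]\<^bsub>T\<^esub> Poly_Mapping.lookup z p) F"
proof -
  interpret T: comm_group T by fact
  show ?thesis
    unfolding free_lift_def
    by (rule T.finprod_mono_neutral_cong_left)
      (use assms in \<open>auto simp: in_keys_iff Pi_iff\<close>)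
qed

lemma free_lift_frag_of:
  assumes "comm_group T" "b p \<in> carrier T"
  shows "free_lift T b (frag_of p) = b p"
proof -
  interpret T: comm_group T by fact
  have "free_lift T b (frag_of p) = finprod T (\<lambda>q. b q [^]\<^bsub>T\<^esub> Poly_Mapping.lookup (frag_of p) q) {p}"
    using assms by (intro free_lift_superset) auto
  then show ?thesis using assms T.int_pow_1 by (simp add: T.finprod_singleton_swap)
qed

lemma free_lift_hom:
  assumes "comm_group T" "b \<in> S \<rightarrow> carrier T"
  shows "free_lift T b \<in> hom (free_Abelian_group S) T"
proof (rule homI)
  interpret T: comm_group T by fact
  fix z w assume "z \<in> carrier (free_Abelian_group S)" "w \<in> carrier (free_Abelian_group S)"
  then have zw: "Poly_Mapping.keys z \<subseteq> S" "Poly_Mapping.keys w \<subseteq> S" by auto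
  let ?F = "Poly_Mapping.keys z \<union> Poly_Mapping.keys w"
  have b: "b \<in> ?F \<rightarrow> carrier T" using zw assms(2) by blast
  have "Poly_Mapping.keys (z + w) \<subseteq> ?F" by (rule keys_add)
  then have "free_lift T b (z + w)
      = finprod T (\<lambda>p. b p [^]\<^bsub>T\<^esub> Poly_Mapping.lookup (z + w) p) ?F"
    using b by (intro free_lift_superset assms(1)) auto
  also have "\<dots> = finprod T (\<lambda>p. b p [^]\<^bsub>T\<^esub> Poly_Mapping.lookup z p \<otimes>\<^bsub>T\<^esub> b p [^]\<^bsub>T\<^esub> Poly_Mapping.lookup w p) ?F"
    by (rule T.finprod_cong') (use b in \<open>auto simp: lookup_add T.int_pow_mult Pi_iff\<close>)
  also have "\<dots> = finprod T (\<lambda>p. b p [^]\<^bsub>T\<^esub> Poly_Mapping.lookup z p) ?F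
      \<otimes>\<^bsub>T\<^esub> finprod T (\<lambda>p. b p [^]\<^bsub>T\<^esub> Poly_Mapping.lookup w p) ?F"
    by (rule T.finprod_multf) (use b in \<open>auto simp: Pi_iff\<close>)
  also have "\<dots> = free_lift T b z \<otimes>\<^bsub>T\<^esub> free_lift T b w"
    using free_lift_superset[OF assms(1) b] by simp
  finally show "free_lift T b (z \<otimes>\<^bsub>free_Abelian_group S\<^esub> w) = free_lift T b z \<otimes>\<^bsub>T\<^esub> free_lift T b w"
    by simp
next
  interpret T: comm_group T by fact
  fix z assume "z \<in> carrier (free_Abelian_group S)"
  then show "free_lift T b z \<in> carrier T"
    unfolding free_lift_def using assms(2) by (intro T.finprod_closed) (auto simp: Pi_iff)
qed

lemma free_lift_diff:
  assumes "comm_group T" "b \<in> S \<rightarrow> carrier T" "Poly_Mapping.keys z \<subseteq> S" "Poly_Mapping.keys w \<subseteq> S"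
  shows "free_lift T b (z - w) = free_lift T b z \<otimes>\<^bsub>T\<^esub> inv\<^bsub>T\<^esub> free_lift T b w"
proof -
  interpret h: group_hom "free_Abelian_group S" T "free_lift T b"
    using assms free_lift_hom[OF assms(1,2)]
    by (auto simp: group_hom_def group_hom_axioms_def comm_group_def)
  have "free_lift T b (z \<otimes>\<^bsub>free_Abelian_group S\<^esub> inv\<^bsub>free_Abelian_group S\<^esub> w) = free_lift T b z \<otimes>\<^bsub>T\<^esub> inv\<^bsub>T\<^esub> free_lift T b w"
    using assms(3,4) h.hom_mult[of z "- w"] h.hom_inv[of w] by simp
  then show ?thesis using assms(4) by simp
qed

text \<open>Working modulo a subgroup \<open>Z\<close> of the target makes it possible to detect elements of a tensor
  product without forming a quotient of the target; \<open>Z = {\<one>}\<close> is the usual notion.\<close>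

definition balanced_mod ::
  "('a, 'k) ring_scheme \<Rightarrow> ('a, 'm, 'u) module_scheme \<Rightarrow> ('a, 'n, 'v) module_scheme
    \<Rightarrow> ('t, 's) monoid_scheme \<Rightarrow> 't set \<Rightarrow> ('m \<times> 'n \<Rightarrow> 't) \<Rightarrow> bool" where
  "balanced_mod A M N T Z b \<longleftrightarrow> b \<in> carrier M \<times> carrier N \<rightarrow> carrier T \<and>
     (\<forall>x\<in>carrier M. \<forall>x'\<in>carrier M. \<forall>y\<in>carrier N.
        b (x \<oplus>\<^bsub>M\<^esub> x', y) \<otimes>\<^bsub>T\<^esub> inv\<^bsub>T\<^esub> b (x, y) \<otimes>\<^bsub>T\<^esub> inv\<^bsub>T\<^esub> b (x', y) \<in> Z) \<and>
     (\<forall>x\<in>carrier M. \<forall>y\<in>carrier N. \<forall>y'\<in>carrier N.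
        b (x, y \<oplus>\<^bsub>N\<^esub> y') \<otimes>\<^bsub>T\<^esub> inv\<^bsub>T\<^esub> b (x, y) \<otimes>\<^bsub>T\<^esub> inv\<^bsub>T\<^esub> b (x, y') \<in> Z) \<and>
     (\<forall>a\<in>carrier A. \<forall>x\<in>carrier M. \<forall>y\<in>carrier N.
        b (a \<odot>\<^bsub>M\<^esub> x, y) \<otimes>\<^bsub>T\<^esub> inv\<^bsub>T\<^esub> b (x, a \<odot>\<^bsub>N\<^esub> y) \<in> Z)"

locale tensor_product =
  fixes A :: "('a, 'k) ring_scheme" and M :: "('a, 'm, 'u) module_scheme"
    and N :: "('a, 'n, 'v) module_scheme"
  assumes M: "Module.module A M" and N: "Module.module A N"
begin

sublocale M: Module.module A M by (rule M)
sublocale N: Module.module A N by (rule N)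

abbreviation G where "G \<equiv> free_Abelian_group (carrier M \<times> carrier N)"
abbreviation K where "K \<equiv> tensor_kernel A M N"
abbreviation MN where "MN \<equiv> tensor A M N"
abbreviation pt where "pt \<equiv> pure_tensor A M N"

sublocale G: comm_group G by (rule abelian_free_Abelian_group)

lemma relations_subset: "tensor_relations A M N \<subseteq> carrier G"
proof -
  have diff: "Poly_Mapping.keys (z - w) \<subseteq> S"
    if "Poly_Mapping.keys z \<subseteq> S" "Poly_Mapping.keys w \<subseteq> S" for z w :: "('m \<times> 'n) \<Rightarrow>\<^sub>0 int" and S
    using keys_diff[of z w] that by blast
  show ?thesis
    unfolding tensor_relations_def
    by (intro Un_least subsetI; elim CollectE exE conjE; hypsubst;
        unfold carrier_free_Abelian_group_iff; intro diff; simp)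
qed

lemma K_subgroup: "subgroup K G"
  unfolding tensor_kernel_def by (rule G.generate_is_subgroup[OF relations_subset])

lemma K_normal: "K \<lhd> G"
  using K_subgroup by (rule G.subgroup_imp_normal)

sublocale MN: comm_group MN
  unfolding tensor_def by (rule G.abelian_FactGroup[OF K_subgroup])

lemma proj_hom: "(\<lambda>z. K #>\<^bsub>G\<^esub> z) \<in> hom G MN"
  unfolding tensor_def by (rule normal.r_coset_hom_Mod[OF K_normal])

sublocale proj: group_hom G MN "\<lambda>z. K #>\<^bsub>G\<^esub> z"
  by unfold_locales (rule proj_hom)

lemma carrier_MN: "carrier MN = (\<lambda>z. K #>\<^bsub>G\<^esub> z) ` carrier G"
  by (simp add: tensor_def carrier_FactGroup)

lemma pt_eq: "pt x y = K #>\<^bsub>G\<^esub> frag_of (x, y)"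
  by (simp add: pure_tensor_def)

lemma pt_closed [simp]: "x \<in> carrier M \<Longrightarrow> y \<in> carrier N \<Longrightarrow> pt x y \<in> carrier MN"
  unfolding pt_eq by (rule proj.hom_closed) simp

lemma coset_eq_iff:
  assumes "z \<in> carrier G" "w \<in> carrier G"
  shows "K #>\<^bsub>G\<^esub> z = K #>\<^bsub>G\<^esub> w \<longleftrightarrow> z - w \<in> K"
proof -
  have "z \<otimes>\<^bsub>G\<^esub> inv\<^bsub>G\<^esub> w = z - w" using assms by simp
  moreover have "z \<in> K #>\<^bsub>G\<^esub> w \<longleftrightarrow> z \<otimes>\<^bsub>G\<^esub> inv\<^bsub>G\<^esub> w \<in> K"
    using assms by (intro subgroup.rcos_module[OF K_subgroup]) auto
  moreover have "K #>\<^bsub>G\<^esub> z = K #>\<^bsub>G\<^esub> w \<longleftrightarrow> z \<in> K #>\<^bsub>G\<^esub> w"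
    using G.repr_independence[OF _ assms(2) K_subgroup] G.rcos_self[OF assms(1) K_subgroup] by blast
  ultimately show ?thesis by simp
qed

lemma coset_diff:
  assumes "z \<in> carrier G" "w \<in> carrier G"
  shows "K #>\<^bsub>G\<^esub> (z - w) = (K #>\<^bsub>G\<^esub> z) \<otimes>\<^bsub>MN\<^esub> inv\<^bsub>MN\<^esub> (K #>\<^bsub>G\<^esub> w)"
  using proj.hom_mult[of z "- w"] proj.hom_inv[of w] assms by simp

lemma relation_coset:
  assumes "frag_of p - frag_of q - frag_of r \<in> tensor_relations A M N"
    and pqr: "p \<in> carrier M \<times> carrier N" "q \<in> carrier M \<times> carrier N" "r \<in> carrier M \<times> carrier N"
  shows "K #>\<^bsub>G\<^esub> frag_of p = (K #>\<^bsub>G\<^esub> frag_of q) \<otimes>\<^bsub>MN\<^esub> (K #>\<^bsub>G\<^esub> frag_of r)"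
proof -
  have "frag_of p - (frag_of q + frag_of r) \<in> K"
    using assms(1) unfolding tensor_kernel_def by (simp add: generate.incl diff_diff_eq)
  moreover have "frag_of q + frag_of r \<in> carrier G"
    using G.m_closed[of "frag_of q" "frag_of r"] pqr by simp
  ultimately have "K #>\<^bsub>G\<^esub> frag_of p = K #>\<^bsub>G\<^esub> (frag_of q + frag_of r)"
    using pqr by (subst coset_eq_iff) auto
  then show ?thesis using proj.hom_mult[of "frag_of q" "frag_of r"] pqr by simp
qed

lemma pt_add_left:
  assumes "x \<in> carrier M" "x' \<in> carrier M" "y \<in> carrier N"
  shows "pt (x \<oplus>\<^bsub>M\<^esub> x') y = pt x y \<otimes>\<^bsub>MN\<^esub> pt x' y"
  unfolding pt_eq by (rule relation_coset) (use assms in \<open>auto simp: tensor_relations_def\<close>)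

lemma pt_add_right:
  assumes "x \<in> carrier M" "y \<in> carrier N" "y' \<in> carrier N"
  shows "pt x (y \<oplus>\<^bsub>N\<^esub> y') = pt x y \<otimes>\<^bsub>MN\<^esub> pt x y'"
  unfolding pt_eq by (rule relation_coset) (use assms in \<open>auto simp: tensor_relations_def\<close>)

lemma pt_smult:
  assumes "a \<in> carrier A" "x \<in> carrier M" "y \<in> carrier N"
  shows "pt (a \<odot>\<^bsub>M\<^esub> x) y = pt x (a \<odot>\<^bsub>N\<^esub> y)"
proof -
  have "frag_of (a \<odot>\<^bsub>M\<^esub> x, y) - frag_of (x, a \<odot>\<^bsub>N\<^esub> y) \<in> K"
    unfolding tensor_kernel_def
    by (rule generate.incl) (use assms in \<open>auto simp: tensor_relations_def\<close>)
  then show ?thesis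
    unfolding pt_eq using assms by (subst coset_eq_iff) auto
qed

lemma pt_zero_right:
  assumes "x \<in> carrier M"
  shows "pt x \<zero>\<^bsub>N\<^esub> = \<one>\<^bsub>MN\<^esub>"
proof -
  have "pt x \<zero>\<^bsub>N\<^esub> = pt x \<zero>\<^bsub>N\<^esub> \<otimes>\<^bsub>MN\<^esub> pt x \<zero>\<^bsub>N\<^esub>"
    using pt_add_right[OF assms N.zero_closed N.zero_closed] by simp
  then show ?thesis using MN.r_cancel_one' assms by simp
qed

text \<open>Pure tensors generate, in the form of an induction principle.\<close>

lemma tensor_subgroup_eq_carrier:
  assumes H: "subgroup H MN" and pt: "\<And>x y. x \<in> carrier M \<Longrightarrow> y \<in> carrier N \<Longrightarrow> pt x y \<in> H"
  shows "H = carrier MN"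
proof
  show "H \<subseteq> carrier MN" using H by (rule subgroup.subset)
  show "carrier MN \<subseteq> H"
  proof
    fix t assume "t \<in> carrier MN"
    then obtain z where z: "Poly_Mapping.keys z \<subseteq> carrier M \<times> carrier N" "t = K #>\<^bsub>G\<^esub> z"
      by (auto simp: carrier_MN)
    have "K #>\<^bsub>G\<^esub> z \<in> H"
      using z(1)
    proof (rule free_Abelian_group_induct)
      show "K #>\<^bsub>G\<^esub> 0 \<in> H" using proj.hom_one subgroup.one_closed[OF H] by simp
    next
      fix z w assume "Poly_Mapping.keys z \<subseteq> carrier M \<times> carrier N" "K #>\<^bsub>G\<^esub> z \<in> H"
        "Poly_Mapping.keys w \<subseteq> carrier M \<times> carrier N" "K #>\<^bsub>G\<^esub> w \<in> H"
      then show "K #>\<^bsub>G\<^esub> (z - w) \<in> H"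
        by (subst coset_diff) (auto intro: subgroup.m_closed[OF H] subgroup.m_inv_closed[OF H])
    next
      fix p assume "p \<in> carrier M \<times> carrier N"
      then show "K #>\<^bsub>G\<^esub> frag_of p \<in> H" using pt by (cases p) (simp flip: pt_eq)
    qed
    then show "t \<in> H" using z by simp
  qed
qed

text \<open>Used in contrapositive form: a representative that a map balanced modulo \<open>Z\<close> does not
  send into \<open>Z\<close> represents a non-zero tensor.\<close>

lemma free_lift_kernel:
  assumes T: "comm_group T" and Z: "subgroup Z T" and b: "balanced_mod A M N T Z b" and z: "z \<in> K"
  shows "free_lift T b z \<in> Z"
proof -
  interpret T: comm_group T by fact
  have bc: "b \<in> carrier M \<times> carrier N \<rightarrow> carrier T" using b by (simp add: balanced_mod_def)
  interpret h: group_hom G T "free_lift T b"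
    by unfold_locales (rule free_lift_hom[OF T bc])
  let ?H = "{z \<in> carrier G. free_lift T b z \<in> Z}"
  have H: "subgroup ?H G"
  proof (rule G.subgroupI)
    show "?H \<noteq> {}" using subgroup.one_closed[OF Z] h.hom_one by (metis (mono_tags, lifting) G.one_closed empty_iff mem_Collect_eq)
    show "inv\<^bsub>G\<^esub> z \<in> ?H" if "z \<in> ?H" for z
      using that subgroup.m_inv_closed[OF Z] h.hom_inv[of z] G.inv_closed[of z] by (simp del: inv_free_Abelian_group carrier_free_Abelian_group_iff)
    show "z \<otimes>\<^bsub>G\<^esub> w \<in> ?H" if "z \<in> ?H" "w \<in> ?H" for z w
      using that subgroup.m_closed[OF Z] h.hom_mult[of z w] G.m_closed[of z w]
      by (simp del: mult_free_Abelian_group carrier_free_Abelian_group_iff)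
  qed auto
  have f: "free_lift T b (frag_of p) = b p" if "p \<in> carrier M \<times> carrier N" for p
    using that bc by (intro free_lift_frag_of T) auto
  have keys: "Poly_Mapping.keys (frag_of p - frag_of q) \<subseteq> carrier M \<times> carrier N"
    if "p \<in> carrier M \<times> carrier N" "q \<in> carrier M \<times> carrier N" for p q :: "'m \<times> 'n"
    using keys_diff[of "frag_of p" "frag_of q"] that by auto
  have "tensor_relations A M N \<subseteq> ?H"
  proof
    fix w assume w: "w \<in> tensor_relations A M N"
    then have "free_lift T b w \<in> Z"
      using b unfolding tensor_relations_def balanced_mod_def
      by (auto simp: free_lift_diff[OF T bc] keys f)
    then show "w \<in> ?H" using w relations_subset by blast
  qed
  then have "K \<subseteq> ?H" unfolding tensor_kernel_def using H by (rule G.generate_subgroup_incl)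
  then show ?thesis using z by blast
qed

text \<open>The homomorphism \<open>free_lift T b\<close> kills the relations, so it takes one value on each
  coset, and \<open>the_elem\<close> picks that value.\<close>

lemma tensor_lift_coset:
  assumes T: "comm_group T" and b: "balanced_mod A M N T {\<one>\<^bsub>T\<^esub>} b" and z: "z \<in> carrier G"
  shows "tensor_lift T b (K #>\<^bsub>G\<^esub> z) = free_lift T b z"
proof -
  interpret T: comm_group T by fact
  have bc: "b \<in> carrier M \<times> carrier N \<rightarrow> carrier T" using b by (simp add: balanced_mod_def)
  interpret h: group_hom G T "free_lift T b"
    by unfold_locales (rule free_lift_hom[OF T bc])
  have "free_lift T b w = free_lift T b z" if "w \<in> K #>\<^bsub>G\<^esub> z" for w
  proof -
    obtain k where k: "k \<in> K" "w = k \<otimes>\<^bsub>G\<^esub> z" using \<open>w \<in> _\<close> by (auto simp: r_coset_def)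
    have "k \<in> carrier G" using k subgroup.mem_carrier[OF K_subgroup] by blast
    then have "free_lift T b w = free_lift T b k \<otimes>\<^bsub>T\<^esub> free_lift T b z"
      unfolding k(2) using z by (rule h.hom_mult)
    then show ?thesis
      using free_lift_kernel[OF T T.triv_subgroup b k(1)] h.hom_closed[OF z] by simp
  qed
  moreover have "z \<in> K #>\<^bsub>G\<^esub> z" by (rule G.rcos_self[OF z K_subgroup])
  ultimately have "free_lift T b ` (K #>\<^bsub>G\<^esub> z) = {free_lift T b z}" by blast
  then show ?thesis by (simp add: tensor_lift_eq)
qed

lemma tensor_lift_hom:
  assumes T: "comm_group T" and b: "balanced_mod A M N T {\<one>\<^bsub>T\<^esub>} b"
  shows "tensor_lift T b \<in> hom MN T"
proof -
  have bc: "b \<in> carrier M \<times> carrier N \<rightarrow> carrier T" using b by (simp add: balanced_mod_def)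
  note h = free_lift_hom[OF T bc]
  show ?thesis
  proof (rule homI)
    fix t u assume "t \<in> carrier MN" "u \<in> carrier MN"
    then obtain z w where z: "z \<in> carrier G" "t = K #>\<^bsub>G\<^esub> z" and w: "w \<in> carrier G" "u = K #>\<^bsub>G\<^esub> w"
      unfolding carrier_MN by blast
    then have "t \<otimes>\<^bsub>MN\<^esub> u = K #>\<^bsub>G\<^esub> (z \<otimes>\<^bsub>G\<^esub> w)" using proj.hom_mult by metis
    then show "tensor_lift T b (t \<otimes>\<^bsub>MN\<^esub> u) = tensor_lift T b t \<otimes>\<^bsub>T\<^esub> tensor_lift T b u"
      using z w tensor_lift_coset[OF T b] G.m_closed[OF z(1) w(1)] hom_mult[OF h z(1) w(1)]
      by metis
  next
    fix t assume "t \<in> carrier MN"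
    then show "tensor_lift T b t \<in> carrier T"
      using tensor_lift_coset[OF T b] hom_in_carrier[OF h] by (auto simp: carrier_MN)
  qed
qed

lemma tensor_lift_pt:
  assumes T: "comm_group T" and b: "balanced_mod A M N T {\<one>\<^bsub>T\<^esub>} b"
    and "x \<in> carrier M" "y \<in> carrier N"
  shows "tensor_lift T b (pt x y) = b (x, y)"
  unfolding pt_eq using assms(3,4) b
  by (subst tensor_lift_coset[OF T b]) (auto simp: balanced_mod_def intro!: free_lift_frag_of T)

end

lemma algebra_module_module:
  assumes "cring A" "cring B" "f \<in> ring_hom A B"
  shows "Module.module A (algebra_module f B)"
proof -
  interpret A: cring A by fact
  interpret B: cring B by fact
  interpret h: ring_hom_cring A B f by unfold_locales (rule assms)
  have "abelian_group (algebra_module f B)"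
  proof (rule abelian_groupI)
    show "\<exists>y\<in>carrier (algebra_module f B). y \<oplus>\<^bsub>algebra_module f B\<^esub> x = \<zero>\<^bsub>algebra_module f B\<^esub>"
      if "x \<in> carrier (algebra_module f B)" for x
      using that by (intro bexI[of _ "\<ominus>\<^bsub>B\<^esub> x"]) (auto simp: algebra_module_def B.l_neg)
  qed (auto simp: algebra_module_def B.a_ac)
  then show ?thesis
    by (intro moduleI) (auto simp: algebra_module_def B.l_distr B.r_distr B.m_assoc A.is_cring)
qed

lemma tensor_map_eq:
  "tensor_map A M N g = tensor_lift (tensor A M N) (\<lambda>(x, y). pure_tensor A M N x (g y))"
  by (simp add: tensor_map_def)

lemma balanced_mod_tensor_map:
  assumes "tensor_product A M N'" "tensor_product A M N" "g \<in> module_homs A N' N"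
  shows "balanced_mod A M N' (tensor A M N) {\<one>\<^bsub>tensor A M N\<^esub>} (\<lambda>(x, y). pure_tensor A M N x (g y))"
proof -
  interpret P: tensor_product A M N' by fact
  interpret Q: tensor_product A M N by fact
  have g: "\<And>y. y \<in> carrier N' \<Longrightarrow> g y \<in> carrier N"
    "\<And>y y'. y \<in> carrier N' \<Longrightarrow> y' \<in> carrier N' \<Longrightarrow> g (y \<oplus>\<^bsub>N'\<^esub> y') = g y \<oplus>\<^bsub>N\<^esub> g y'"
    "\<And>a y. a \<in> carrier A \<Longrightarrow> y \<in> carrier N' \<Longrightarrow> g (a \<odot>\<^bsub>N'\<^esub> y) = a \<odot>\<^bsub>N\<^esub> g y"
    using assms(3) by (auto simp: module_homs_def hom_def)
  show ?thesis
    unfolding balanced_mod_def using g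
    by (auto simp: Q.pt_add_left Q.pt_add_right Q.pt_smult Q.MN.mult_inv_inv)
qed

section \<open>Spectra along faithfully flat homomorphisms\<close>

text \<open>The cyclic module \<open>A/I\<close>, realized on the type over which \<open>faithfully_flat\<close>
  quantifies. The coset of \<open>a\<close> is encoded by the sequences whose term at \<open>0\<close> lies in
  it; the remaining terms are arbitrary.\<close>

definition cyclic_elt :: "('a, 'k) ring_scheme \<Rightarrow> 'a set \<Rightarrow> 'a \<Rightarrow> (nat \<Rightarrow> 'a) set" where
  "cyclic_elt A I a = {h. h 0 \<in> carrier A \<and> h 0 \<ominus>\<^bsub>A\<^esub> a \<in> I}"

definition cyclic_rep :: "('a, 'k) ring_scheme \<Rightarrow> 'a set \<Rightarrow> (nat \<Rightarrow> 'a) set \<Rightarrow> 'a" where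
  "cyclic_rep A I c = (SOME a. a \<in> carrier A \<and> cyclic_elt A I a = c)"

definition cyclic_module :: "('a, 'k) ring_scheme \<Rightarrow> 'a set \<Rightarrow> ('a, (nat \<Rightarrow> 'a) set) module" where
  "cyclic_module A I =
     \<lparr>carrier = cyclic_elt A I ` carrier A,
      monoid.mult = (\<lambda>c d. cyclic_elt A I (cyclic_rep A I c \<otimes>\<^bsub>A\<^esub> cyclic_rep A I d)),
      one = cyclic_elt A I \<one>\<^bsub>A\<^esub>,
      ring.zero = cyclic_elt A I \<zero>\<^bsub>A\<^esub>,
      ring.add = (\<lambda>c d. cyclic_elt A I (cyclic_rep A I c \<oplus>\<^bsub>A\<^esub> cyclic_rep A I d)),
      smult = (\<lambda>a c. cyclic_elt A I (a \<otimes>\<^bsub>A\<^esub> cyclic_rep A I c))\<rparr>"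

locale cyclic_quotient = ideal I A + cring A for I and A :: "('a, 'k) ring_scheme" (structure)
begin

abbreviation Q where "Q \<equiv> cyclic_module A I"
abbreviation el where "el \<equiv> cyclic_elt A I"
abbreviation rep where "rep \<equiv> cyclic_rep A I"

lemma el_eq_iff:
  assumes a: "a \<in> carrier A" and b: "b \<in> carrier A"
  shows "el a = el b \<longleftrightarrow> a \<ominus> b \<in> I"
proof
  assume "el a = el b"
  moreover have "(\<lambda>_. a) \<in> el a" using a by (simp add: cyclic_elt_def minus_eq r_neg)
  ultimately show "a \<ominus> b \<in> I" by (auto simp: cyclic_elt_def)
next
  assume ab: "a \<ominus> b \<in> I"
  have "c \<ominus> a \<in> I \<longleftrightarrow> c \<ominus> b \<in> I" if c: "c \<in> carrier A" for c
  proof -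
    have 1: "c \<ominus> b = (c \<ominus> a) \<oplus> (a \<ominus> b)" "c \<ominus> a = (c \<ominus> b) \<ominus> (a \<ominus> b)"
      using a b c by algebra+
    have I_closed: "x \<oplus> y \<in> I" "x \<ominus> y \<in> I" if "x \<in> I" "y \<in> I" for x y
      using that additive_subgroup.a_closed[OF additive_subgroup_axioms]
        additive_subgroup.a_inv_closed[OF additive_subgroup_axioms] by (auto simp: minus_eq)
    show ?thesis
    proof
      assume "c \<ominus> a \<in> I"
      then show "c \<ominus> b \<in> I" unfolding 1(1) using ab by (rule I_closed)
    next
      assume "c \<ominus> b \<in> I"
      then show "c \<ominus> a \<in> I" unfolding 1(2) using ab by (rule I_closed)
    qed
  qed
  then show "el a = el b" by (auto simp: cyclic_elt_def)
qed

lemma el_closed [simp]: "a \<in> carrier A \<Longrightarrow> el a \<in> carrier Q"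
  by (simp add: cyclic_module_def)

lemma carrier_Q: "carrier Q = el ` carrier A"
  by (simp add: cyclic_module_def)

lemma rep: "c \<in> carrier Q \<Longrightarrow> rep c \<in> carrier A \<and> el (rep c) = c"
  unfolding cyclic_rep_def by (rule someI_ex) (auto simp: carrier_Q)

lemma rep_el:
  assumes "a \<in> carrier A"
  shows "rep (el a) \<in> carrier A" "rep (el a) \<ominus> a \<in> I"
  using rep[of "el a"] el_eq_iff[of "rep (el a)" a] assms by auto

lemma zero_Q: "\<zero>\<^bsub>Q\<^esub> = el \<zero>"
  by (simp add: cyclic_module_def)

lemma add_el:
  assumes "a \<in> carrier A" "b \<in> carrier A"
  shows "el a \<oplus>\<^bsub>Q\<^esub> el b = el (a \<oplus> b)"
proof -
  note r = rep_el[OF assms(1)] rep_el[OF assms(2)]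
  have "(rep (el a) \<oplus> rep (el b)) \<ominus> (a \<oplus> b) = (rep (el a) \<ominus> a) \<oplus> (rep (el b) \<ominus> b)"
    using r assms by algebra
  then have "(rep (el a) \<oplus> rep (el b)) \<ominus> (a \<oplus> b) \<in> I" using r by auto
  then have "el (rep (el a) \<oplus> rep (el b)) = el (a \<oplus> b)" using r assms by (subst el_eq_iff) auto
  then show ?thesis by (simp add: cyclic_module_def)
qed

lemma smult_el:
  assumes "a \<in> carrier A" "b \<in> carrier A"
  shows "a \<odot>\<^bsub>Q\<^esub> el b = el (a \<otimes> b)"
proof -
  note r = rep_el[OF assms(2)]
  have "a \<otimes> rep (el b) \<ominus> a \<otimes> b = a \<otimes> (rep (el b) \<ominus> b)"
    using r assms by algebra
  then have "a \<otimes> rep (el b) \<ominus> a \<otimes> b \<in> I" using r assms I_l_closed by auto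
  then have "el (a \<otimes> rep (el b)) = el (a \<otimes> b)" using r assms by (subst el_eq_iff) auto
  then show ?thesis by (simp add: cyclic_module_def)
qed

lemma el_eq_zero_iff: "a \<in> carrier A \<Longrightarrow> el a = \<zero>\<^bsub>Q\<^esub> \<longleftrightarrow> a \<in> I"
  by (simp add: zero_Q el_eq_iff minus_eq)

lemma module_Q: "Module.module A Q"
proof (rule moduleI)
  show "abelian_group Q"
  proof (rule abelian_groupI)
    show "\<exists>d\<in>carrier Q. d \<oplus>\<^bsub>Q\<^esub> c = \<zero>\<^bsub>Q\<^esub>" if c: "c \<in> carrier Q" for c
    proof -
      obtain a where "a \<in> carrier A" "c = el a" using c carrier_Q by blast
      then show ?thesis by (intro bexI[of _ "el (\<ominus> a)"]) (auto simp: add_el l_neg zero_Q)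
    qed
  qed (auto simp: carrier_Q add_el zero_Q a_ac)
qed (auto simp: carrier_Q add_el smult_el is_cring l_distr r_distr m_assoc)

lemma smult_module_homs: "s \<in> carrier A \<Longrightarrow> (\<lambda>c. s \<odot>\<^bsub>Q\<^esub> c) \<in> module_homs A Q Q"
  by (auto simp: module_homs_def hom_def carrier_Q add_el smult_el r_distr m_ac)

lemma zero_module_homs_to: "Module.module A L \<Longrightarrow> (\<lambda>_. \<zero>\<^bsub>Q\<^esub>) \<in> module_homs A L Q"
  by (auto simp: module_homs_def hom_def zero_Q add_el smult_el)

end

lemma (in tensor_product) tensor_trivial:
  assumes "carrier N = {\<zero>\<^bsub>N\<^esub>}"
  shows "carrier MN = {\<one>\<^bsub>MN\<^esub>}"
  using tensor_subgroup_eq_carrier[OF MN.triv_subgroup] pt_zero_right assms by auto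

locale faithfully_flat_hom =
  fixes A :: "('a, 'k) ring_scheme" and B :: "('b, 'l) ring_scheme" and f :: "'a \<Rightarrow> 'b"
  assumes A: "cring A" and B: "cring B" and ff: "faithfully_flat A f B"
begin

sublocale A: cring A by (rule A)
sublocale B: cring B by (rule B)

lemma f_hom: "f \<in> ring_hom A B"
  using ff by (simp add: faithfully_flat_def)

sublocale f: ring_hom_cring A B f by unfold_locales (rule f_hom)

abbreviation E where "E \<equiv> algebra_module f B"
abbreviation quot where "quot \<equiv> cyclic_module A"

lemma E_simps:
  "carrier E = carrier B" "x \<oplus>\<^bsub>E\<^esub> y = x \<oplus>\<^bsub>B\<^esub> y" "a \<odot>\<^bsub>E\<^esub> x = f a \<otimes>\<^bsub>B\<^esub> x"
  by (simp_all add: algebra_module_def)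

lemma tensor_product_E: "Module.module A N \<Longrightarrow> tensor_product A E N"
  by (intro tensor_product.intro algebra_module_module A B f_hom)

lemma exact_iff:
  fixes L M N :: "('a, (nat \<Rightarrow> 'a) set) module"
  assumes "Module.module A L" "Module.module A M" "Module.module A N"
    "u \<in> module_homs A L M" "v \<in> module_homs A M N"
  shows "u ` carrier L = kernel (add_monoid M) (add_monoid N) v \<longleftrightarrow>
    tensor_map A E M u ` carrier (tensor A E L) =
      kernel (tensor A E M) (tensor A E N) (tensor_map A E N v)"
  by (rule conjunct2[OF ff[unfolded faithfully_flat_def Let_def], rule_format]) (intro conjI assms)

lemma tensor_map_hom:
  assumes "Module.module A L" "Module.module A N" "v \<in> module_homs A L N"
  shows "tensor_map A E N v \<in> hom (tensor A E L) (tensor A E N)"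
    and "\<And>x y. x \<in> carrier E \<Longrightarrow> y \<in> carrier L \<Longrightarrow>
      tensor_map A E N v (pure_tensor A E L x y) = pure_tensor A E N x (v y)"
proof -
  interpret L: tensor_product A E L by (rule tensor_product_E) fact
  interpret N: tensor_product A E N by (rule tensor_product_E) fact
  note b = balanced_mod_tensor_map[OF L.tensor_product_axioms N.tensor_product_axioms assms(3)]
  show "tensor_map A E N v \<in> hom (tensor A E L) (tensor A E N)"
    unfolding tensor_map_eq by (rule L.tensor_lift_hom[OF N.MN.comm_group_axioms b])
  show "tensor_map A E N v (pure_tensor A E L x y) = pure_tensor A E N x (v y)"
    if "x \<in> carrier E" "y \<in> carrier L" for x y
    unfolding tensor_map_eq using L.tensor_lift_pt[OF N.MN.comm_group_axioms b that] by simp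
qed

lemma zero_module:
  "Module.module A (quot (carrier A))" "carrier (quot (carrier A)) = {\<zero>\<^bsub>quot (carrier A)\<^esub>}"
proof -
  interpret Z: cyclic_quotient "carrier A" A
    by (intro cyclic_quotient.intro A.oneideal A)
  show "Module.module A (quot (carrier A))" by (rule Z.module_Q)
  show "carrier (quot (carrier A)) = {\<zero>\<^bsub>quot (carrier A)\<^esub>}"
    using Z.el_eq_zero_iff Z.carrier_Q by auto
qed

lemma prime_cyclic_quotient: "p \<in> Spec A \<Longrightarrow> cyclic_quotient p A"
  by (intro cyclic_quotient.intro A) (auto simp: Spec_def primeideal_def)

text \<open>Multiplication by \<open>s\<close> on \<open>A/p\<close> is injective because \<open>p\<close> is
  prime, which is exactness of \<open>0 \<rightarrow> A/p \<rightarrow> A/p\<close>; flatness preserves it. The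
  zero module is \<open>A/A\<close>.\<close>

lemma flat_mult_injective:
  assumes p: "p \<in> Spec A" and s: "s \<in> carrier A" "s \<notin> p"
    and t: "t \<in> carrier (tensor A E (quot p))"
    and 0: "tensor_map A E (quot p) (\<lambda>c. s \<odot>\<^bsub>quot p\<^esub> c) t = \<one>\<^bsub>tensor A E (quot p)\<^esub>"
  shows "t = \<one>\<^bsub>tensor A E (quot p)\<^esub>"
proof -
  interpret Q: cyclic_quotient p A by (rule prime_cyclic_quotient[OF p])
  interpret T: tensor_product A E "quot p" by (rule tensor_product_E[OF Q.module_Q])
  interpret T0: tensor_product A E "quot (carrier A)" by (rule tensor_product_E[OF zero_module(1)])
  let ?Z = "quot (carrier A)" and ?u = "\<lambda>_. \<zero>\<^bsub>quot p\<^esub>" and ?v = "\<lambda>c. s \<odot>\<^bsub>quot p\<^esub> c"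
  have u: "?u \<in> module_homs A ?Z (quot p)" by (rule Q.zero_module_homs_to[OF zero_module(1)])
  have v: "?v \<in> module_homs A (quot p) (quot p)" by (rule Q.smult_module_homs[OF s(1)])
  have "s \<odot>\<^bsub>quot p\<^esub> c = \<zero>\<^bsub>quot p\<^esub> \<longleftrightarrow> c = \<zero>\<^bsub>quot p\<^esub>" if "c \<in> carrier (quot p)" for c
  proof -
    obtain a where "a \<in> carrier A" "c = cyclic_elt A p a" using \<open>c \<in> _\<close> Q.carrier_Q by blast
    then show ?thesis
      using s A.Spec_closed(4)[OF p] by (simp add: Q.smult_el Q.el_eq_zero_iff)
  qed
  then have "?u ` carrier ?Z = kernel (add_monoid (quot p)) (add_monoid (quot p)) ?v"
    using zero_module(2) T.N.zero_closed by (auto simp: kernel_def)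
  then have "tensor_map A E (quot p) ?u ` carrier (tensor A E ?Z)
      = kernel (tensor A E (quot p)) (tensor A E (quot p)) (tensor_map A E (quot p) ?v)"
    by (rule iffD1[OF exact_iff[OF zero_module(1) Q.module_Q Q.module_Q u v]])
  moreover have "tensor_map A E (quot p) ?u ` carrier (tensor A E ?Z) = {\<one>\<^bsub>tensor A E (quot p)\<^esub>}"
    using T0.tensor_trivial[OF zero_module(2)]
      hom_one[OF tensor_map_hom(1)[OF zero_module(1) Q.module_Q u] T0.MN.group_axioms T.MN.group_axioms]
    by simp
  ultimately show ?thesis using t 0 by (auto simp: kernel_def)
qed

text \<open>If \<open>B \<otimes> A/p\<close> vanished, then \<open>0 \<rightarrow> A/p \<rightarrow> 0\<close>
  would be exact after tensoring, hence exact, and \<open>p\<close> would contain \<open>1\<close>.\<close>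

lemma tensor_quot_nontrivial:
  assumes p: "p \<in> Spec A"
  shows "carrier (tensor A E (quot p)) \<noteq> {\<one>\<^bsub>tensor A E (quot p)\<^esub>}"
proof
  assume triv: "carrier (tensor A E (quot p)) = {\<one>\<^bsub>tensor A E (quot p)\<^esub>}"
  interpret Q: cyclic_quotient p A by (rule prime_cyclic_quotient[OF p])
  interpret Z: cyclic_quotient "carrier A" A by (intro cyclic_quotient.intro A.oneideal A)
  interpret T: tensor_product A E "quot p" by (rule tensor_product_E[OF Q.module_Q])
  interpret T0: tensor_product A E "quot (carrier A)" by (rule tensor_product_E[OF zero_module(1)])
  let ?Z = "quot (carrier A)" and ?u = "\<lambda>_. \<zero>\<^bsub>quot p\<^esub>" and ?v = "\<lambda>_. \<zero>\<^bsub>quot (carrier A)\<^esub>"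
  have u: "?u \<in> module_homs A ?Z (quot p)" by (rule Q.zero_module_homs_to[OF zero_module(1)])
  have v: "?v \<in> module_homs A (quot p) ?Z" by (rule Z.zero_module_homs_to[OF Q.module_Q])
  have "tensor_map A E (quot p) ?u ` carrier (tensor A E ?Z) = {\<one>\<^bsub>tensor A E (quot p)\<^esub>}"
    using T0.tensor_trivial[OF zero_module(2)]
      hom_one[OF tensor_map_hom(1)[OF zero_module(1) Q.module_Q u] T0.MN.group_axioms T.MN.group_axioms]
    by simp
  moreover have "kernel (tensor A E (quot p)) (tensor A E ?Z) (tensor_map A E ?Z ?v)
      = {\<one>\<^bsub>tensor A E (quot p)\<^esub>}"
    using triv
      hom_one[OF tensor_map_hom(1)[OF Q.module_Q zero_module(1) v] T.MN.group_axioms T0.MN.group_axioms]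
    by (auto simp: kernel_def)
  ultimately have "?u ` carrier ?Z = kernel (add_monoid (quot p)) (add_monoid ?Z) ?v"
    by (intro iffD2[OF exact_iff[OF zero_module(1) Q.module_Q zero_module(1) u v]]) simp
  then have "carrier (quot p) = {\<zero>\<^bsub>quot p\<^esub>}" using zero_module(2) by (auto simp: kernel_def)
  then have "cyclic_elt A p \<one>\<^bsub>A\<^esub> = \<zero>\<^bsub>quot p\<^esub>" using Q.el_closed[OF A.one_closed] by blast
  then show False using Q.el_eq_zero_iff A.Spec_closed(3)[OF p] by simp
qed

text \<open>The elements of \<open>B\<close> that act as zero on \<open>B \<otimes> A/p\<close>, that is, the
  extension of \<open>p\<close> to \<open>B\<close>. The action of \<open>w\<close> is spelled out as
  multiplication in the first factor, because the tensor product carries only a group structure. This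
  description makes it an ideal at once and lets the flatness of \<open>B\<close> act on it directly.\<close>

definition annihilator :: "'a set \<Rightarrow> 'b set" where
  "annihilator p = {w \<in> carrier B. \<forall>b\<in>carrier B. \<forall>c\<in>carrier (quot p).
     pure_tensor A E (quot p) (b \<otimes>\<^bsub>B\<^esub> w) c = \<one>\<^bsub>tensor A E (quot p)\<^esub>}"

lemma annihilator_ideal:
  assumes p: "p \<in> Spec A"
  shows "ideal (annihilator p) B"
proof -
  interpret Q: cyclic_quotient p A by (rule prime_cyclic_quotient[OF p])
  interpret T: tensor_product A E "quot p" by (rule tensor_product_E[OF Q.module_Q])
  have zero: "pure_tensor A E (quot p) \<zero>\<^bsub>B\<^esub> c = \<one>\<^bsub>tensor A E (quot p)\<^esub>"
    if c: "c \<in> carrier (quot p)" for c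
  proof -
    have "pure_tensor A E (quot p) (\<zero>\<^bsub>A\<^esub> \<odot>\<^bsub>E\<^esub> \<zero>\<^bsub>B\<^esub>) c = pure_tensor A E (quot p) \<zero>\<^bsub>B\<^esub> (\<zero>\<^bsub>A\<^esub> \<odot>\<^bsub>quot p\<^esub> c)"
      using c by (intro T.pt_smult) (auto simp: E_simps)
    then show ?thesis using c T.pt_zero_right by (simp add: E_simps)
  qed
  show ?thesis
    unfolding B.ideal_iff_closed annihilator_def
  proof (intro conjI ballI)
    fix w w' assume "w \<in> {w \<in> carrier B. \<forall>b\<in>carrier B. \<forall>c\<in>carrier (quot p).
     pure_tensor A E (quot p) (b \<otimes>\<^bsub>B\<^esub> w) c = \<one>\<^bsub>tensor A E (quot p)\<^esub>}"
     "w' \<in> {w \<in> carrier B. \<forall>b\<in>carrier B. \<forall>c\<in>carrier (quot p).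
     pure_tensor A E (quot p) (b \<otimes>\<^bsub>B\<^esub> w) c = \<one>\<^bsub>tensor A E (quot p)\<^esub>}"
    then show "w \<oplus>\<^bsub>B\<^esub> w' \<in> {w \<in> carrier B. \<forall>b\<in>carrier B. \<forall>c\<in>carrier (quot p).
     pure_tensor A E (quot p) (b \<otimes>\<^bsub>B\<^esub> w) c = \<one>\<^bsub>tensor A E (quot p)\<^esub>}"
      using T.pt_add_left by (simp add: E_simps B.r_distr)
  qed (use zero in \<open>auto simp flip: B.m_assoc\<close>)
qed

lemma image_prime_in_annihilator:
  assumes p: "p \<in> Spec A" and a: "a \<in> p"
  shows "f a \<in> annihilator p"
proof -
  interpret Q: cyclic_quotient p A by (rule prime_cyclic_quotient[OF p])
  interpret T: tensor_product A E "quot p" by (rule tensor_product_E[OF Q.module_Q])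
  have aA: "a \<in> carrier A" using a A.Spec_closed(1)[OF p] by blast
  have "pure_tensor A E (quot p) (b \<otimes>\<^bsub>B\<^esub> f a) c = \<one>\<^bsub>tensor A E (quot p)\<^esub>"
    if b: "b \<in> carrier B" and c: "c \<in> carrier (quot p)" for b c
  proof -
    obtain d where d: "d \<in> carrier A" "c = cyclic_elt A p d" using c Q.carrier_Q by blast
    then have "a \<odot>\<^bsub>quot p\<^esub> c = \<zero>\<^bsub>quot p\<^esub>"
      using a aA A.Spec_closed(4)[OF p] by (simp add: Q.smult_el Q.el_eq_zero_iff)
    then show ?thesis
      using T.pt_smult[of a b c] T.pt_zero_right[of b] aA b c by (simp add: E_simps B.m_comm)
  qed
  then show ?thesis using aA by (simp add: annihilator_def)
qed

text \<open>A prime of \<open>B\<close> that contains the extension of \<open>p\<close> and avoids the images of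
  the elements outside \<open>p\<close> contracts to \<open>p\<close>. If some \<open>f s\<close> with \<open>s
  \<notin> p\<close> annihilated \<open>B \<otimes> A/p\<close>, then the injective multiplication by
  \<open>s\<close> would be zero on \<open>B \<otimes> A/p\<close>, which is not trivial.\<close>

lemma Spec_map_surjective:
  assumes p: "p \<in> Spec A"
  obtains q where "q \<in> Spec B" "Spec_map A f q = p"
proof -
  interpret Q: cyclic_quotient p A by (rule prime_cyclic_quotient[OF p])
  interpret T: tensor_product A E "quot p" by (rule tensor_product_E[OF Q.module_Q])
  let ?S = "f ` (carrier A - p)"
  obtain q where q: "q \<in> Spec B" "annihilator p \<subseteq> q" "q \<inter> ?S = {}"
  proof (rule B.obtain_prime_disjoint[OF annihilator_ideal[OF p], of ?S])
    show "\<one>\<^bsub>B\<^esub> \<in> ?S" using A.Spec_closed(3)[OF p] by (intro image_eqI[of _ _ "\<one>\<^bsub>A\<^esub>"]) auto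
    show "s \<otimes>\<^bsub>B\<^esub> t \<in> ?S" if st: "s \<in> ?S" "t \<in> ?S" for s t
    proof -
      obtain s' t' where "s' \<in> carrier A - p" "t' \<in> carrier A - p" "s = f s'" "t = f t'"
        using st by blast
      then show ?thesis
        using A.Spec_closed(4)[OF p] by (intro image_eqI[of _ _ "s' \<otimes>\<^bsub>A\<^esub> t'"]) auto
    qed
    show "annihilator p \<inter> ?S = {}"
    proof (rule ccontr)
      assume "annihilator p \<inter> ?S \<noteq> {}"
      then obtain s where s: "s \<in> carrier A" "s \<notin> p" "f s \<in> annihilator p" by blast
      have "pure_tensor A E (quot p) b c = \<one>\<^bsub>tensor A E (quot p)\<^esub>"
        if b: "b \<in> carrier E" and c: "c \<in> carrier (quot p)" for b c
      proof (rule flat_mult_injective[OF p s(1,2)])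
        have "tensor_map A E (quot p) (\<lambda>c. s \<odot>\<^bsub>quot p\<^esub> c) (pure_tensor A E (quot p) b c)
            = pure_tensor A E (quot p) b (s \<odot>\<^bsub>quot p\<^esub> c)"
          by (rule tensor_map_hom(2)[OF Q.module_Q Q.module_Q Q.smult_module_homs[OF s(1)] b c])
        also have "\<dots> = pure_tensor A E (quot p) (b \<otimes>\<^bsub>B\<^esub> f s) c"
          using T.pt_smult[OF s(1) b c] b s(1) by (simp add: E_simps B.m_comm)
        also have "\<dots> = \<one>\<^bsub>tensor A E (quot p)\<^esub>"
          using s(3) b c by (simp add: annihilator_def E_simps)
        finally show "tensor_map A E (quot p) (\<lambda>c. s \<odot>\<^bsub>quot p\<^esub> c) (pure_tensor A E (quot p) b c)
            = \<one>\<^bsub>tensor A E (quot p)\<^esub>" .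
      qed (rule T.pt_closed[OF b c])
      then have "{\<one>\<^bsub>tensor A E (quot p)\<^esub>} = carrier (tensor A E (quot p))"
        by (intro T.tensor_subgroup_eq_carrier T.MN.triv_subgroup) auto
      then show False using tensor_quot_nontrivial[OF p] by simp
    qed
  qed auto
  have "Spec_map A f q = p"
    using q(2,3) image_prime_in_annihilator[OF p] A.Spec_closed(1)[OF p]
    by (auto simp: Spec_map_def)
  then show thesis using q(1) that by blast
qed

text \<open>To stay inside \<open>q\<close>, the prime must also avoid the complement of \<open>q\<close>. If
  \<open>f s \<cdot> t\<close> annihilates \<open>B \<otimes> A/p\<close> with \<open>s \<notin> p\<close>, then
  \<open>t \<otimes> 1 = 0\<close> by injectivity of the multiplication by \<open>s\<close>. The map \<open>(x,
  c) \<mapsto> x \<cdot> f c\<close> is well defined modulo \<open>q\<close> because \<open>f\<close> maps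
  \<open>p\<close> into \<open>q\<close>, and it shows that then \<open>t \<in> q\<close>.\<close>

lemma going_down:
  assumes p: "p \<in> Spec A" and q: "q \<in> Spec B" and le: "p \<subseteq> Spec_map A f q"
  obtains q' where "q' \<in> Spec B" "q' \<subseteq> q" "Spec_map A f q' = p"
proof -
  interpret Q: cyclic_quotient p A by (rule prime_cyclic_quotient[OF p])
  interpret T: tensor_product A E "quot p" by (rule tensor_product_E[OF Q.module_Q])
  note pc = A.Spec_closed[OF p] and qc = B.Spec_closed[OF q]
  have fp: "f a \<in> q" if "a \<in> p" for a using le that by (auto simp: Spec_map_def)
  let ?S = "(\<lambda>(s, t). f s \<otimes>\<^bsub>B\<^esub> t) ` ((carrier A - p) \<times> (carrier B - q))"
  let ?rep = "cyclic_rep A p" and ?el = "cyclic_elt A p"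
  let ?b = "\<lambda>(x, c). x \<otimes>\<^bsub>B\<^esub> f (?rep c)"
  have qsub: "subgroup q (add_monoid B)"
    using q unfolding Spec_def primeideal_def ideal_def additive_subgroup_def by blast
  have bal: "balanced_mod A E (quot p) (add_monoid B) q ?b"
  proof -
    have add: "x \<otimes>\<^bsub>B\<^esub> f (?rep (c \<oplus>\<^bsub>quot p\<^esub> d)) \<ominus>\<^bsub>B\<^esub> x \<otimes>\<^bsub>B\<^esub> f (?rep c) \<ominus>\<^bsub>B\<^esub> x \<otimes>\<^bsub>B\<^esub> f (?rep d) \<in> q"
      if x: "x \<in> carrier B" and c: "c \<in> carrier (quot p)" and d: "d \<in> carrier (quot p)" for x c d
    proof -
      note rc = Q.rep[OF c] and rd = Q.rep[OF d]
      have "c \<oplus>\<^bsub>quot p\<^esub> d = ?el (?rep c \<oplus>\<^bsub>A\<^esub> ?rep d)" using rc rd Q.add_el by metis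
      then have r: "?rep (c \<oplus>\<^bsub>quot p\<^esub> d) \<in> carrier A"
          "?rep (c \<oplus>\<^bsub>quot p\<^esub> d) \<ominus>\<^bsub>A\<^esub> (?rep c \<oplus>\<^bsub>A\<^esub> ?rep d) \<in> p"
        using Q.rep_el[of "?rep c \<oplus>\<^bsub>A\<^esub> ?rep d"] rc rd by auto
      have "x \<otimes>\<^bsub>B\<^esub> f (?rep (c \<oplus>\<^bsub>quot p\<^esub> d)) \<ominus>\<^bsub>B\<^esub> x \<otimes>\<^bsub>B\<^esub> f (?rep c) \<ominus>\<^bsub>B\<^esub> x \<otimes>\<^bsub>B\<^esub> f (?rep d)
        = x \<otimes>\<^bsub>B\<^esub> (f (?rep (c \<oplus>\<^bsub>quot p\<^esub> d)) \<ominus>\<^bsub>B\<^esub> (f (?rep c) \<oplus>\<^bsub>B\<^esub> f (?rep d)))"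
        using x f.hom_closed[of "?rep c"] f.hom_closed[of "?rep d"] f.hom_closed[OF r(1)] rc rd by algebra
      also have "\<dots> = x \<otimes>\<^bsub>B\<^esub> f (?rep (c \<oplus>\<^bsub>quot p\<^esub> d) \<ominus>\<^bsub>A\<^esub> (?rep c \<oplus>\<^bsub>A\<^esub> ?rep d))"
        using r(1) rc rd by (simp add: A.minus_eq B.minus_eq)
      finally show ?thesis using fp[OF r(2)] x qc(1,4) by auto
    qed
    have smult: "f a \<otimes>\<^bsub>B\<^esub> x \<otimes>\<^bsub>B\<^esub> f (?rep c) \<ominus>\<^bsub>B\<^esub> x \<otimes>\<^bsub>B\<^esub> f (?rep (a \<odot>\<^bsub>quot p\<^esub> c)) \<in> q"
      if a: "a \<in> carrier A" and x: "x \<in> carrier B" and c: "c \<in> carrier (quot p)" for a x c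
    proof -
      note rc = Q.rep[OF c]
      have "a \<odot>\<^bsub>quot p\<^esub> c = ?el (a \<otimes>\<^bsub>A\<^esub> ?rep c)" using rc a Q.smult_el by metis
      then have r: "?rep (a \<odot>\<^bsub>quot p\<^esub> c) \<in> carrier A"
          "?rep (a \<odot>\<^bsub>quot p\<^esub> c) \<ominus>\<^bsub>A\<^esub> (a \<otimes>\<^bsub>A\<^esub> ?rep c) \<in> p"
        using Q.rep_el[of "a \<otimes>\<^bsub>A\<^esub> ?rep c"] rc a by auto
      have "f a \<otimes>\<^bsub>B\<^esub> x \<otimes>\<^bsub>B\<^esub> f (?rep c) \<ominus>\<^bsub>B\<^esub> x \<otimes>\<^bsub>B\<^esub> f (?rep (a \<odot>\<^bsub>quot p\<^esub> c))
        = (\<ominus>\<^bsub>B\<^esub> x) \<otimes>\<^bsub>B\<^esub> (f (?rep (a \<odot>\<^bsub>quot p\<^esub> c)) \<ominus>\<^bsub>B\<^esub> (f a \<otimes>\<^bsub>B\<^esub> f (?rep c)))"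
        using x f.hom_closed[of "?rep c"] f.hom_closed[OF a] f.hom_closed[OF r(1)] rc by algebra
      also have "\<dots> = (\<ominus>\<^bsub>B\<^esub> x) \<otimes>\<^bsub>B\<^esub> f (?rep (a \<odot>\<^bsub>quot p\<^esub> c) \<ominus>\<^bsub>A\<^esub> (a \<otimes>\<^bsub>A\<^esub> ?rep c))"
        using r(1) rc a by (simp add: A.minus_eq B.minus_eq)
      finally show ?thesis using fp[OF r(2)] x qc(1,4) by auto
    qed
    have left: "(x \<oplus>\<^bsub>B\<^esub> x') \<otimes>\<^bsub>B\<^esub> y \<ominus>\<^bsub>B\<^esub> x \<otimes>\<^bsub>B\<^esub> y \<ominus>\<^bsub>B\<^esub> x' \<otimes>\<^bsub>B\<^esub> y \<in> q"
      if xy: "x \<in> carrier B" "x' \<in> carrier B" "y \<in> carrier B" for x x' y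
    proof -
      have "(x \<oplus>\<^bsub>B\<^esub> x') \<otimes>\<^bsub>B\<^esub> y \<ominus>\<^bsub>B\<^esub> x \<otimes>\<^bsub>B\<^esub> y \<ominus>\<^bsub>B\<^esub> x' \<otimes>\<^bsub>B\<^esub> y = \<zero>\<^bsub>B\<^esub>" using xy by algebra
      then show ?thesis using qc(2) by simp
    qed
    show ?thesis
      unfolding balanced_mod_def
      using Q.rep add smult left
      by (auto simp: E_simps B.minus_eq a_inv_def)
  qed
  obtain q' where q': "q' \<in> Spec B" "annihilator p \<subseteq> q'" "q' \<inter> ?S = {}"
  proof (rule B.obtain_prime_disjoint[OF annihilator_ideal[OF p], of ?S])
    show "\<one>\<^bsub>B\<^esub> \<in> ?S" using pc(3) qc(3) by (intro image_eqI[of _ _ "(\<one>\<^bsub>A\<^esub>, \<one>\<^bsub>B\<^esub>)"]) auto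
    show "x \<otimes>\<^bsub>B\<^esub> y \<in> ?S" if xy: "x \<in> ?S" "y \<in> ?S" for x y
    proof -
      obtain s t s' t' where st: "s \<in> carrier A - p" "s' \<in> carrier A - p" "t \<in> carrier B - q"
        "t' \<in> carrier B - q" "x = f s \<otimes>\<^bsub>B\<^esub> t" "y = f s' \<otimes>\<^bsub>B\<^esub> t'"
        using xy by auto
      then have "x \<otimes>\<^bsub>B\<^esub> y = f (s \<otimes>\<^bsub>A\<^esub> s') \<otimes>\<^bsub>B\<^esub> (t \<otimes>\<^bsub>B\<^esub> t')"
        by (simp add: B.m_ac)
      then show ?thesis
        using st pc(4) qc(4) by (intro image_eqI[of _ _ "(s \<otimes>\<^bsub>A\<^esub> s', t \<otimes>\<^bsub>B\<^esub> t')"]) auto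
    qed
    show "annihilator p \<inter> ?S = {}"
    proof (rule ccontr)
      assume "annihilator p \<inter> ?S \<noteq> {}"
      then obtain x where ann': "x \<in> annihilator p" and xS: "x \<in> ?S" by blast
      from xS obtain s t where s: "s \<in> carrier A" "s \<notin> p" and t: "t \<in> carrier B" "t \<notin> q"
        and x: "x = f s \<otimes>\<^bsub>B\<^esub> t" by auto
      have ann: "f s \<otimes>\<^bsub>B\<^esub> t \<in> annihilator p" using ann' x by simp
      have tE: "t \<in> carrier E" using t by (simp add: E_simps)
      have 1: "?el \<one>\<^bsub>A\<^esub> \<in> carrier (quot p)" by simp
      have "tensor_map A E (quot p) (\<lambda>c. s \<odot>\<^bsub>quot p\<^esub> c) (pure_tensor A E (quot p) t (?el \<one>\<^bsub>A\<^esub>))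
          = pure_tensor A E (quot p) t (s \<odot>\<^bsub>quot p\<^esub> ?el \<one>\<^bsub>A\<^esub>)"
        by (rule tensor_map_hom(2)[OF Q.module_Q Q.module_Q Q.smult_module_homs[OF s(1)] tE 1])
      also have "\<dots> = pure_tensor A E (quot p) (\<one>\<^bsub>B\<^esub> \<otimes>\<^bsub>B\<^esub> (f s \<otimes>\<^bsub>B\<^esub> t)) (?el \<one>\<^bsub>A\<^esub>)"
        using T.pt_smult[OF s(1) tE 1] s(1) t(1) by (simp add: E_simps)
      also have "\<dots> = \<one>\<^bsub>tensor A E (quot p)\<^esub>"
        using ann 1 unfolding annihilator_def by blast
      finally have "pure_tensor A E (quot p) t (?el \<one>\<^bsub>A\<^esub>) = \<one>\<^bsub>tensor A E (quot p)\<^esub>"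
        using flat_mult_injective[OF p s T.pt_closed[OF tE 1]] by blast
      then have "frag_of (t, ?el \<one>\<^bsub>A\<^esub>) - 0 \<in> tensor_kernel A E (quot p)"
        using T.coset_eq_iff[of "frag_of (t, ?el \<one>\<^bsub>A\<^esub>)" 0] T.proj.hom_one tE 1
        by (simp add: T.pt_eq)
      then have "free_lift (add_monoid B) ?b (frag_of (t, ?el \<one>\<^bsub>A\<^esub>)) \<in> q"
        using T.free_lift_kernel[OF B.a_comm_group qsub bal] by simp
      moreover have r: "?rep (?el \<one>\<^bsub>A\<^esub>) \<in> carrier A" "?rep (?el \<one>\<^bsub>A\<^esub>) \<ominus>\<^bsub>A\<^esub> \<one>\<^bsub>A\<^esub> \<in> p"
        using Q.rep_el by auto
      ultimately have "t \<otimes>\<^bsub>B\<^esub> f (?rep (?el \<one>\<^bsub>A\<^esub>)) \<in> q"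
        using free_lift_frag_of[OF B.a_comm_group, of ?b "(t, ?el \<one>\<^bsub>A\<^esub>)"] t by simp
      then have "f (?rep (?el \<one>\<^bsub>A\<^esub>)) \<in> q" using t qc(4) r by auto
      moreover have "f (?rep (?el \<one>\<^bsub>A\<^esub>)) \<ominus>\<^bsub>B\<^esub> \<one>\<^bsub>B\<^esub> \<in> q"
        using fp[OF r(2)] r(1) by (simp add: A.minus_eq B.minus_eq)
      ultimately have "f (?rep (?el \<one>\<^bsub>A\<^esub>)) \<ominus>\<^bsub>B\<^esub> (f (?rep (?el \<one>\<^bsub>A\<^esub>)) \<ominus>\<^bsub>B\<^esub> \<one>\<^bsub>B\<^esub>) \<in> q"
        by (rule qc(6))
      moreover have "f (?rep (?el \<one>\<^bsub>A\<^esub>)) \<ominus>\<^bsub>B\<^esub> (f (?rep (?el \<one>\<^bsub>A\<^esub>)) \<ominus>\<^bsub>B\<^esub> \<one>\<^bsub>B\<^esub>) = \<one>\<^bsub>B\<^esub>"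
        using f.hom_closed[OF r(1)] by algebra
      ultimately show False using qc(3) by simp
    qed
  qed auto
  have "f s \<notin> q'" if "s \<in> carrier A" "s \<notin> p" for s
  proof -
    have "f s \<otimes>\<^bsub>B\<^esub> \<one>\<^bsub>B\<^esub> \<in> ?S"
      using that qc(3) by (intro image_eqI[of _ _ "(s, \<one>\<^bsub>B\<^esub>)"]) auto
    then show ?thesis using q'(3) that by auto
  qed
  then have "Spec_map A f q' = p"
    using q'(2) image_prime_in_annihilator[OF p] pc(1) by (auto simp: Spec_map_def)
  moreover have "q' \<subseteq> q"
  proof
    fix t assume t: "t \<in> q'"
    then have tB: "t \<in> carrier B" using B.Spec_closed(1)[OF q'(1)] by blast
    have "f \<one>\<^bsub>A\<^esub> \<otimes>\<^bsub>B\<^esub> t \<in> ?S" if "t \<notin> q"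
      using that tB pc(3) by (intro image_eqI[of _ _ "(\<one>\<^bsub>A\<^esub>, t)"]) auto
    then show "t \<in> q" using q'(3) t tB by auto
  qed
  ultimately show thesis using that q'(1) by blast
qed

end

section \<open>Points of a tensor product of algebras\<close>

locale algebra_pair =
  fixes A :: "('a, 'k) ring_scheme" and B :: "('b, 'l) ring_scheme" and C :: "('c, 'm) ring_scheme"
    and f :: "'a \<Rightarrow> 'b" and g :: "'a \<Rightarrow> 'c"
  assumes A: "cring A" and B: "cring B" and C: "cring C"
    and f_hom: "f \<in> ring_hom A B" and g_hom: "g \<in> ring_hom A C"
begin

sublocale A: cring A by (rule A)
sublocale B: cring B by (rule B)
sublocale C: cring C by (rule C)
sublocale f: ring_hom_cring A B f by unfold_locales (rule f_hom)
sublocale g: ring_hom_cring A C g by unfold_locales (rule g_hom)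

abbreviation E where "E \<equiv> algebra_module f B"
abbreviation E' where "E' \<equiv> algebra_module g C"

sublocale T: tensor_product A E E'
  by (intro tensor_product.intro algebra_module_module A B C f_hom g_hom)

lemma E_simps:
  "carrier E = carrier B" "x \<oplus>\<^bsub>E\<^esub> y = x \<oplus>\<^bsub>B\<^esub> y" "a \<odot>\<^bsub>E\<^esub> x = f a \<otimes>\<^bsub>B\<^esub> x"
  "carrier E' = carrier C" "u \<oplus>\<^bsub>E'\<^esub> v = u \<oplus>\<^bsub>C\<^esub> v" "a \<odot>\<^bsub>E'\<^esub> u = g a \<otimes>\<^bsub>C\<^esub> u"
  by (simp_all add: algebra_module_def)

definition submodule_of_B :: "'b set \<Rightarrow> bool" where
  "submodule_of_B N \<longleftrightarrow> N \<subseteq> carrier B \<and> \<zero>\<^bsub>B\<^esub> \<in> N \<and> (\<forall>x\<in>N. \<forall>y\<in>N. x \<oplus>\<^bsub>B\<^esub> y \<in> N) \<and>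
     (\<forall>a\<in>carrier A. \<forall>x\<in>N. f a \<otimes>\<^bsub>B\<^esub> x \<in> N)"

lemma submodule_minus:
  assumes N: "submodule_of_B N" and x: "x \<in> N" and y: "y \<in> N"
  shows "x \<ominus>\<^bsub>B\<^esub> y \<in> N"
proof -
  have c: "x \<in> carrier B" "y \<in> carrier B" using assms by (auto simp: submodule_of_B_def)
  have "f (\<ominus>\<^bsub>A\<^esub> \<one>\<^bsub>A\<^esub>) \<otimes>\<^bsub>B\<^esub> y \<in> N"
    using N y A.a_inv_closed[OF A.one_closed] unfolding submodule_of_B_def by blast
  then have "x \<oplus>\<^bsub>B\<^esub> f (\<ominus>\<^bsub>A\<^esub> \<one>\<^bsub>A\<^esub>) \<otimes>\<^bsub>B\<^esub> y \<in> N"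
    using N x unfolding submodule_of_B_def by blast
  moreover have "f (\<ominus>\<^bsub>A\<^esub> \<one>\<^bsub>A\<^esub>) \<otimes>\<^bsub>B\<^esub> y = \<ominus>\<^bsub>B\<^esub> y" using c by (simp add: B.l_minus)
  ultimately show ?thesis by (simp add: B.minus_eq)
qed

text \<open>Let \<open>p\<close> be the contraction of \<open>r\<close>. The module \<open>N\<close> is the
  kernel of an \<open>A\<close>-linear map from \<open>B\<close> to the fraction field of \<open>A/p\<close>
  that vanishes on \<open>r\<close> but not at \<open>s\<close>: the last conclusion says that every
  \<open>x\<close> is \<open>(a/d) s\<close> modulo \<open>N\<close>. Any submodule \<open>N\<close> that is
  maximal subject to the second and the third conclusion has this property: when \<open>x \<notin> N\<close>,
  adjoining \<open>x\<close> to \<open>N\<close> puts a multiple \<open>a s\<close> with \<open>a \<notin>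
  p\<close> into \<open>N + A x\<close>.\<close>

lemma obtain_maximal_submodule:
  assumes r: "r \<in> Spec B" and s: "s \<in> carrier B" "s \<notin> r"
  obtains N where "submodule_of_B N" "r \<subseteq> N"
    "\<And>a. a \<in> carrier A \<Longrightarrow> f a \<otimes>\<^bsub>B\<^esub> s \<in> N \<Longrightarrow> a \<in> Spec_map A f r"
    "\<And>x. x \<in> carrier B \<Longrightarrow>
      \<exists>d\<in>carrier A - Spec_map A f r. \<exists>a\<in>carrier A. f d \<otimes>\<^bsub>B\<^esub> x \<ominus>\<^bsub>B\<^esub> f a \<otimes>\<^bsub>B\<^esub> s \<in> N"
proof -
  let ?p = "Spec_map A f r"
  let ?sep = "\<lambda>N. \<forall>a\<in>carrier A. f a \<otimes>\<^bsub>B\<^esub> s \<in> N \<longrightarrow> a \<in> ?p"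
  let ?Z = "{N. submodule_of_B N \<and> r \<subseteq> N \<and> ?sep N}"
  note rc = B.Spec_closed[OF r]
  have "\<exists>M\<in>?Z. \<forall>N\<in>?Z. M \<subseteq> N \<longrightarrow> N = M"
  proof (rule subset_Zorn_nonempty)
    have "submodule_of_B r"
      using rc(1,2,4,5) unfolding submodule_of_B_def by auto
    moreover have "?sep r"
    proof (intro ballI impI)
      fix a assume a: "a \<in> carrier A" "f a \<otimes>\<^bsub>B\<^esub> s \<in> r"
      then show "a \<in> ?p" using rc(4)[of "f a" s] s by (simp add: Spec_map_def)
    qed
    ultimately show "?Z \<noteq> {}" by blast
  next
    fix c assume c: "c \<noteq> {}" "subset.chain ?Z c"
    then have sub: "c \<subseteq> ?Z" and "\<forall>N\<in>c. \<forall>M\<in>c. N \<subset> M \<or> N = M \<or> M \<subset> N \<or> M = N"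
      by (simp_all add: pred_on.chain_def)
    then have chain: "N \<subseteq> M \<or> M \<subseteq> N" if "N \<in> c" "M \<in> c" for N M
      using that by blast
    have closed: "M \<subseteq> carrier B" "\<zero>\<^bsub>B\<^esub> \<in> M" "\<And>x y. x \<in> M \<Longrightarrow> y \<in> M \<Longrightarrow> x \<oplus>\<^bsub>B\<^esub> y \<in> M"
      "\<And>a x. a \<in> carrier A \<Longrightarrow> x \<in> M \<Longrightarrow> f a \<otimes>\<^bsub>B\<^esub> x \<in> M" if "M \<in> c" for M
    proof -
      have "submodule_of_B M" using sub that by auto
      then show "M \<subseteq> carrier B" "\<zero>\<^bsub>B\<^esub> \<in> M" "\<And>x y. x \<in> M \<Longrightarrow> y \<in> M \<Longrightarrow> x \<oplus>\<^bsub>B\<^esub> y \<in> M"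
        "\<And>a x. a \<in> carrier A \<Longrightarrow> x \<in> M \<Longrightarrow> f a \<otimes>\<^bsub>B\<^esub> x \<in> M"
        by (simp_all add: submodule_of_B_def)
    qed
    have "submodule_of_B (\<Union>c)"
      unfolding submodule_of_B_def
    proof (intro conjI ballI)
      show "\<Union>c \<subseteq> carrier B" using closed(1) by blast
      show "\<zero>\<^bsub>B\<^esub> \<in> \<Union>c" using closed(2) c(1) by blast
      show "f a \<otimes>\<^bsub>B\<^esub> x \<in> \<Union>c" if ax: "a \<in> carrier A" "x \<in> \<Union>c" for a x
      proof -
        obtain M where "M \<in> c" "x \<in> M" using ax(2) by blast
        then show ?thesis using closed(4)[of M a x] ax(1) by blast
      qed
      show "x \<oplus>\<^bsub>B\<^esub> y \<in> \<Union>c" if xy: "x \<in> \<Union>c" "y \<in> \<Union>c" for x y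
      proof -
        obtain N M where NM: "N \<in> c" "x \<in> N" "M \<in> c" "y \<in> M" using xy by blast
        then obtain L where L: "L \<in> c" "x \<in> L" "y \<in> L" using chain[of N M] by blast
        then have "x \<oplus>\<^bsub>B\<^esub> y \<in> L" by (intro closed(3))
        then show ?thesis using L(1) by blast
      qed
    qed
    moreover have "r \<subseteq> \<Union>c" using sub c(1) by auto
    moreover have "?sep (\<Union>c)" using sub by auto
    ultimately show "\<Union>c \<in> ?Z" by blast
  qed
  then obtain N where NZ: "N \<in> ?Z" and max: "\<forall>M\<in>?Z. N \<subseteq> M \<longrightarrow> M = N" by (elim bexE)
  then have N: "submodule_of_B N" "r \<subseteq> N" "?sep N" by auto
  then have Nc: "N \<subseteq> carrier B" "\<zero>\<^bsub>B\<^esub> \<in> N" "\<And>x y. x \<in> N \<Longrightarrow> y \<in> N \<Longrightarrow> x \<oplus>\<^bsub>B\<^esub> y \<in> N"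
    "\<And>a x. a \<in> carrier A \<Longrightarrow> x \<in> N \<Longrightarrow> f a \<otimes>\<^bsub>B\<^esub> x \<in> N"
    by (auto simp: submodule_of_B_def)
  have p: "?p \<in> Spec A" by (rule Spec_map_in_Spec[OF A B f_hom r])
  have "\<exists>d\<in>carrier A - ?p. \<exists>a\<in>carrier A. f d \<otimes>\<^bsub>B\<^esub> x \<ominus>\<^bsub>B\<^esub> f a \<otimes>\<^bsub>B\<^esub> s \<in> N"
    if x: "x \<in> carrier B" for x
  proof (cases "x \<in> N")
    case True
    have "f \<one>\<^bsub>A\<^esub> \<otimes>\<^bsub>B\<^esub> x \<ominus>\<^bsub>B\<^esub> f \<zero>\<^bsub>A\<^esub> \<otimes>\<^bsub>B\<^esub> s = x" using x s by (simp add: B.minus_eq)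
    then have "f \<one>\<^bsub>A\<^esub> \<otimes>\<^bsub>B\<^esub> x \<ominus>\<^bsub>B\<^esub> f \<zero>\<^bsub>A\<^esub> \<otimes>\<^bsub>B\<^esub> s \<in> N" using True by simp
    then show ?thesis using A.Spec_closed(3)[OF p] by blast
  next
    case False
    let ?M = "{n \<oplus>\<^bsub>B\<^esub> f c \<otimes>\<^bsub>B\<^esub> x | n c. n \<in> N \<and> c \<in> carrier A}"
    have M: "submodule_of_B ?M"
      unfolding submodule_of_B_def
    proof (intro conjI ballI)
      show "?M \<subseteq> carrier B" using Nc(1) x by auto
      have "\<zero>\<^bsub>B\<^esub> = \<zero>\<^bsub>B\<^esub> \<oplus>\<^bsub>B\<^esub> f \<zero>\<^bsub>A\<^esub> \<otimes>\<^bsub>B\<^esub> x" using x by simp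
      then show "\<zero>\<^bsub>B\<^esub> \<in> ?M" using Nc(2) by blast
    next
      fix u v assume "u \<in> ?M" "v \<in> ?M"
      then obtain n c n' c' where n: "n \<in> N" "c \<in> carrier A" "u = n \<oplus>\<^bsub>B\<^esub> f c \<otimes>\<^bsub>B\<^esub> x"
        "n' \<in> N" "c' \<in> carrier A" "v = n' \<oplus>\<^bsub>B\<^esub> f c' \<otimes>\<^bsub>B\<^esub> x" by blast
      then have "u \<oplus>\<^bsub>B\<^esub> v = (n \<oplus>\<^bsub>B\<^esub> n') \<oplus>\<^bsub>B\<^esub> f (c \<oplus>\<^bsub>A\<^esub> c') \<otimes>\<^bsub>B\<^esub> x"
        using x Nc(1) by (auto simp: subset_iff B.l_distr B.a_ac)
      then show "u \<oplus>\<^bsub>B\<^esub> v \<in> ?M" using n Nc(3)[of n n'] A.a_closed[of c c'] by blast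
    next
      fix a u assume a: "a \<in> carrier A" "u \<in> ?M"
      then obtain n c where n: "n \<in> N" "c \<in> carrier A" "u = n \<oplus>\<^bsub>B\<^esub> f c \<otimes>\<^bsub>B\<^esub> x" by blast
      then have "f a \<otimes>\<^bsub>B\<^esub> u = f a \<otimes>\<^bsub>B\<^esub> n \<oplus>\<^bsub>B\<^esub> f (a \<otimes>\<^bsub>A\<^esub> c) \<otimes>\<^bsub>B\<^esub> x"
        using a(1) x Nc(1) by (auto simp: subset_iff B.r_distr B.m_assoc)
      then show "f a \<otimes>\<^bsub>B\<^esub> u \<in> ?M" using n Nc(4)[of a n] a(1) A.m_closed[of a c] by blast
    qed
    have NM: "N \<subseteq> ?M"
    proof
      fix n assume n: "n \<in> N"
      then have "n = n \<oplus>\<^bsub>B\<^esub> f \<zero>\<^bsub>A\<^esub> \<otimes>\<^bsub>B\<^esub> x" using x Nc(1) by auto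
      then show "n \<in> ?M" using n by blast
    qed
    have "x = \<zero>\<^bsub>B\<^esub> \<oplus>\<^bsub>B\<^esub> f \<one>\<^bsub>A\<^esub> \<otimes>\<^bsub>B\<^esub> x" using x by simp
    then have "x \<in> ?M" using Nc(2) by blast
    then have "?M \<noteq> N" using False by blast
    have "\<not> ?sep ?M"
    proof
      assume "?sep ?M"
      moreover have "r \<subseteq> ?M" using N(2) NM by (rule subset_trans)
      ultimately have "?M \<in> ?Z" using M by (intro CollectI conjI)
      then have "?M = N" using NM by (rule max[rule_format])
      then show False using \<open>?M \<noteq> N\<close> by contradiction
    qed
    then obtain a where a: "a \<in> carrier A" "f a \<otimes>\<^bsub>B\<^esub> s \<in> ?M" "a \<notin> ?p" by blast
    then obtain n c where n: "n \<in> N" "c \<in> carrier A" "f a \<otimes>\<^bsub>B\<^esub> s = n \<oplus>\<^bsub>B\<^esub> f c \<otimes>\<^bsub>B\<^esub> x" by blast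
    have nB: "n \<in> carrier B" using n(1) Nc(1) by blast
    \<comment> \<open>Otherwise \<open>c x\<close> lies in \<open>r\<close>, and the multiple \<open>a s\<close> lies in \<open>N\<close> itself.\<close>
    have "c \<notin> ?p"
    proof
      assume "c \<in> ?p"
      then have "f c \<otimes>\<^bsub>B\<^esub> x \<in> r" using rc(4) x by (auto simp: Spec_map_def)
      then have "f a \<otimes>\<^bsub>B\<^esub> s \<in> N" unfolding n(3) using n(1) N(2) Nc(3) by blast
      then show False using N(3) a(1,3) by blast
    qed
    moreover have "f c \<otimes>\<^bsub>B\<^esub> x \<ominus>\<^bsub>B\<^esub> f a \<otimes>\<^bsub>B\<^esub> s \<in> N"
    proof -
      have "f c \<otimes>\<^bsub>B\<^esub> x \<ominus>\<^bsub>B\<^esub> f a \<otimes>\<^bsub>B\<^esub> s = \<zero>\<^bsub>B\<^esub> \<ominus>\<^bsub>B\<^esub> n"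
        unfolding n(3) using nB f.hom_closed[OF n(2)] x by algebra
      then show ?thesis using submodule_minus[OF N(1) Nc(2) n(1)] by simp
    qed
    ultimately show ?thesis using n(2) a(1) by blast
  qed
  then show thesis using that[of N] N by blast
qed

text \<open>With \<open>\<lambda>\<close> the linear map to fractions whose kernel is the \<open>N\<close> of
  \<open>obtain_maximal_submodule\<close>, normalized by \<open>\<lambda> s = 1\<close>, the subgroup
  \<open>H\<close> is the kernel of \<open>(x, y) \<mapsto> \<lambda> x \<cdot> y\<close> with values in the
  fraction field of \<open>C/r'\<close>. This map is balanced, vanishes if \<open>x \<in> r\<close> or \<open>y
  \<in> r'\<close>, and sends \<open>(s, t)\<close> to \<open>t\<close>. As a formal sum involves only finitely
  many \<open>x\<close>, the fractions \<open>\<lambda> x = a x / d\<close> can be written with a common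
  denominator \<open>d\<close>, and vanishing is tested on the numerators in \<open>C\<close> modulo
  \<open>r'\<close>.\<close>

lemma obtain_separating_subgroup:
  assumes r: "r \<in> Spec B" and r': "r' \<in> Spec C" and eq: "Spec_map A f r = Spec_map A g r'"
    and s: "s \<in> carrier B" "s \<notin> r"
  obtains H where "subgroup H T.G" "T.K \<subseteq> H"
    "\<And>x y. x \<in> carrier B \<Longrightarrow> y \<in> carrier C \<Longrightarrow> x \<in> r \<or> y \<in> r' \<Longrightarrow> frag_of (x, y) \<in> H"
    "\<And>t. t \<in> carrier C \<Longrightarrow> t \<notin> r' \<Longrightarrow> frag_of (s, t) \<notin> H"
proof -
  define p where "p = Spec_map A f r"
  have p: "p \<in> Spec A" unfolding p_def by (rule Spec_map_in_Spec[OF A B f_hom r])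
  note pc = A.Spec_closed[OF p] and rc = C.Spec_closed[OF r']
  have p_iff: "a \<in> p \<longleftrightarrow> f a \<in> r" "a \<in> p \<longleftrightarrow> g a \<in> r'" if "a \<in> carrier A" for a
    using that eq by (auto simp: p_def Spec_map_def)
  obtain N where N: "submodule_of_B N" "r \<subseteq> N"
    and sep: "\<And>a. a \<in> carrier A \<Longrightarrow> f a \<otimes>\<^bsub>B\<^esub> s \<in> N \<Longrightarrow> a \<in> p"
    and frac: "\<And>x. x \<in> carrier B \<Longrightarrow>
      \<exists>d\<in>carrier A - p. \<exists>a\<in>carrier A. f d \<otimes>\<^bsub>B\<^esub> x \<ominus>\<^bsub>B\<^esub> f a \<otimes>\<^bsub>B\<^esub> s \<in> N"
    using obtain_maximal_submodule[OF r s] unfolding p_def by blast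
  have Nc: "N \<subseteq> carrier B" "\<zero>\<^bsub>B\<^esub> \<in> N" "\<And>x y. x \<in> N \<Longrightarrow> y \<in> N \<Longrightarrow> x \<oplus>\<^bsub>B\<^esub> y \<in> N"
    "\<And>a x. a \<in> carrier A \<Longrightarrow> x \<in> N \<Longrightarrow> f a \<otimes>\<^bsub>B\<^esub> x \<in> N"
    using N(1) by (auto simp: submodule_of_B_def)
  note Nm = submodule_minus[OF N(1)]
  let ?frac = "\<lambda>d a x. f d \<otimes>\<^bsub>B\<^esub> x \<ominus>\<^bsub>B\<^esub> f (a x) \<otimes>\<^bsub>B\<^esub> s \<in> N"
  let ?adm = "\<lambda>d a V. d \<in> carrier A - p \<and> a \<in> carrier B \<rightarrow> carrier A \<and> (\<forall>x\<in>V. ?frac d a x)"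
  have common: "\<exists>d a. ?adm d a V" if "finite V" "V \<subseteq> carrier B" for V
    using that
  proof (induction V rule: finite_induct)
    case empty
    then show ?case using pc(3) by (intro exI[of _ "\<one>\<^bsub>A\<^esub>"] exI[of _ "\<lambda>_. \<one>\<^bsub>A\<^esub>"]) auto
  next
    case (insert x V)
    then obtain d a where d: "d \<in> carrier A" "d \<notin> p" and a: "a \<in> carrier B \<rightarrow> carrier A"
      and V: "\<And>y. y \<in> V \<Longrightarrow> ?frac d a y" by auto
    have xB: "x \<in> carrier B" and VB: "V \<subseteq> carrier B" using insert by auto
    obtain e b where e: "e \<in> carrier A" "e \<notin> p" and b: "b \<in> carrier A"
      and x: "f e \<otimes>\<^bsub>B\<^esub> x \<ominus>\<^bsub>B\<^esub> f b \<otimes>\<^bsub>B\<^esub> s \<in> N" using frac[OF xB] by blast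
    define a' where "a' = (\<lambda>y. if y = x then d \<otimes>\<^bsub>A\<^esub> b else e \<otimes>\<^bsub>A\<^esub> a y)"
    have scale: "f (c \<otimes>\<^bsub>A\<^esub> d) \<otimes>\<^bsub>B\<^esub> y \<ominus>\<^bsub>B\<^esub> f (c \<otimes>\<^bsub>A\<^esub> b) \<otimes>\<^bsub>B\<^esub> s \<in> N"
      if cdb: "c \<in> carrier A" "d \<in> carrier A" "b \<in> carrier A" "y \<in> carrier B"
        and n: "f d \<otimes>\<^bsub>B\<^esub> y \<ominus>\<^bsub>B\<^esub> f b \<otimes>\<^bsub>B\<^esub> s \<in> N" for c d b y
    proof -
      have "f (c \<otimes>\<^bsub>A\<^esub> d) \<otimes>\<^bsub>B\<^esub> y \<ominus>\<^bsub>B\<^esub> f (c \<otimes>\<^bsub>A\<^esub> b) \<otimes>\<^bsub>B\<^esub> s = (f c \<otimes>\<^bsub>B\<^esub> f d) \<otimes>\<^bsub>B\<^esub> y \<ominus>\<^bsub>B\<^esub> (f c \<otimes>\<^bsub>B\<^esub> f b) \<otimes>\<^bsub>B\<^esub> s"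
        using cdb by simp
      also have "\<dots> = f c \<otimes>\<^bsub>B\<^esub> (f d \<otimes>\<^bsub>B\<^esub> y \<ominus>\<^bsub>B\<^esub> f b \<otimes>\<^bsub>B\<^esub> s)"
        using f.hom_closed[OF cdb(1)] f.hom_closed[OF cdb(2)] f.hom_closed[OF cdb(3)] cdb(4) s(1) by algebra
      finally show ?thesis using Nc(4)[OF cdb(1) n] by simp
    qed
    have "?frac (d \<otimes>\<^bsub>A\<^esub> e) a' y" if y: "y \<in> insert x V" for y
    proof (cases "y = x")
      case True
      then show ?thesis using scale[OF d(1) e(1) b xB x] by (simp add: a'_def)
    next
      case False
      then have yV: "y \<in> V" using y by blast
      then have yB: "y \<in> carrier B" using VB by blast
      have "a y \<in> carrier A" using a yB by blast
      then show ?thesis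
        using scale[OF e(1) d(1) _ yB V[OF yV]] False d(1) e(1) by (simp add: a'_def A.m_comm)
    qed
    moreover have "d \<otimes>\<^bsub>A\<^esub> e \<in> carrier A - p" using d e pc(4) by auto
    moreover have "a' \<in> carrier B \<rightarrow> carrier A" using a d(1) e(1) b by (auto simp: a'_def Pi_iff)
    ultimately show ?case by blast
  qed
  let ?b = "\<lambda>a (x, y). g (a x) \<otimes>\<^bsub>C\<^esub> y"
  \<comment> \<open>The finite set \<open>V\<close> records which elements the denominator \<open>d\<close> must serve; every choice of
    \<open>d\<close> and of numerators \<open>a\<close> has to give zero, which makes the condition stable under sums.\<close>
  let ?P = "\<lambda>z V. finite V \<and> V \<subseteq> carrier B \<and>
    (\<forall>d a. ?adm d a V \<longrightarrow> free_lift (add_monoid C) (?b a) z \<in> r')"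
  define H where "H = {z \<in> carrier T.G. \<exists>V. ?P z V}"
  have HI: "z \<in> H" if "z \<in> carrier T.G" "finite V" "V \<subseteq> carrier B"
    "\<And>d a. ?adm d a V \<Longrightarrow> free_lift (add_monoid C) (?b a) z \<in> r'" for z V
    unfolding H_def using that by (intro CollectI conjI exI[of _ V]) auto
  have HE: "\<exists>V. ?P z V" if "z \<in> H" for z using that by (simp add: H_def)
  have HG: "H \<subseteq> carrier T.G" unfolding H_def by blast
  have closed: "?b a \<in> carrier E \<times> carrier E' \<rightarrow> carrier (add_monoid C)"
    if "a \<in> carrier B \<rightarrow> carrier A" for a
    using that by (auto simp: E_simps Pi_iff)
  have lift_frag: "free_lift (add_monoid C) (?b a) (frag_of (x, y)) = g (a x) \<otimes>\<^bsub>C\<^esub> y"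
    if "a \<in> carrier B \<rightarrow> carrier A" "x \<in> carrier B" "y \<in> carrier C" for a x y
    using that by (subst free_lift_frag_of[OF C.a_comm_group]) (auto simp: Pi_iff)
  have minus: "free_lift (add_monoid C) (?b a) (z - w) =
      free_lift (add_monoid C) (?b a) z \<ominus>\<^bsub>C\<^esub> free_lift (add_monoid C) (?b a) w"
    if a: "a \<in> carrier B \<rightarrow> carrier A" and "z \<in> carrier T.G" "w \<in> carrier T.G" for a z w
    using that free_lift_diff[OF C.a_comm_group closed[OF a], of z w] by (simp add: a_minus_def a_inv_def)
  have diffG: "z - w \<in> carrier T.G" if "z \<in> carrier T.G" "w \<in> carrier T.G" for z w
    using T.G.m_closed[OF that(1) T.G.inv_closed[OF that(2)]] that(2) by simp
  have Hdiff: "z - w \<in> H" if z: "z \<in> H" and w: "w \<in> H" for z w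
  proof -
    obtain V where V: "?P z V" using HE[OF z] by blast
    obtain W where W: "?P w W" using HE[OF w] by blast
    note zw = subsetD[OF HG z] subsetD[OF HG w]
    show ?thesis
    proof (rule HI[of _ "V \<union> W"])
      fix d a assume "?adm d a (V \<union> W)"
      then have a: "a \<in> carrier B \<rightarrow> carrier A" and adm: "?adm d a V" "?adm d a W" by auto
      have "free_lift (add_monoid C) (?b a) z \<in> r'" "free_lift (add_monoid C) (?b a) w \<in> r'"
        using V W adm by blast+
      then show "free_lift (add_monoid C) (?b a) (z - w) \<in> r'"
        unfolding minus[OF a zw] by (rule rc(6))
    qed (use V W diffG[OF zw] in auto)
  qed
  have Hzero: "0 \<in> H"
  proof (rule HI[of _ "{}"])
    fix d a assume "?adm d a {}"
    show "free_lift (add_monoid C) (?b a) 0 \<in> r'"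
      using rc(2)
      by (simp add: free_lift_def comm_monoid.finprod_empty[OF comm_group.axioms(1)[OF C.a_comm_group]])
  qed auto
  have H: "subgroup H T.G"
  proof (rule T.G.subgroupI)
    show "H \<noteq> {}" using Hzero by blast
    show "inv\<^bsub>T.G\<^esub> z \<in> H" if "z \<in> H" for z
      using Hdiff[OF Hzero that] subsetD[OF HG that] by simp
    show "z \<otimes>\<^bsub>T.G\<^esub> w \<in> H" if "z \<in> H" "w \<in> H" for z w
      using Hdiff[OF that(1) Hdiff[OF Hzero that(2)]] by simp
  qed (rule HG)
  have fragG: "frag_of (x, y) \<in> carrier T.G" if "x \<in> carrier B" "y \<in> carrier C" for x y
    using that by (simp add: E_simps)
  have sep_diff: "g a \<ominus>\<^bsub>C\<^esub> g b \<in> r'"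
    if ab: "a \<in> carrier A" "b \<in> carrier A" and n: "f a \<otimes>\<^bsub>B\<^esub> s \<ominus>\<^bsub>B\<^esub> f b \<otimes>\<^bsub>B\<^esub> s \<in> N" for a b
  proof -
    have "f a \<otimes>\<^bsub>B\<^esub> s \<ominus>\<^bsub>B\<^esub> f b \<otimes>\<^bsub>B\<^esub> s = (f a \<ominus>\<^bsub>B\<^esub> f b) \<otimes>\<^bsub>B\<^esub> s"
      using f.hom_closed[OF ab(1)] f.hom_closed[OF ab(2)] s(1) by algebra
    then have "f (a \<ominus>\<^bsub>A\<^esub> b) \<otimes>\<^bsub>B\<^esub> s \<in> N" using n ab by (simp add: A.minus_eq B.minus_eq)
    then have "g (a \<ominus>\<^bsub>A\<^esub> b) \<in> r'" using sep[of "a \<ominus>\<^bsub>A\<^esub> b"] p_iff(2)[of "a \<ominus>\<^bsub>A\<^esub> b"] ab by simp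
    then show ?thesis using ab by (simp add: A.minus_eq C.minus_eq)
  qed
  have rel1: "frag_of (x \<oplus>\<^bsub>B\<^esub> x', y) - frag_of (x, y) - frag_of (x', y) \<in> H"
    if xy: "x \<in> carrier B" "x' \<in> carrier B" "y \<in> carrier C" for x x' y
  proof (rule HI[of _ "{x \<oplus>\<^bsub>B\<^esub> x', x, x'}"])
    fix d a assume "?adm d a {x \<oplus>\<^bsub>B\<^esub> x', x, x'}"
    then have d: "d \<in> carrier A" and a: "a \<in> carrier B \<rightarrow> carrier A"
      and n: "?frac d a (x \<oplus>\<^bsub>B\<^esub> x')" "?frac d a x" "?frac d a x'" by auto
    have ac: "a x \<in> carrier A" "a x' \<in> carrier A" "a (x \<oplus>\<^bsub>B\<^esub> x') \<in> carrier A" using a xy by auto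
    note fc = ac[THEN f.hom_closed] and gc = ac[THEN g.hom_closed]
    have "f (a x \<oplus>\<^bsub>A\<^esub> a x') \<otimes>\<^bsub>B\<^esub> s \<ominus>\<^bsub>B\<^esub> f (a (x \<oplus>\<^bsub>B\<^esub> x')) \<otimes>\<^bsub>B\<^esub> s
        = (f (a x) \<oplus>\<^bsub>B\<^esub> f (a x')) \<otimes>\<^bsub>B\<^esub> s \<ominus>\<^bsub>B\<^esub> f (a (x \<oplus>\<^bsub>B\<^esub> x')) \<otimes>\<^bsub>B\<^esub> s" using ac by simp
    also have "\<dots> = (f d \<otimes>\<^bsub>B\<^esub> (x \<oplus>\<^bsub>B\<^esub> x') \<ominus>\<^bsub>B\<^esub> f (a (x \<oplus>\<^bsub>B\<^esub> x')) \<otimes>\<^bsub>B\<^esub> s) \<ominus>\<^bsub>B\<^esub>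
        ((f d \<otimes>\<^bsub>B\<^esub> x \<ominus>\<^bsub>B\<^esub> f (a x) \<otimes>\<^bsub>B\<^esub> s) \<oplus>\<^bsub>B\<^esub> (f d \<otimes>\<^bsub>B\<^esub> x' \<ominus>\<^bsub>B\<^esub> f (a x') \<otimes>\<^bsub>B\<^esub> s))"
      using fc f.hom_closed[OF d] xy s(1) by algebra
    also have "\<dots> \<in> N" by (intro Nm Nc(3) n)
    finally have "g (a x \<oplus>\<^bsub>A\<^esub> a x') \<ominus>\<^bsub>C\<^esub> g (a (x \<oplus>\<^bsub>B\<^esub> x')) \<in> r'"
      by (intro sep_diff) (use ac in auto)
    then have "(\<ominus>\<^bsub>C\<^esub> y) \<otimes>\<^bsub>C\<^esub> (g (a x) \<oplus>\<^bsub>C\<^esub> g (a x') \<ominus>\<^bsub>C\<^esub> g (a (x \<oplus>\<^bsub>B\<^esub> x'))) \<in> r'"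
      using rc(4) xy ac by (simp add: C.minus_eq)
    moreover have "(\<ominus>\<^bsub>C\<^esub> y) \<otimes>\<^bsub>C\<^esub> (g (a x) \<oplus>\<^bsub>C\<^esub> g (a x') \<ominus>\<^bsub>C\<^esub> g (a (x \<oplus>\<^bsub>B\<^esub> x')))
      = g (a (x \<oplus>\<^bsub>B\<^esub> x')) \<otimes>\<^bsub>C\<^esub> y \<ominus>\<^bsub>C\<^esub> g (a x) \<otimes>\<^bsub>C\<^esub> y \<ominus>\<^bsub>C\<^esub> g (a x') \<otimes>\<^bsub>C\<^esub> y"
      using gc xy(3) by algebra
    ultimately show "free_lift (add_monoid C) (?b a) (frag_of (x \<oplus>\<^bsub>B\<^esub> x', y) - frag_of (x, y) - frag_of (x', y)) \<in> r'"
      using xy a by (simp add: minus fragG diffG lift_frag del: carrier_free_Abelian_group_iff frag_of_in_free_Abelian_group)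
  qed (use xy fragG diffG in \<open>auto simp del: carrier_free_Abelian_group_iff frag_of_in_free_Abelian_group\<close>)
  have rel2: "frag_of (x, y \<oplus>\<^bsub>C\<^esub> y') - frag_of (x, y) - frag_of (x, y') \<in> H"
    if xy: "x \<in> carrier B" "y \<in> carrier C" "y' \<in> carrier C" for x y y'
  proof (rule HI[of _ "{}"])
    fix d a assume "?adm d a {}"
    then have a: "a \<in> carrier B \<rightarrow> carrier A" by auto
    then have "g (a x) \<in> carrier C" using xy by auto
    then have "g (a x) \<otimes>\<^bsub>C\<^esub> (y \<oplus>\<^bsub>C\<^esub> y') \<ominus>\<^bsub>C\<^esub> g (a x) \<otimes>\<^bsub>C\<^esub> y \<ominus>\<^bsub>C\<^esub> g (a x) \<otimes>\<^bsub>C\<^esub> y' = \<zero>\<^bsub>C\<^esub>"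
      using xy by algebra
    then show "free_lift (add_monoid C) (?b a) (frag_of (x, y \<oplus>\<^bsub>C\<^esub> y') - frag_of (x, y) - frag_of (x, y')) \<in> r'"
      using xy a rc(2) by (simp add: minus fragG diffG lift_frag del: carrier_free_Abelian_group_iff frag_of_in_free_Abelian_group)
  qed (use xy fragG diffG in \<open>auto simp del: carrier_free_Abelian_group_iff frag_of_in_free_Abelian_group\<close>)
  have rel3: "frag_of (f c \<otimes>\<^bsub>B\<^esub> x, y) - frag_of (x, g c \<otimes>\<^bsub>C\<^esub> y) \<in> H"
    if xy: "c \<in> carrier A" "x \<in> carrier B" "y \<in> carrier C" for c x y
  proof (rule HI[of _ "{f c \<otimes>\<^bsub>B\<^esub> x, x}"])
    fix d a assume "?adm d a {f c \<otimes>\<^bsub>B\<^esub> x, x}"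
    then have d: "d \<in> carrier A" and a: "a \<in> carrier B \<rightarrow> carrier A"
      and n: "?frac d a (f c \<otimes>\<^bsub>B\<^esub> x)" "?frac d a x" by auto
    have ac: "a x \<in> carrier A" "a (f c \<otimes>\<^bsub>B\<^esub> x) \<in> carrier A" using a xy by auto
    note fc = ac[THEN f.hom_closed] and gc = ac[THEN g.hom_closed]
    have "f (a (f c \<otimes>\<^bsub>B\<^esub> x)) \<otimes>\<^bsub>B\<^esub> s \<ominus>\<^bsub>B\<^esub> f (c \<otimes>\<^bsub>A\<^esub> a x) \<otimes>\<^bsub>B\<^esub> s
        = f (a (f c \<otimes>\<^bsub>B\<^esub> x)) \<otimes>\<^bsub>B\<^esub> s \<ominus>\<^bsub>B\<^esub> (f c \<otimes>\<^bsub>B\<^esub> f (a x)) \<otimes>\<^bsub>B\<^esub> s" using ac xy by simp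
    also have "\<dots> = f c \<otimes>\<^bsub>B\<^esub> (f d \<otimes>\<^bsub>B\<^esub> x \<ominus>\<^bsub>B\<^esub> f (a x) \<otimes>\<^bsub>B\<^esub> s) \<ominus>\<^bsub>B\<^esub>
        (f d \<otimes>\<^bsub>B\<^esub> (f c \<otimes>\<^bsub>B\<^esub> x) \<ominus>\<^bsub>B\<^esub> f (a (f c \<otimes>\<^bsub>B\<^esub> x)) \<otimes>\<^bsub>B\<^esub> s)"
      using fc f.hom_closed[OF d] f.hom_closed[OF xy(1)] xy(2) s(1) by algebra
    also have "\<dots> \<in> N" by (intro Nm Nc(4) n xy(1))
    finally have "g (a (f c \<otimes>\<^bsub>B\<^esub> x)) \<ominus>\<^bsub>C\<^esub> g (c \<otimes>\<^bsub>A\<^esub> a x) \<in> r'"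
      by (intro sep_diff) (use ac xy in auto)
    then have "y \<otimes>\<^bsub>C\<^esub> (g (a (f c \<otimes>\<^bsub>B\<^esub> x)) \<ominus>\<^bsub>C\<^esub> g c \<otimes>\<^bsub>C\<^esub> g (a x)) \<in> r'"
      using rc(4) xy ac by (simp add: C.minus_eq)
    moreover have "y \<otimes>\<^bsub>C\<^esub> (g (a (f c \<otimes>\<^bsub>B\<^esub> x)) \<ominus>\<^bsub>C\<^esub> g c \<otimes>\<^bsub>C\<^esub> g (a x))
      = g (a (f c \<otimes>\<^bsub>B\<^esub> x)) \<otimes>\<^bsub>C\<^esub> y \<ominus>\<^bsub>C\<^esub> g (a x) \<otimes>\<^bsub>C\<^esub> (g c \<otimes>\<^bsub>C\<^esub> y)"
      using gc g.hom_closed[OF xy(1)] xy(3) by algebra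
    ultimately show "free_lift (add_monoid C) (?b a) (frag_of (f c \<otimes>\<^bsub>B\<^esub> x, y) - frag_of (x, g c \<otimes>\<^bsub>C\<^esub> y)) \<in> r'"
      using xy a by (simp add: minus fragG diffG lift_frag del: carrier_free_Abelian_group_iff frag_of_in_free_Abelian_group)
  qed (use xy fragG diffG in \<open>auto simp del: carrier_free_Abelian_group_iff frag_of_in_free_Abelian_group\<close>)
  have "tensor_relations A E E' \<subseteq> H"
    unfolding tensor_relations_def E_simps using rel1 rel2 rel3 by auto
  then have KH: "T.K \<subseteq> H"
    unfolding tensor_kernel_def using H by (rule T.G.generate_subgroup_incl)
  have mem: "frag_of (x, y) \<in> H" if xy: "x \<in> carrier B" "y \<in> carrier C" "x \<in> r \<or> y \<in> r'" for x y
  proof (rule HI[of _ "{x}"])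
    fix d a assume "?adm d a {x}"
    then have d: "d \<in> carrier A" and a: "a \<in> carrier B \<rightarrow> carrier A" and n: "?frac d a x" by auto
    have ax: "a x \<in> carrier A" using a xy by blast
    have "g (a x) \<otimes>\<^bsub>C\<^esub> y \<in> r'"
    proof (cases "x \<in> r")
      case True
      then have "f d \<otimes>\<^bsub>B\<^esub> x \<in> N" using Nc(4)[OF d] N(2) by blast
      then have "f d \<otimes>\<^bsub>B\<^esub> x \<ominus>\<^bsub>B\<^esub> (f d \<otimes>\<^bsub>B\<^esub> x \<ominus>\<^bsub>B\<^esub> f (a x) \<otimes>\<^bsub>B\<^esub> s) \<in> N" using n by (rule Nm)
      moreover have "f d \<otimes>\<^bsub>B\<^esub> x \<ominus>\<^bsub>B\<^esub> (f d \<otimes>\<^bsub>B\<^esub> x \<ominus>\<^bsub>B\<^esub> f (a x) \<otimes>\<^bsub>B\<^esub> s) = f (a x) \<otimes>\<^bsub>B\<^esub> s"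
        using f.hom_closed[OF d] f.hom_closed[OF ax] xy(1) s(1) by algebra
      ultimately have "a x \<in> p" using sep[OF ax] by simp
      then show ?thesis using p_iff(2)[OF ax] rc(4) ax xy by simp
    next
      case False
      then show ?thesis using xy ax rc(4) by auto
    qed
    then show "free_lift (add_monoid C) (?b a) (frag_of (x, y)) \<in> r'" using lift_frag[OF a xy(1,2)] by simp
  qed (use xy fragG in \<open>auto simp del: carrier_free_Abelian_group_iff frag_of_in_free_Abelian_group\<close>)
  have not_mem: "frag_of (s, t) \<notin> H" if t: "t \<in> carrier C" "t \<notin> r'" for t
  proof
    assume "frag_of (s, t) \<in> H"
    from HE[OF this] obtain V where V: "?P (frag_of (s, t)) V" by (elim exE)
    have "finite (insert s V)" "insert s V \<subseteq> carrier B" using V s(1) by (simp_all del: split_paired_All)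
    then have "\<exists>d a. ?adm d a (insert s V)" by (rule common)
    then obtain d a where da: "?adm d a (insert s V)" by (elim exE)
    then have adm: "?adm d a V" by blast
    from da have d: "d \<in> carrier A" "d \<notin> p" and a: "a \<in> carrier B \<rightarrow> carrier A" and n: "?frac d a s"
      by auto
    have as: "a s \<in> carrier A" using a s by blast
    have "free_lift (add_monoid C) (?b a) (frag_of (s, t)) \<in> r'" using V adm by blast
    then have "g (a s) \<otimes>\<^bsub>C\<^esub> t \<in> r'" unfolding lift_frag[OF a s(1) t(1)] .
    then have 1: "g (a s) \<in> r'" using rc(4) t as by auto
    have "g d \<ominus>\<^bsub>C\<^esub> g (a s) \<in> r'" by (rule sep_diff[OF d(1) as n])
    then have "g d \<ominus>\<^bsub>C\<^esub> g (a s) \<oplus>\<^bsub>C\<^esub> g (a s) \<in> r'" using 1 by (rule rc(5))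
    moreover have "g d \<ominus>\<^bsub>C\<^esub> g (a s) \<oplus>\<^bsub>C\<^esub> g (a s) = g d"
      using g.hom_closed[OF d(1)] g.hom_closed[OF as] by algebra
    ultimately show False using p_iff(2)[OF d(1)] d(2) by simp
  qed
  show thesis using that[OF H KH mem not_mem] .
qed

text \<open>Primes of \<open>B\<close> and \<open>C\<close> over the same prime of \<open>A\<close> have a
  common prime above them in \<open>D = B \<otimes> C\<close>. It must contain \<open>r\<close> and
  \<open>r'\<close> and avoid all \<open>\<beta> s \<cdot> \<gamma> t\<close> with \<open>s \<notin> r\<close>
  and \<open>t \<notin> r'\<close>. For fixed \<open>s\<close>, the image \<open>Z\<close> of the separating
  subgroup contains the ideal generated by \<open>r\<close> and \<open>r'\<close>, but none of these
  products.\<close>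

lemma obtain_common_prime:
  fixes D :: "('d, 'n) ring_scheme"
  assumes D: "cring D" and \<beta>: "\<beta> \<in> ring_hom B D" and \<gamma>: "\<gamma> \<in> ring_hom C D"
    and comm: "\<And>a. a \<in> carrier A \<Longrightarrow> \<beta> (f a) = \<gamma> (g a)"
    and bij: "bij_betw (tensor_lift (add_monoid D) (\<lambda>(x, y). \<beta> x \<otimes>\<^bsub>D\<^esub> \<gamma> y)) (carrier T.MN) (carrier D)"
    and r: "r \<in> Spec B" and r': "r' \<in> Spec C" and eq: "Spec_map A f r = Spec_map A g r'"
  obtains q where "q \<in> Spec D" "Spec_map B \<beta> q = r" "Spec_map C \<gamma> q = r'"
proof -
  interpret D: cring D by (rule D)
  interpret \<beta>: ring_hom_cring B D \<beta> by unfold_locales (rule \<beta>)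
  interpret \<gamma>: ring_hom_cring C D \<gamma> by unfold_locales (rule \<gamma>)
  let ?b = "\<lambda>(x, y). \<beta> x \<otimes>\<^bsub>D\<^esub> \<gamma> y"
  define L where "L = tensor_lift (add_monoid D) ?b"
  note rc = B.Spec_closed[OF r] and rc' = C.Spec_closed[OF r']
  have cancel: "u \<oplus>\<^bsub>D\<^esub> v \<ominus>\<^bsub>D\<^esub> u \<ominus>\<^bsub>D\<^esub> v = \<zero>\<^bsub>D\<^esub>" "u \<ominus>\<^bsub>D\<^esub> u = \<zero>\<^bsub>D\<^esub>"
    if "u \<in> carrier D" "v \<in> carrier D" for u v using that by algebra+
  have bal: "balanced_mod A E E' (add_monoid D) {\<one>\<^bsub>add_monoid D\<^esub>} ?b"
    unfolding balanced_mod_def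
    using cancel comm
    by (auto simp: E_simps D.l_distr D.r_distr D.m_ac simp flip: a_inv_def D.minus_eq)
  have L_hom: "L \<in> hom T.MN (add_monoid D)"
    unfolding L_def by (rule T.tensor_lift_hom[OF D.a_comm_group bal])
  have L_pt: "L (T.pt x y) = \<beta> x \<otimes>\<^bsub>D\<^esub> \<gamma> y" if "x \<in> carrier B" "y \<in> carrier C" for x y
    using T.tensor_lift_pt[OF D.a_comm_group bal] that by (simp add: L_def E_simps)
  have L_inj: "inj_on L (carrier T.MN)" and L_surj: "L ` carrier T.MN = carrier D"
    using bij by (auto simp: bij_betw_def L_def)
  interpret L: group_hom T.MN "add_monoid D" L
    by (intro group_hom.intro group_hom_axioms.intro T.MN.group_axioms D.a_group L_hom)
  let ?gen = "\<beta> ` r \<union> \<gamma> ` r'"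
  let ?J = "Idl\<^bsub>D\<^esub> ?gen"
  let ?S = "(\<lambda>(s, t). \<beta> s \<otimes>\<^bsub>D\<^esub> \<gamma> t) ` ((carrier B - r) \<times> (carrier C - r'))"
  have gen: "?gen \<subseteq> carrier D" using rc(1) rc'(1) by auto
  have disj: "\<beta> s \<otimes>\<^bsub>D\<^esub> \<gamma> t \<notin> ?J"
    if s: "s \<in> carrier B" "s \<notin> r" and t: "t \<in> carrier C" "t \<notin> r'" for s t
  proof
    assume J: "\<beta> s \<otimes>\<^bsub>D\<^esub> \<gamma> t \<in> ?J"
    obtain H where H: "subgroup H T.G" "T.K \<subseteq> H"
      and mem: "\<And>x y. x \<in> carrier B \<Longrightarrow> y \<in> carrier C \<Longrightarrow> x \<in> r \<or> y \<in> r' \<Longrightarrow> frag_of (x, y) \<in> H"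
      and not_mem: "\<And>t. t \<in> carrier C \<Longrightarrow> t \<notin> r' \<Longrightarrow> frag_of (s, t) \<notin> H"
      using obtain_separating_subgroup[OF r r' eq s] by blast
    have HG: "H \<subseteq> carrier T.G" using H(1) by (rule subgroup.subset)
    let ?h = "\<lambda>z. L (T.K #>\<^bsub>T.G\<^esub> z)"
    define Z where "Z = ?h ` H"
    have h_frag: "?h (frag_of (x, y)) = \<beta> x \<otimes>\<^bsub>D\<^esub> \<gamma> y" if "x \<in> carrier B" "y \<in> carrier C" for x y
      using L_pt[OF that] by (simp add: T.pt_eq)
    have Z: "subgroup Z (add_monoid D)"
    proof -
      have "subgroup ((\<lambda>z. T.K #>\<^bsub>T.G\<^esub> z) ` H) T.MN" by (rule T.proj.subgroup_img_is_subgroup[OF H(1)])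
      then have "subgroup (L ` (\<lambda>z. T.K #>\<^bsub>T.G\<^esub> z) ` H) (add_monoid D)" by (rule L.subgroup_img_is_subgroup)
      then show ?thesis by (simp add: Z_def image_image)
    qed
    note Zc = subgroup.m_closed[OF Z] subgroup.m_inv_closed[OF Z] subgroup.one_closed[OF Z]
      subgroup.subset[OF Z]
    have Z_mem: "\<beta> x \<otimes>\<^bsub>D\<^esub> \<gamma> y \<in> Z" if "x \<in> carrier B" "y \<in> carrier C" "x \<in> r \<or> y \<in> r'" for x y
      unfolding Z_def using mem[OF that] h_frag[OF that(1,2)] by (metis image_eqI)
    \<comment> \<open>\<open>I\<close> is the largest ideal inside the additive subgroup \<open>Z\<close>.\<close>
    define I where "I = {w \<in> carrier D. \<forall>d\<in>carrier D. d \<otimes>\<^bsub>D\<^esub> w \<in> Z}"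
    have I: "ideal I D"
      unfolding D.ideal_iff_closed I_def
      using Zc by (auto simp: D.r_distr simp flip: D.m_assoc)
    have I_mem: "w \<in> I" if w: "w \<in> carrier D"
      and gen: "\<And>x y. x \<in> carrier B \<Longrightarrow> y \<in> carrier C \<Longrightarrow> (\<beta> x \<otimes>\<^bsub>D\<^esub> \<gamma> y) \<otimes>\<^bsub>D\<^esub> w \<in> Z" for w
    proof -
      let ?U = "{u \<in> carrier T.MN. L u \<otimes>\<^bsub>D\<^esub> w \<in> Z}"
      have "subgroup ?U T.MN"
      proof (rule T.MN.subgroupI)
        show "?U \<noteq> {}" using L.hom_one w Zc(3) by (auto intro!: exI[of _ "\<one>\<^bsub>T.MN\<^esub>"])
        show "inv\<^bsub>T.MN\<^esub> u \<in> ?U" if "u \<in> ?U" for u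
          using that w Zc(2)[of "L u \<otimes>\<^bsub>D\<^esub> w"] L.hom_inv[of u] L.hom_closed[of u]
          by (simp add: D.l_minus flip: a_inv_def)
        show "u \<otimes>\<^bsub>T.MN\<^esub> v \<in> ?U" if "u \<in> ?U" "v \<in> ?U" for u v
          using that w Zc(1)[of "L u \<otimes>\<^bsub>D\<^esub> w" "L v \<otimes>\<^bsub>D\<^esub> w"] L.hom_mult[of u v] L.hom_closed[of u] L.hom_closed[of v]
          by (simp add: D.l_distr)
      qed auto
      then have "?U = carrier T.MN"
        by (rule T.tensor_subgroup_eq_carrier) (use gen L_pt T.pt_closed in \<open>auto simp: E_simps\<close>)
      then have "\<forall>u\<in>carrier T.MN. L u \<otimes>\<^bsub>D\<^esub> w \<in> Z" by blast
      then have "\<forall>d\<in>L ` carrier T.MN. d \<otimes>\<^bsub>D\<^esub> w \<in> Z" by blast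
      then show ?thesis unfolding L_surj I_def using w by blast
    qed
    have "\<beta> x \<in> I" if x: "x \<in> r" for x
    proof (rule I_mem)
      have xB: "x \<in> carrier B" using x rc(1) by blast
      then show "\<beta> x \<in> carrier D" by simp
      fix x' y assume x': "x' \<in> carrier B" "y \<in> carrier C"
      have "x' \<otimes>\<^bsub>B\<^esub> x \<in> r" using rc(4)[of x' x] x x' xB by simp
      then have "\<beta> (x' \<otimes>\<^bsub>B\<^esub> x) \<otimes>\<^bsub>D\<^esub> \<gamma> y \<in> Z" using Z_mem[of "x' \<otimes>\<^bsub>B\<^esub> x" y] x' xB by simp
      moreover have "\<beta> (x' \<otimes>\<^bsub>B\<^esub> x) \<otimes>\<^bsub>D\<^esub> \<gamma> y = (\<beta> x' \<otimes>\<^bsub>D\<^esub> \<gamma> y) \<otimes>\<^bsub>D\<^esub> \<beta> x"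
        using x' xB by (simp add: D.m_ac)
      ultimately show "(\<beta> x' \<otimes>\<^bsub>D\<^esub> \<gamma> y) \<otimes>\<^bsub>D\<^esub> \<beta> x \<in> Z" by simp
    qed
    moreover have "\<gamma> y \<in> I" if y: "y \<in> r'" for y
    proof (rule I_mem)
      have yC: "y \<in> carrier C" using y rc'(1) by blast
      then show "\<gamma> y \<in> carrier D" by simp
      fix x y' assume x: "x \<in> carrier B" "y' \<in> carrier C"
      have "y' \<otimes>\<^bsub>C\<^esub> y \<in> r'" using rc'(4)[of y' y] x y yC by simp
      then have "\<beta> x \<otimes>\<^bsub>D\<^esub> \<gamma> (y' \<otimes>\<^bsub>C\<^esub> y) \<in> Z" using Z_mem[of x "y' \<otimes>\<^bsub>C\<^esub> y"] x yC by simp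
      moreover have "\<beta> x \<otimes>\<^bsub>D\<^esub> \<gamma> (y' \<otimes>\<^bsub>C\<^esub> y) = (\<beta> x \<otimes>\<^bsub>D\<^esub> \<gamma> y') \<otimes>\<^bsub>D\<^esub> \<gamma> y"
        using x yC by (simp add: D.m_ac)
      ultimately show "(\<beta> x \<otimes>\<^bsub>D\<^esub> \<gamma> y') \<otimes>\<^bsub>D\<^esub> \<gamma> y \<in> Z" by simp
    qed
    ultimately have "?gen \<subseteq> I" by blast
    then have "?J \<subseteq> I" using D.genideal_minimal[OF I] by blast
    then have "\<one>\<^bsub>D\<^esub> \<otimes>\<^bsub>D\<^esub> (\<beta> s \<otimes>\<^bsub>D\<^esub> \<gamma> t) \<in> Z" using J unfolding I_def by blast
    \<comment> \<open>Membership in \<open>Z\<close> lifts to \<open>H\<close> because \<open>L\<close> is injective and \<open>H\<close> contains the tensor relations.\<close>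
    then have "?h (frag_of (s, t)) \<in> Z" using h_frag s t by simp
    then obtain w where w: "w \<in> H" "?h (frag_of (s, t)) = ?h w" by (auto simp: Z_def)
    have stG: "frag_of (s, t) \<in> carrier T.G" using s t by (simp add: E_simps)
    have wG: "w \<in> carrier T.G" using w HG by blast
    have "T.K #>\<^bsub>T.G\<^esub> frag_of (s, t) = T.K #>\<^bsub>T.G\<^esub> w"
      by (rule inj_onD[OF L_inj w(2)]) (use stG wG T.carrier_MN in auto)
    then have "frag_of (s, t) - w \<in> H" using T.coset_eq_iff[OF stG wG] H(2) by blast
    then have "(frag_of (s, t) - w) \<otimes>\<^bsub>T.G\<^esub> w \<in> H" using w(1) by (rule subgroup.m_closed[OF H(1)])
    then show False using not_mem[OF t] by simp
  qed
  obtain q where q: "q \<in> Spec D" "?J \<subseteq> q" "q \<inter> ?S = {}"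
  proof (rule D.obtain_prime_disjoint[OF D.genideal_ideal[OF gen], of ?S])
    show "\<one>\<^bsub>D\<^esub> \<in> ?S" using rc(3) rc'(3) by (intro image_eqI[of _ _ "(\<one>\<^bsub>B\<^esub>, \<one>\<^bsub>C\<^esub>)"]) auto
    show "u \<otimes>\<^bsub>D\<^esub> v \<in> ?S" if uv: "u \<in> ?S" "v \<in> ?S" for u v
    proof -
      obtain s t s' t' where st: "s \<in> carrier B - r" "s' \<in> carrier B - r" "t \<in> carrier C - r'"
        "t' \<in> carrier C - r'" "u = \<beta> s \<otimes>\<^bsub>D\<^esub> \<gamma> t" "v = \<beta> s' \<otimes>\<^bsub>D\<^esub> \<gamma> t'"
        using uv by auto
      then have "u \<otimes>\<^bsub>D\<^esub> v = \<beta> (s \<otimes>\<^bsub>B\<^esub> s') \<otimes>\<^bsub>D\<^esub> \<gamma> (t \<otimes>\<^bsub>C\<^esub> t')" by (simp add: D.m_ac)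
      then show ?thesis
        using st rc(4) rc'(4) by (intro image_eqI[of _ _ "(s \<otimes>\<^bsub>B\<^esub> s', t \<otimes>\<^bsub>C\<^esub> t')"]) auto
    qed
    show "?J \<inter> ?S = {}" using disj by auto
  qed auto
  have in_q: "\<beta> ` r \<subseteq> q" "\<gamma> ` r' \<subseteq> q" using D.genideal_self[OF gen] q(2) by auto
  have "\<beta> s \<notin> q" if "s \<in> carrier B" "s \<notin> r" for s
  proof -
    have "\<beta> s \<otimes>\<^bsub>D\<^esub> \<gamma> \<one>\<^bsub>C\<^esub> \<in> ?S"
      using that rc'(3) by (intro image_eqI[of _ _ "(s, \<one>\<^bsub>C\<^esub>)"]) auto
    then show ?thesis using q(3) that by auto
  qed
  moreover have "\<gamma> t \<notin> q" if "t \<in> carrier C" "t \<notin> r'" for t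
  proof -
    have "\<beta> \<one>\<^bsub>B\<^esub> \<otimes>\<^bsub>D\<^esub> \<gamma> t \<in> ?S"
      using that rc(3) by (intro image_eqI[of _ _ "(\<one>\<^bsub>B\<^esub>, t)"]) auto
    then show ?thesis using q(3) that by auto
  qed
  ultimately have "Spec_map B \<beta> q = r" "Spec_map C \<gamma> q = r'"
    using in_q rc(1) rc'(1) by (auto simp: Spec_map_def)
  then show thesis using that q(1) by blast
qed

end

section \<open>Finite products of rings\<close>

lemma product_ring_simps:
  "carrier (product_ring I R) = (\<Pi>\<^sub>E i\<in>I. carrier (R i))"
  "s \<otimes>\<^bsub>product_ring I R\<^esub> t = (\<lambda>i\<in>I. s i \<otimes>\<^bsub>R i\<^esub> t i)"
  "\<one>\<^bsub>product_ring I R\<^esub> = (\<lambda>i\<in>I. \<one>\<^bsub>R i\<^esub>)"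
  "\<zero>\<^bsub>product_ring I R\<^esub> = (\<lambda>i\<in>I. \<zero>\<^bsub>R i\<^esub>)"
  "s \<oplus>\<^bsub>product_ring I R\<^esub> t = (\<lambda>i\<in>I. s i \<oplus>\<^bsub>R i\<^esub> t i)"
  by (simp_all add: product_ring_def)

lemma product_ring_cring:
  assumes R: "\<And>i. i \<in> I \<Longrightarrow> cring (R i)"
  shows "cring (product_ring I R)"
proof -
  have mon: "\<And>i. i \<in> I \<Longrightarrow> Group.monoid (R i)" and cmon: "\<And>i. i \<in> I \<Longrightarrow> comm_monoid (R i)"
    and ring: "\<And>i. i \<in> I \<Longrightarrow> ring (R i)"
    using R by (auto simp: cring_def ring_def)
  have ag: "\<And>i. i \<in> I \<Longrightarrow> abelian_group (R i)" using ring by (auto simp: ring_def)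
  have am: "\<And>i. i \<in> I \<Longrightarrow> abelian_monoid (R i)" using ag by (auto simp: abelian_group_def)
  show ?thesis
  proof (rule cringI)
    show "abelian_group (product_ring I R)"
    proof (rule abelian_groupI)
      show "\<exists>t\<in>carrier (product_ring I R). t \<oplus>\<^bsub>product_ring I R\<^esub> s = \<zero>\<^bsub>product_ring I R\<^esub>"
        if s: "s \<in> carrier (product_ring I R)" for s
      proof (intro bexI)
        show "(\<lambda>i\<in>I. \<ominus>\<^bsub>R i\<^esub> s i) \<oplus>\<^bsub>product_ring I R\<^esub> s = \<zero>\<^bsub>product_ring I R\<^esub>"
          using s ag by (auto simp: product_ring_simps PiE_iff abelian_group.l_neg intro!: restrict_ext)
        show "(\<lambda>i\<in>I. \<ominus>\<^bsub>R i\<^esub> s i) \<in> carrier (product_ring I R)"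
          using s ag by (auto simp: product_ring_simps PiE_iff abelian_group.a_inv_closed)
      qed
    qed (use am in \<open>auto simp: product_ring_simps PiE_iff extensional_def fun_eq_iff
          abelian_monoid.a_closed abelian_monoid.zero_closed abelian_monoid.l_zero
          abelian_monoid.r_zero abelian_monoid.a_assoc abelian_monoid.a_comm abelian_monoid.a_lcomm\<close>)
    show "comm_monoid (product_ring I R)"
      by (rule comm_monoidI) (use mon cmon in \<open>auto simp: product_ring_simps PiE_iff extensional_def
          fun_eq_iff monoid.m_closed monoid.one_closed monoid.l_one monoid.m_assoc comm_monoid.m_comm comm_monoid.m_lcomm\<close>)
  qed (use ring in \<open>auto simp: product_ring_simps PiE_iff fun_eq_iff ring.ring_simprules\<close>)
qed

lemma product_ring_proj: "i \<in> I \<Longrightarrow> (\<lambda>s. s i) \<in> ring_hom (product_ring I R) (R i)"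
  by (rule ring_hom_memI) (auto simp: product_ring_simps)

text \<open>A prime that avoids the idempotent of the factor \<open>i\<close> is decided by the component at
  \<open>i\<close>, because multiplication by this idempotent does not affect membership.\<close>

lemma Spec_product_ring_factor:
  assumes R: "\<And>i. i \<in> I \<Longrightarrow> cring (R i)" and Q: "Q \<in> Spec (product_ring I R)"
    and i: "i \<in> I" and e: "(\<lambda>j\<in>I. if j = i then \<one>\<^bsub>R j\<^esub> else \<zero>\<^bsub>R j\<^esub>) \<notin> Q"
  obtains q where "q \<in> Spec (R i)" "Q = Spec_map (product_ring I R) (\<lambda>s. s i) q"
proof -
  let ?P = "product_ring I R"
  interpret P: cring ?P by (rule product_ring_cring[OF R])
  interpret Ri: cring "R i" by (rule R[OF i])
  note Qc = P.Spec_closed[OF Q]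
  define \<delta> where "\<delta> = (\<lambda>b. \<lambda>j\<in>I. if j = i then b else \<zero>\<^bsub>R j\<^esub>)"
  have zero: "\<zero>\<^bsub>R j\<^esub> \<in> carrier (R j)" "x \<in> carrier (R j) \<Longrightarrow> \<zero>\<^bsub>R j\<^esub> \<otimes>\<^bsub>R j\<^esub> x = \<zero>\<^bsub>R j\<^esub>"
    "\<zero>\<^bsub>R j\<^esub> \<oplus>\<^bsub>R j\<^esub> \<zero>\<^bsub>R j\<^esub> = \<zero>\<^bsub>R j\<^esub>" if "j \<in> I" for j x
  proof -
    interpret cring "R j" by (rule R[OF that])
    show "\<zero>\<^bsub>R j\<^esub> \<in> carrier (R j)" "x \<in> carrier (R j) \<Longrightarrow> \<zero>\<^bsub>R j\<^esub> \<otimes>\<^bsub>R j\<^esub> x = \<zero>\<^bsub>R j\<^esub>"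
      "\<zero>\<^bsub>R j\<^esub> \<oplus>\<^bsub>R j\<^esub> \<zero>\<^bsub>R j\<^esub> = \<zero>\<^bsub>R j\<^esub>" by auto
  qed
  have \<delta>_closed: "\<delta> b \<in> carrier ?P" if "b \<in> carrier (R i)" for b
    using that zero by (auto simp: \<delta>_def product_ring_simps)
  have \<delta>_add: "\<delta> a \<oplus>\<^bsub>?P\<^esub> \<delta> b = \<delta> (a \<oplus>\<^bsub>R i\<^esub> b)" for a b
    using zero by (auto simp: \<delta>_def product_ring_simps fun_eq_iff)
  have \<delta>_mult: "\<delta> a \<otimes>\<^bsub>?P\<^esub> s = \<delta> (a \<otimes>\<^bsub>R i\<^esub> s i)" if "s \<in> carrier ?P" for a s
    using that zero by (auto simp: \<delta>_def product_ring_simps fun_eq_iff PiE_iff)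
  have \<delta>_i: "\<delta> b i = b" for b using i by (simp add: \<delta>_def)
  have \<delta>_zero: "\<delta> \<zero>\<^bsub>R i\<^esub> = \<zero>\<^bsub>?P\<^esub>" by (auto simp: \<delta>_def product_ring_simps)
  have \<delta>_one: "\<delta> \<one>\<^bsub>R i\<^esub> \<notin> Q"
  proof -
    have "\<delta> \<one>\<^bsub>R i\<^esub> = (\<lambda>j\<in>I. if j = i then \<one>\<^bsub>R j\<^esub> else \<zero>\<^bsub>R j\<^esub>)" by (auto simp: \<delta>_def)
    then show ?thesis using e by simp
  qed
  define q where "q = {b \<in> carrier (R i). \<delta> b \<in> Q}"
  have "q \<in> Spec (R i)"
  proof (rule Ri.SpecI)
    show "a \<oplus>\<^bsub>R i\<^esub> b \<in> q" if "a \<in> q" "b \<in> q" for a b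
      using that Qc(5)[of "\<delta> a" "\<delta> b"] by (simp add: q_def \<delta>_add)
    have mult: "\<delta> (x \<otimes>\<^bsub>R i\<^esub> a) \<in> Q \<longleftrightarrow> \<delta> x \<in> Q \<or> \<delta> a \<in> Q"
      if "x \<in> carrier (R i)" "a \<in> carrier (R i)" for x a
      using Qc(4)[OF \<delta>_closed[OF that(1)] \<delta>_closed[OF that(2)]] \<delta>_mult[OF \<delta>_closed[OF that(2)]]
      by (simp add: \<delta>_i)
    show "x \<otimes>\<^bsub>R i\<^esub> a \<in> q" if "a \<in> q" "x \<in> carrier (R i)" for a x
      using that mult[of x a] by (simp add: q_def)
    show "a \<in> q \<or> b \<in> q" if "a \<in> carrier (R i)" "b \<in> carrier (R i)" "a \<otimes>\<^bsub>R i\<^esub> b \<in> q" for a b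
      using that mult[of a b] by (simp add: q_def)
  qed (use Qc(2) \<delta>_zero \<delta>_one in \<open>auto simp: q_def\<close>)
  moreover have "Q = Spec_map ?P (\<lambda>s. s i) q"
  proof -
    have "s \<in> Q \<longleftrightarrow> s i \<in> q" if s: "s \<in> carrier ?P" for s
    proof -
      have si: "s i \<in> carrier (R i)" using s i by (auto simp: product_ring_simps)
      have "\<delta> (s i) = \<delta> \<one>\<^bsub>R i\<^esub> \<otimes>\<^bsub>?P\<^esub> s" using \<delta>_mult[OF s] si by simp
      then show ?thesis
        using Qc(4)[OF \<delta>_closed[OF Ri.one_closed] s] \<delta>_one si by (simp add: q_def)
    qed
    then show ?thesis using Qc(1) by (auto simp: Spec_map_def)
  qed
  ultimately show thesis using that by blast
qed

text \<open>The idempotents of the factors sum to \<open>1\<close>, so a prime cannot contain all of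
  them.\<close>

lemma Spec_product_ring:
  assumes I: "finite I" and R: "\<And>i. i \<in> I \<Longrightarrow> cring (R i)" and Q: "Q \<in> Spec (product_ring I R)"
  obtains i q where "i \<in> I" "q \<in> Spec (R i)" "Q = Spec_map (product_ring I R) (\<lambda>s. s i) q"
proof -
  let ?P = "product_ring I R" and ?e = "\<lambda>J. \<lambda>j\<in>I. if j \<in> J then \<one>\<^bsub>R j\<^esub> else \<zero>\<^bsub>R j\<^esub>"
  interpret P: cring ?P by (rule product_ring_cring[OF R])
  note Qc = P.Spec_closed[OF Q]
  have "\<exists>i\<in>I. ?e {i} \<notin> Q"
  proof (rule ccontr)
    assume "\<not> ?thesis"
    then have e: "\<And>i. i \<in> I \<Longrightarrow> ?e {i} \<in> Q" by blast
    have "?e J \<in> Q" if "J \<subseteq> I" for J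
      using finite_subset[OF that I] that
    proof (induction J rule: finite_induct)
      case empty
      have "?e {} = \<zero>\<^bsub>?P\<^esub>" by (simp add: product_ring_simps)
      then show ?case using Qc(2) by simp
    next
      case (insert i J)
      have "\<zero>\<^bsub>R j\<^esub> \<oplus>\<^bsub>R j\<^esub> \<zero>\<^bsub>R j\<^esub> = \<zero>\<^bsub>R j\<^esub>" "\<one>\<^bsub>R j\<^esub> \<oplus>\<^bsub>R j\<^esub> \<zero>\<^bsub>R j\<^esub> = \<one>\<^bsub>R j\<^esub>"
        "\<zero>\<^bsub>R j\<^esub> \<oplus>\<^bsub>R j\<^esub> \<one>\<^bsub>R j\<^esub> = \<one>\<^bsub>R j\<^esub>" if "j \<in> I" for j
      proof -
        interpret cring "R j" by (rule R[OF that])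
        show "\<zero>\<^bsub>R j\<^esub> \<oplus>\<^bsub>R j\<^esub> \<zero>\<^bsub>R j\<^esub> = \<zero>\<^bsub>R j\<^esub>" "\<one>\<^bsub>R j\<^esub> \<oplus>\<^bsub>R j\<^esub> \<zero>\<^bsub>R j\<^esub> = \<one>\<^bsub>R j\<^esub>"
          "\<zero>\<^bsub>R j\<^esub> \<oplus>\<^bsub>R j\<^esub> \<one>\<^bsub>R j\<^esub> = \<one>\<^bsub>R j\<^esub>" by auto
      qed
      then have "?e (insert i J) = ?e {i} \<oplus>\<^bsub>?P\<^esub> ?e J"
        using insert by (auto simp: product_ring_simps fun_eq_iff)
      moreover have "?e {i} \<oplus>\<^bsub>?P\<^esub> ?e J \<in> Q"
        by (rule Qc(5)[OF e insert.IH]) (use insert.prems in auto)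
      ultimately show ?case by (simp only:)
    qed
    from this[OF order_refl] have "?e I \<in> Q" .
    moreover have "?e I = \<one>\<^bsub>?P\<^esub>" by (auto simp: product_ring_simps)
    ultimately show False using Qc(3) by simp
  qed
  then obtain i where i: "i \<in> I" "?e {i} \<notin> Q" by blast
  show thesis
    by (rule Spec_product_ring_factor[OF R Q i(1)]) (use i that in auto)
qed

lemma faithfully_flat_product_surjective:
  assumes A: "cring A" and I: "finite I" and R: "\<And>i. i \<in> I \<Longrightarrow> cring (R i)"
    and ff: "faithfully_flat A (\<lambda>a. \<lambda>i\<in>I. f i a) (product_ring I R)" and p: "p \<in> Spec A"
  obtains i q where "i \<in> I" "q \<in> Spec (R i)" "Spec_map A (f i) q = p"
proof -
  interpret faithfully_flat_hom A "product_ring I R" "\<lambda>a. \<lambda>i\<in>I. f i a"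
    by (intro faithfully_flat_hom.intro A product_ring_cring R ff)
  obtain Q where Q: "Q \<in> Spec (product_ring I R)" "Spec_map A (\<lambda>a. \<lambda>i\<in>I. f i a) Q = p"
    using Spec_map_surjective[OF p] .
  obtain i q where iq: "i \<in> I" "q \<in> Spec (R i)" "Q = Spec_map (product_ring I R) (\<lambda>s. s i) q"
    using Spec_product_ring[OF I R Q(1)] .
  then have "Spec_map A (f i) q = p"
    using Q(2) Spec_map_comp[OF f_hom, of "\<lambda>s. s i" "f i" q] by simp
  then show thesis using that iq by blast
qed

text \<open>Going down for the product yields a prime below the one coming from \<open>q\<close>. It avoids the
  idempotent of the factor \<open>i\<close>, so it comes from the same factor.\<close>

lemma faithfully_flat_product_going_down:
  assumes A: "cring A" and R: "\<And>i. i \<in> I \<Longrightarrow> cring (R i)"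
    and ff: "faithfully_flat A (\<lambda>a. \<lambda>i\<in>I. f i a) (product_ring I R)" and p: "p \<in> Spec A"
    and i: "i \<in> I" and q: "q \<in> Spec (R i)" and le: "p \<subseteq> Spec_map A (f i) q"
  obtains q' where "q' \<in> Spec (R i)" "q' \<subseteq> q" "Spec_map A (f i) q' = p"
proof -
  let ?P = "product_ring I R" and ?f = "\<lambda>a. \<lambda>i\<in>I. f i a"
  interpret faithfully_flat_hom A ?P ?f
    by (intro faithfully_flat_hom.intro A product_ring_cring R ff)
  interpret Ri: cring "R i" by (rule R[OF i])
  let ?q = "Spec_map ?P (\<lambda>s. s i)"
  have comp: "Spec_map A ?f (?q q') = Spec_map A (f i) q'" for q'
    using Spec_map_comp[OF f_hom, of "\<lambda>s. s i" "f i" q'] i by simp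
  have "?q q \<in> Spec ?P"
    by (rule Spec_map_in_Spec[OF B R[OF i] product_ring_proj[OF i] q])
  then obtain Q where Q: "Q \<in> Spec ?P" "Q \<subseteq> ?q q" "Spec_map A ?f Q = p"
    using going_down[OF p] le comp by metis
  let ?e = "\<lambda>j\<in>I. if j = i then \<one>\<^bsub>R j\<^esub> else \<zero>\<^bsub>R j\<^esub>"
  have "?e \<notin> ?q q" using Ri.Spec_closed(3)[OF q] i by (simp add: Spec_map_def)
  then have "?e \<notin> Q" using Q(2) by blast
  then obtain q' where q': "q' \<in> Spec (R i)" "Q = ?q q'"
    using Spec_product_ring_factor[OF R Q(1) i] by blast
  have "q' \<subseteq> q"
  proof
    fix b assume b: "b \<in> q'"
    define s where "s = (\<lambda>j\<in>I. if j = i then b else \<zero>\<^bsub>R j\<^esub>)"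
    have "b \<in> carrier (R i)" using b Ri.Spec_closed(1)[OF q'(1)] by blast
    moreover have "\<zero>\<^bsub>R j\<^esub> \<in> carrier (R j)" if "j \<in> I" for j
      using R[OF that] by (simp add: cring_def ring.ring_simprules(2))
    ultimately have "s \<in> carrier ?P" by (auto simp: s_def product_ring_simps)
    then have "s \<in> Q" using b i q'(2) by (simp add: Spec_map_def s_def)
    then have "s \<in> ?q q" using Q(2) by blast
    then show "b \<in> q" using i by (simp add: Spec_map_def s_def)
  qed
  then show thesis using that q'(1) Q(3) comp unfolding q'(2) by blast
qed

section \<open>The spectra of the stalks of a schematic finite space\<close>

locale schematic_space =
  fixes S :: "'x topology" and F :: "'x set \<Rightarrow> 'r ring" and \<rho> :: "'x set \<Rightarrow> 'x set \<Rightarrow> 'r \<Rightarrow> 'r"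
  assumes schematic: "schematic_finite_space S F \<rho>"
begin

sublocale finite_ringed_space S F \<rho>
  using schematic by (simp add: schematic_finite_space_def)

abbreviation U where "U \<equiv> smallest_open S"
abbreviation St where "St \<equiv> stalk S F"
abbreviation pull where "pull x y \<equiv> Spec_map (St x) (\<rho> (U x) (U y))"

lemma openin_U [simp]: "x \<in> topspace S \<Longrightarrow> openin S (U x)"
proof -
  assume x: "x \<in> topspace S"
  have "finite {V. openin S V \<and> x \<in> V}"
    by (rule finite_subset[of _ "Pow (topspace S)"]) (use finite_space openin_subset in auto)
  then show ?thesis unfolding smallest_open_def using x by (intro openin_Inter) auto
qed

lemma U_self [simp]: "x \<in> U x"
  by (simp add: smallest_open_def)

lemma U_subset: "openin S V \<Longrightarrow> x \<in> V \<Longrightarrow> U x \<subseteq> V"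
  by (auto simp: smallest_open_def)

lemma U_mono: "x \<in> topspace S \<Longrightarrow> y \<in> U x \<Longrightarrow> U y \<subseteq> U x"
  by (rule U_subset[OF openin_U])

lemma U_topspace: "x \<in> topspace S \<Longrightarrow> y \<in> U x \<Longrightarrow> y \<in> topspace S"
  using openin_subset[OF openin_U] by blast

lemma stalk_cring [simp]: "x \<in> topspace S \<Longrightarrow> cring (St x)"
  by (simp add: stalk_def sections_cring)

lemma stalk_hom: "x \<in> topspace S \<Longrightarrow> y \<in> U x \<Longrightarrow> \<rho> (U x) (U y) \<in> ring_hom (St x) (St y)"
  unfolding stalk_def using U_mono U_topspace by (intro restriction_hom) auto

lemma pull_Spec: "x \<in> topspace S \<Longrightarrow> y \<in> U x \<Longrightarrow> q \<in> Spec (St y) \<Longrightarrow> pull x y q \<in> Spec (St x)"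
  using Spec_map_in_Spec[OF stalk_cring stalk_cring stalk_hom] U_topspace by blast

lemma Spec_map_restriction_comp:
  assumes "openin S V" "openin S W" "W \<subseteq> V" "openin S W'" "W' \<subseteq> W"
  shows "Spec_map (F V) (\<rho> V W) (Spec_map (F W) (\<rho> W W') q) = Spec_map (F V) (\<rho> V W') q"
  using assms by (intro Spec_map_comp[OF restriction_hom] restriction_comp) auto

lemma pull_comp:
  assumes "x \<in> topspace S" "y \<in> U x" "z \<in> U y"
  shows "pull x y (pull y z q) = pull x z q"
proof -
  have "y \<in> topspace S" using U_topspace assms by blast
  moreover from this have "z \<in> topspace S" using U_topspace assms by blast
  ultimately show ?thesis
    unfolding stalk_def using assms U_mono by (intro Spec_map_restriction_comp) auto
qed

text \<open>An affine open set. Over its ring of sections the spectra of the stalks of its points can be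
  compared with each other.\<close>

definition chart :: "'x set \<Rightarrow> bool" where
  "chart V \<longleftrightarrow> openin S V \<and> affine_finite_space (subtopology S V) F \<rho>"

lemma obtain_chart:
  assumes "x \<in> topspace S"
  obtains V where "chart V" "x \<in> V"
  using schematic assms unfolding schematic_finite_space_def chart_def by blast

lemma smallest_open_subtopology:
  assumes V: "openin S V" and x: "x \<in> V"
  shows "smallest_open (subtopology S V) x = U x"
proof
  have "x \<in> topspace S" using openin_subset[OF V] x by blast
  then have "openin (subtopology S V) (U x)"
    using V x U_subset by (simp add: openin_open_subtopology)
  then show "smallest_open (subtopology S V) x \<subseteq> U x" unfolding smallest_open_def by auto
  show "U x \<subseteq> smallest_open (subtopology S V) x"
    using V unfolding smallest_open_def by (auto simp: openin_open_subtopology)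
qed

context
  fixes V assumes chart: "chart V"
begin

lemma V_open: "openin S V" and V_affine: "affine_finite_space (subtopology S V) F \<rho>"
  using chart by (simp_all add: chart_def)

lemma V_topspace: "topspace (subtopology S V) = V"
  using openin_subset[OF V_open] by auto

lemma V_mem: "x \<in> V \<Longrightarrow> x \<in> topspace S"
  using openin_subset[OF V_open] by blast

abbreviation to_chart where "to_chart x \<equiv> Spec_map (F V) (\<rho> V (U x))"

lemma to_chart_pull:
  assumes x: "x \<in> V" and y: "y \<in> U x"
  shows "to_chart x (pull x y q) = to_chart y q"
proof -
  have "x \<in> topspace S" "y \<in> topspace S" using U_topspace V_mem assms by blast+
  then show ?thesis
    unfolding stalk_def using V_open U_subset[OF V_open x] U_mono y
    by (intro Spec_map_restriction_comp) auto
qed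

lemma faithfully_flat_over_stalks_V:
  assumes ff: "faithfully_flat_over_stalks (subtopology S V) F \<rho> W" and W: "W \<subseteq> V"
  shows "faithfully_flat (F W) (\<lambda>s. \<lambda>z\<in>W. \<rho> W (U z) s) (product_ring W St)"
proof -
  have U: "smallest_open (subtopology S V) z = U z" if "z \<in> W" for z
    using smallest_open_subtopology[OF V_open] that W by blast
  have "(\<lambda>s. \<lambda>z\<in>W. \<rho> W (smallest_open (subtopology S V) z) s) = (\<lambda>s. \<lambda>z\<in>W. \<rho> W (U z) s)"
    using U by (auto simp: fun_eq_iff)
  moreover have "product_ring W (stalk (subtopology S V) F) = product_ring W St"
    unfolding product_ring_def using U
    by (auto simp: stalk_def fun_eq_iff intro!: PiE_cong)
  ultimately show ?thesis using ff by (simp add: faithfully_flat_over_stalks_def)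
qed

lemma chart_going_down:
  assumes x: "x \<in> V" and p: "p \<in> Spec (F V)" and q: "q \<in> Spec (St x)" and le: "p \<subseteq> to_chart x q"
  obtains q' where "q' \<in> Spec (St x)" "q' \<subseteq> q" "to_chart x q' = p"
proof -
  have "faithfully_flat_over_stalks (subtopology S V) F \<rho> V"
    using V_affine unfolding affine_finite_space_def V_topspace by blast
  note ff = faithfully_flat_over_stalks_V[OF this order_refl]
  show thesis
    by (rule faithfully_flat_product_going_down[OF sections_cring[OF V_open] _ ff p x q le])
      (use V_mem that in auto)
qed

text \<open>The scheme-theoretic reason is \<open>Spec O\<^sub>x \<inter> Spec O\<^sub>y = Spec (O\<^sub>x
  \<otimes> O\<^sub>y) = Spec O\<^sub>x\<^sub>y\<close> inside the spectrum of the chart, and \<open>Spec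
  O\<^sub>x\<^sub>y\<close> is the union of the \<open>Spec O\<^sub>z\<close>.\<close>

lemma chart_common_point:
  assumes x: "x \<in> V" and y: "y \<in> V" and q: "q \<in> Spec (St x)" and q': "q' \<in> Spec (St y)"
    and eq: "to_chart x q = to_chart y q'"
  obtains z w where "z \<in> U x \<inter> U y" "w \<in> Spec (St z)" "pull x z w = q" "pull y z w = q'"
proof -
  let ?W = "U x \<inter> U y"
  have W: "openin S ?W" "openin S (U x)" "openin S (U y)" "U x \<subseteq> V" "U y \<subseteq> V"
    using V_mem x y U_subset[OF V_open] by auto
  note sub = smallest_open_subtopology[OF V_open x] smallest_open_subtopology[OF V_open y]
  have st: "stalk (subtopology S V) F x = St x" "stalk (subtopology S V) F y = St y"
    by (simp_all add: stalk_def sub)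
  note affine = V_affine[unfolded affine_finite_space_def V_topspace Let_def, THEN conjunct2, THEN conjunct2]
  have aff: "tensor_lift (add_monoid (F ?W)) (\<lambda>(s, t). \<rho> (U x) ?W s \<otimes>\<^bsub>F ?W\<^esub> \<rho> (U y) ?W t)
      \<in> ring_iso (tensor_algebra (F V) (\<rho> V (U x)) (St x) (\<rho> V (U y)) (St y)) (F ?W)"
    and ffW: "faithfully_flat_over_stalks (subtopology S V) F \<rho> ?W"
    using affine[THEN conjunct1, rule_format, OF x y] affine[THEN conjunct2, rule_format, OF x y]
    unfolding sub st by blast+
  interpret P: algebra_pair "F V" "St x" "St y" "\<rho> V (U x)" "\<rho> V (U y)"
    by (rule algebra_pair.intro)
      (use W V_open x y V_mem in \<open>auto simp: stalk_def intro!: sections_cring restriction_hom\<close>)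
  have bij: "bij_betw (tensor_lift (add_monoid (F ?W)) (\<lambda>(s, t). \<rho> (U x) ?W s \<otimes>\<^bsub>F ?W\<^esub> \<rho> (U y) ?W t))
      (carrier P.T.MN) (carrier (F ?W))"
    using aff by (simp add: ring_iso_def tensor_algebra_def Let_def)
  obtain q0 where q0: "q0 \<in> Spec (F ?W)" "Spec_map (St x) (\<rho> (U x) ?W) q0 = q"
    "Spec_map (St y) (\<rho> (U y) ?W) q0 = q'"
  proof (rule P.obtain_common_prime[OF _ _ _ _ bij q q' eq])
    show "\<rho> (U x) ?W \<in> ring_hom (St x) (F ?W)" "\<rho> (U y) ?W \<in> ring_hom (St y) (F ?W)"
      unfolding stalk_def using W by (auto intro!: restriction_hom)
    show "\<rho> (U x) ?W (\<rho> V (U x) a) = \<rho> (U y) ?W (\<rho> V (U y) a)" if "a \<in> carrier (F V)" for a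
      using that V_open W restriction_comp[of V "U x" ?W a] restriction_comp[of V "U y" ?W a] by simp
  qed (use W sections_cring in auto)
  have WV: "?W \<subseteq> V" using W by blast
  have fin: "finite ?W" using finite_subset[OF _ finite_space] openin_subset[OF W(1)] by blast
  obtain z w where z: "z \<in> ?W" and w: "w \<in> Spec (St z)" "Spec_map (F ?W) (\<rho> ?W (U z)) w = q0"
    by (rule faithfully_flat_product_surjective[OF sections_cring[OF W(1)] fin _
          faithfully_flat_over_stalks_V[OF ffW WV] q0(1)]) (use WV V_mem in auto)
  have "U z \<subseteq> ?W" "openin S (U z)" using U_subset[OF W(1) z] z WV V_mem by auto
  then have "pull x z w = q" "pull y z w = q'"
    using q0(2,3) w(2) W
      Spec_map_restriction_comp[of "U x" ?W "U z" w] Spec_map_restriction_comp[of "U y" ?W "U z" w]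
    by (simp_all add: stalk_def)
  then show thesis using that z w(1) by blast
qed

lemma to_chart_injective:
  assumes "x \<in> V" "q \<in> Spec (St x)" "q' \<in> Spec (St x)" "to_chart x q = to_chart x q'"
  shows "q = q'"
  using chart_common_point[OF assms(1,1,2,3,4)] by metis

end

text \<open>A chart gives a prime below \<open>q\<close> with the right contraction to the sections of the
  chart; by injectivity its contraction to the stalk at \<open>x\<close> is \<open>p\<close>.\<close>

lemma pull_going_down:
  assumes x: "x \<in> topspace S" and y: "y \<in> U x" and p: "p \<in> Spec (St x)" and q: "q \<in> Spec (St y)"
    and le: "p \<subseteq> pull x y q"
  obtains q' where "q' \<in> Spec (St y)" "q' \<subseteq> q" "pull x y q' = p"
proof -
  obtain V where V: "chart V" "x \<in> V" using obtain_chart[OF x] .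
  then have yV: "y \<in> V" using U_subset[OF V_open[OF V(1)]] y by blast
  note Vo = V_open[OF V(1)]
  have "Spec_map (F V) (\<rho> V (U x)) p \<in> Spec (F V)"
    using p Vo x U_subset[OF Vo V(2)]
    by (intro Spec_map_in_Spec[of "F V" "F (U x)"] sections_cring restriction_hom) (auto simp: stalk_def)
  moreover have "Spec_map (F V) (\<rho> V (U x)) p \<subseteq> Spec_map (F V) (\<rho> V (U y)) q"
    using Spec_map_mono[OF le] to_chart_pull[OF V y] by metis
  ultimately obtain q' where q': "q' \<in> Spec (St y)" "q' \<subseteq> q"
    "Spec_map (F V) (\<rho> V (U y)) q' = Spec_map (F V) (\<rho> V (U x)) p"
    using chart_going_down[OF V(1) yV _ q] by blast
  have "pull x y q' = p"
    using to_chart_injective[OF V pull_Spec[OF x y q'(1)] p] to_chart_pull[OF V y] q'(3) by metis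
  then show thesis using that q' by blast
qed

lemma pull_common_point:
  assumes x: "x \<in> topspace S" and y: "y \<in> U x" and z: "z \<in> U x"
    and q: "q \<in> Spec (St y)" and q': "q' \<in> Spec (St z)" and eq: "pull x y q = pull x z q'"
  obtains t w where "t \<in> U y \<inter> U z" "w \<in> Spec (St t)" "pull y t w = q" "pull z t w = q'"
proof -
  obtain V where V: "chart V" "x \<in> V" using obtain_chart[OF x] .
  then have yz: "y \<in> V" "z \<in> V" using U_subset[OF V_open[OF V(1)]] y z by blast+
  show thesis
    using chart_common_point[OF V(1) yz q q'] to_chart_pull[OF V y] to_chart_pull[OF V z] eq that
    by metis
qed

end

section \<open>Quasi-compact open subsets of the direct limit\<close>

lemma sym_rtrancl_Image_eq:
  assumes "sym r" "(s, t) \<in> r\<^sup>*"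
  shows "r\<^sup>* `` {s} = r\<^sup>* `` {t}"
  using assms(2) symD[OF sym_rtrancl[OF assms(1)] assms(2)] by (auto intro: rtrancl_trans)

lemma openin_zariski_generization:
  assumes "openin (zariski R) T" "q \<in> T" "q' \<in> Spec R" "q' \<subseteq> q"
  shows "q' \<in> T"
  using assms unfolding openin_zariski_iff Spec_open_def by blast

context schematic_space
begin

abbreviation Xt where "Xt \<equiv> Spec_space S F \<rho>"
abbreviation pt where "pt x p \<equiv> limit_point S F \<rho> (x, p)"
abbreviation part where "part Y \<equiv> Spec_subset S F \<rho> Y"

text \<open>The preimage of \<open>W\<close> in the spectrum of the stalk at \<open>x\<close>; the topology of
  the limit is determined by these sets.\<close>

definition trace :: "'x \<Rightarrow> ('x \<times> 'r set) set set \<Rightarrow> 'r set set" where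
  "trace x W = {p \<in> Spec (St x). pt x p \<in> W}"

text \<open>A one-step description of the equivalence relation generated by the transition maps.\<close>

definition meets :: "'x \<Rightarrow> 'r set \<Rightarrow> 'x \<Rightarrow> 'r set \<Rightarrow> bool" where
  "meets x p y q \<longleftrightarrow> (\<exists>z\<in>U x \<inter> U y. \<exists>w\<in>Spec (St z). pull x z w = p \<and> pull y z w = q)"

lemma limit_relation_iff:
  "((x, p), (y, q)) \<in> limit_relation S F \<rho> \<longleftrightarrow>
     x \<in> topspace S \<and> y \<in> U x \<and> q \<in> Spec (St y) \<and> p = pull x y q"
  unfolding limit_relation_def using U_mono U_topspace by auto

lemma pull_id:
  assumes "x \<in> topspace S" "p \<in> Spec (St x)"
  shows "pull x x p = p"
proof -
  have "\<rho> (U x) (U x) a = a" if "a \<in> carrier (St x)" for a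
    using that assms(1) restriction_id by (simp add: stalk_def)
  moreover have "p \<subseteq> carrier (St x)"
    using cring.Spec_closed(1)[OF stalk_cring assms(2)] assms(1) .
  ultimately show ?thesis by (auto simp: Spec_map_def)
qed

text \<open>The relation \<open>meets\<close> is stable under a further transition map in either direction. For
  a step to a stalk further up, \<open>pull_common_point\<close> provides the point that witnesses the new
  instance.\<close>

lemma limit_point_iff:
  assumes x: "x \<in> topspace S" and p: "p \<in> Spec (St x)"
  shows "(y, q) \<in> pt x p \<longleftrightarrow> y \<in> topspace S \<and> q \<in> Spec (St y) \<and> meets x p y q"
proof -
  let ?R = "limit_relation S F \<rho> \<union> (limit_relation S F \<rho>)\<inverse>"
  have "y \<in> topspace S \<and> q \<in> Spec (St y) \<and> meets x p y q" if "((x, p), (y, q)) \<in> ?R\<^sup>*"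
    using that
  proof (induction "(y, q)" arbitrary: y q rule: rtrancl_induct)
    case base
    then show ?case using x p pull_id[OF x p] U_self unfolding meets_def by blast
  next
    case (step s y q)
    obtain y' q' where s: "s = (y', q')" by (cases s)
    then have IH: "y' \<in> topspace S" "q' \<in> Spec (St y')" "meets x p y' q'" using step by auto
    then obtain z w where z: "z \<in> U x" "z \<in> U y'" and w: "w \<in> Spec (St z)" "pull x z w = p" "pull y' z w = q'"
      by (auto simp: meets_def)
    from step(2) consider "((y', q'), (y, q)) \<in> limit_relation S F \<rho>"
      | "((y, q), (y', q')) \<in> limit_relation S F \<rho>" unfolding s by blast
    then show ?case
    proof cases
      case 1
      then have y: "y \<in> U y'" "q \<in> Spec (St y)" "q' = pull y' y q" by (auto simp: limit_relation_iff)
      obtain t w' where t: "t \<in> U z \<inter> U y" "w' \<in> Spec (St t)" "pull z t w' = w" "pull y t w' = q"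
        using pull_common_point[OF IH(1) z(2) y(1) w(1) y(2)] w(3) y(3) by blast
      have "pull x t w' = p" using pull_comp[OF x z(1), of t w'] t w(2) by auto
      moreover have "t \<in> U x" using U_mono[OF x z(1)] t(1) by blast
      ultimately show ?thesis using t y U_topspace[OF IH(1) y(1)] by (auto simp: meets_def)
    next
      case 2
      then have y: "y \<in> topspace S" "y' \<in> U y" "q = pull y y' q'" by (auto simp: limit_relation_iff)
      have "pull y z w = q" using pull_comp[OF y(1,2) z(2), of w] w(3) y(3) by simp
      moreover have "z \<in> U y" using U_mono[OF y(1,2)] z(2) by blast
      moreover have "q \<in> Spec (St y)" using pull_Spec[OF y(1,2) IH(2)] y(3) by simp
      ultimately show ?thesis using z w y(1) by (auto simp: meets_def)
    qed
  qed
  moreover have "((x, p), (y, q)) \<in> ?R\<^sup>*"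
    if y: "y \<in> topspace S" "q \<in> Spec (St y)" and m: "meets x p y q"
  proof -
    obtain z w where z: "z \<in> U x" "z \<in> U y" and w: "w \<in> Spec (St z)" "pull x z w = p" "pull y z w = q"
      using m by (auto simp: meets_def)
    have "((x, p), (z, w)) \<in> ?R" "((z, w), (y, q)) \<in> ?R"
      using x y(1) z w by (auto simp: limit_relation_iff)
    then show ?thesis by (meson converse_rtrancl_into_rtrancl r_into_rtrancl)
  qed
  ultimately show ?thesis unfolding limit_point_def by blast
qed

lemma pt_eq_iff:
  assumes x: "x \<in> topspace S" "p \<in> Spec (St x)" and y: "y \<in> topspace S" "q \<in> Spec (St y)"
  shows "pt x p = pt y q \<longleftrightarrow> meets x p y q"
proof
  assume "pt x p = pt y q"
  moreover have "(y, q) \<in> pt y q" by (simp add: limit_point_def)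
  ultimately show "meets x p y q" using limit_point_iff[OF x] by blast
next
  assume "meets x p y q"
  then have "(y, q) \<in> pt x p" using limit_point_iff[OF x] y by blast
  then show "pt x p = pt y q"
    unfolding limit_point_def by (intro sym_rtrancl_Image_eq) (auto simp: sym_Un_converse)
qed

lemma pt_inject:
  assumes "x \<in> topspace S" "p \<in> Spec (St x)" "q \<in> Spec (St x)" "pt x p = pt x q"
  shows "p = q"
  using assms pt_eq_iff[OF assms(1,2,1,3)] by (auto simp: meets_def)

lemma pt_pull:
  assumes x: "x \<in> topspace S" and y: "y \<in> U x" and q: "q \<in> Spec (St y)"
  shows "pt x (pull x y q) = pt y q"
  using pt_eq_iff[OF x pull_Spec[OF x y q] U_topspace[OF x y] q] pull_id[OF U_topspace[OF x y] q] y q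
  by (auto simp: meets_def)

lemma part_iff: "a \<in> part Y \<longleftrightarrow> (\<exists>y\<in>Y. \<exists>q\<in>Spec (St y). a = pt y q)"
  by (auto simp: Spec_subset_def)

lemma partI [intro]: "y \<in> Y \<Longrightarrow> q \<in> Spec (St y) \<Longrightarrow> pt y q \<in> part Y"
  unfolding part_iff by blast

lemma openin_Xt:
  "openin Xt W \<longleftrightarrow> W \<subseteq> part (topspace S) \<and> (\<forall>x\<in>topspace S. openin (zariski (St x)) (trace x W))"
proof -
  let ?T = "sum_topology (\<lambda>x. zariski (St x)) (topspace S)"
  have top: "topspace ?T = Sigma (topspace S) (\<lambda>x. Spec (St x))" by (auto simp: comp_def)
  have "limit_point S F \<rho> ` topspace ?T = part (topspace S)"
    unfolding top part_iff[abs_def] by (auto simp: Spec_subset_def)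
  moreover have "{x. (y, x) \<in> {s \<in> topspace ?T. limit_point S F \<rho> s \<in> W}} = trace y W"
    if "y \<in> topspace S" for y using that unfolding top trace_def by auto
  moreover have "{s \<in> topspace ?T. limit_point S F \<rho> s \<in> W} \<subseteq> Sigma (topspace S) (topspace \<circ> (\<lambda>x. zariski (St x)))"
    unfolding top by auto
  ultimately show ?thesis
    unfolding Spec_space_def openin_quotient_topology openin_sum_topology by auto
qed

lemma topspace_Xt: "topspace Xt = part (topspace S)"
proof -
  have "openin (zariski (St x)) (trace x (part (topspace S)))" if "x \<in> topspace S" for x
  proof -
    have "trace x (part (topspace S)) = topspace (zariski (St x))"
      using that by (auto simp: trace_def)
    then show ?thesis by (simp only: openin_topspace)
  qed
  then have "openin Xt (part (topspace S))" by (simp add: openin_Xt)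
  then show ?thesis using openin_Xt openin_subset by (metis openin_topspace subset_antisym)
qed

lemma continuous_map_pt: "x \<in> topspace S \<Longrightarrow> continuous_map (zariski (St x)) Xt (pt x)"
  unfolding continuous_map_def topspace_Xt openin_Xt
  by (auto simp: trace_def)

text \<open>The parts over \<open>Y\<close> and over \<open>U z\<close> intersect in the part over \<open>Y
  \<inter> U z\<close>.\<close>

lemma part_Int_U:
  assumes Y: "openin S Y" and u: "u \<in> Y" and z: "z \<in> topspace S"
    and q: "q \<in> Spec (St u)" and p: "p \<in> Spec (St z)" and eq: "pt u q = pt z p"
  obtains t w where "t \<in> Y \<inter> U z" "t \<in> U u" "w \<in> Spec (St t)" "pt t w = pt z p"
proof -
  have u': "u \<in> topspace S" using openin_subset[OF Y] u by blast
  obtain t w where t: "t \<in> U u" "t \<in> U z" and w: "w \<in> Spec (St t)" "pull z t w = p"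
    using pt_eq_iff[OF u' q z p] eq by (auto simp: meets_def)
  have "pt t w = pt z p" using pt_pull[OF z t(2) w(1)] w(2) by simp
  moreover have "t \<in> Y" using U_subset[OF Y u] t(1) by blast
  ultimately show thesis using that t w by blast
qed

text \<open>The part of the limit over \<open>Y\<close>, with the topology that its pieces induce, is a subspace
  of the spectrum of the stalk at \<open>z\<close>. If no \<open>f\<close> works, then \<open>p\<close> lies in
  the closure of the complement of \<open>W\<close>. Since \<open>Y\<close> is finite, \<open>p\<close> lies in
  the closure of the portion of this complement coming from a single \<open>u\<close>, hence contains the
  contraction of a prime \<open>q0\<close> of the stalk at \<open>u\<close> outside \<open>W\<close>. Going down
  along a \<open>v\<close> that carries \<open>p\<close> contradicts that the trace of \<open>W\<close> at
  \<open>v\<close> is open, hence stable under generization.\<close>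

lemma obtain_basic_neighbourhood:
  assumes z: "z \<in> topspace S" and Y: "Y \<subseteq> U z"
    and W: "\<And>u. u \<in> Y \<Longrightarrow> openin (zariski (St u)) (trace u W)"
    and p: "p \<in> Spec (St z)" "pt z p \<in> W" "pt z p \<in> part Y"
  obtains f where "f \<in> carrier (St z)" "f \<notin> p"
    "\<And>p'. p' \<in> Spec (St z) \<Longrightarrow> f \<notin> p' \<Longrightarrow> pt z p' \<in> part Y \<Longrightarrow> pt z p' \<in> W"
proof (rule ccontr)
  assume not_thesis: "\<not> thesis"
  note found = that
  have bad: "\<exists>p'\<in>Spec (St z). f \<notin> p' \<and> pt z p' \<in> part Y \<and> pt z p' \<notin> W"
    if f: "f \<in> carrier (St z)" "f \<notin> p" for f
  proof (rule ccontr)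
    assume "\<not> ?thesis"
    then have "pt z p' \<in> W" if "p' \<in> Spec (St z)" "f \<notin> p'" "pt z p' \<in> part Y" for p'
      using that by blast
    then show False using found[OF f] not_thesis by blast
  qed
  interpret Z: cring "St z" using z by (rule stalk_cring)
  note pc = Z.Spec_closed[OF p(1)]
  let ?r = "\<lambda>u. \<rho> (U z) (U u)"
  have Yt: "u \<in> topspace S" if "u \<in> Y" for u using that Y U_topspace[OF z] by blast
  have finY: "finite Y" using finite_subset[OF _ finite_space, of Y] Yt by blast
  \<comment> \<open>\<open>I u\<close> is the vanishing ideal of the complement of \<open>W\<close> in the spectrum at \<open>u\<close>, and \<open>J u\<close> that of
    the image of this complement in the spectrum at \<open>z\<close>.\<close>
  define I where "I u = {b \<in> carrier (St u). \<forall>q\<in>Spec (St u). pt u q \<notin> W \<longrightarrow> b \<in> q}" for u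
  define J where "J u = {a \<in> carrier (St z). ?r u a \<in> I u}" for u
  have I: "ideal (I u) (St u)" if "u \<in> Y" for u
  proof -
    interpret cring "St u" using Yt[OF that] by (rule stalk_cring)
    show ?thesis unfolding ideal_iff_closed I_def using Spec_closed(2,4,5) by auto
  qed
  have hom: "ring_hom_cring (St z) (St u) (?r u)" if u: "u \<in> Y" for u
    using stalk_cring[OF z] stalk_cring[OF Yt[OF u]] stalk_hom[OF z subsetD[OF Y u]]
    by (intro ring_hom_cring.intro ring_hom_cring_axioms.intro)
  have J_mult: "b \<otimes>\<^bsub>St z\<^esub> a \<in> J u" "a \<otimes>\<^bsub>St z\<^esub> b \<in> J u" if u: "u \<in> Y" and "a \<in> J u" "b \<in> carrier (St z)" for u a b
  proof -
    interpret h: ring_hom_cring "St z" "St u" "?r u" by (rule hom[OF u])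
    show "b \<otimes>\<^bsub>St z\<^esub> a \<in> J u"
      using that I[OF u] unfolding h.S.ideal_iff_closed J_def by auto
    then show "a \<otimes>\<^bsub>St z\<^esub> b \<in> J u" using that by (simp add: Z.m_comm J_def)
  qed
  \<comment> \<open>A product of elements of the \<open>J u\<close> outside \<open>p\<close> would be an \<open>f\<close> as desired.\<close>
  have "\<exists>u\<in>Y. J u \<subseteq> p"
  proof (rule ccontr)
    assume "\<not> ?thesis"
    then have no: "\<exists>f. f \<in> J u \<and> f \<notin> p" if "u \<in> Y" for u using that by blast
    have "\<exists>f\<in>carrier (St z). f \<notin> p \<and> (\<forall>u\<in>Y'. f \<in> J u)" if "Y' \<subseteq> Y" for Y'
      using finite_subset[OF that finY] that
    proof (induction Y' rule: finite_induct)
      case empty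
      then show ?case using pc(3) by auto
    next
      case (insert u Y')
      then obtain f where f: "f \<in> carrier (St z)" "f \<notin> p" "\<forall>u\<in>Y'. f \<in> J u" by blast
      obtain g where g: "g \<in> J u" "g \<notin> p" using no insert by blast
      have gc: "g \<in> carrier (St z)" using g by (simp add: J_def)
      have "f \<otimes>\<^bsub>St z\<^esub> g \<notin> p" using pc(4)[OF f(1) gc] f g by blast
      moreover have "f \<otimes>\<^bsub>St z\<^esub> g \<in> J v" if "v \<in> insert u Y'" for v
        using that f g gc J_mult insert.prems by blast
      ultimately show ?case using f gc by (intro bexI[of _ "f \<otimes>\<^bsub>St z\<^esub> g"]) auto
    qed
    then obtain f where f: "f \<in> carrier (St z)" "f \<notin> p" "\<forall>u\<in>Y. f \<in> J u" by blast
    then obtain p' where p': "p' \<in> Spec (St z)" "f \<notin> p'" "pt z p' \<in> part Y" "pt z p' \<notin> W"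
      using bad by blast
    then obtain u q where uq: "u \<in> Y" "q \<in> Spec (St u)" "pt z p' = pt u q" by (auto simp: part_iff)
    have "pull z u q = p'"
      using pt_inject[OF z pull_Spec[OF z _ uq(2)] p'(1)] pt_pull[OF z _ uq(2)] uq Y by auto
    moreover have "?r u f \<in> q" using f uq p'(4) by (auto simp: J_def I_def)
    ultimately show False using f(1) p'(2) by (auto simp: Spec_map_def)
  qed
  then obtain u where u: "u \<in> Y" "J u \<subseteq> p" by blast
  interpret h: ring_hom_cring "St z" "St u" "?r u" by (rule hom[OF u(1)])
  let ?S = "?r u ` (carrier (St z) - p)"
  obtain q0 where q0: "q0 \<in> Spec (St u)" "I u \<subseteq> q0" "q0 \<inter> ?S = {}"
  proof (rule h.S.obtain_prime_disjoint[OF I[OF u(1)], of ?S])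
    show "\<one>\<^bsub>St u\<^esub> \<in> ?S" using pc(3) by (intro image_eqI[of _ _ "\<one>\<^bsub>St z\<^esub>"]) auto
    show "s \<otimes>\<^bsub>St u\<^esub> t \<in> ?S" if st: "s \<in> ?S" "t \<in> ?S" for s t
    proof -
      obtain s' t' where "s' \<in> carrier (St z) - p" "t' \<in> carrier (St z) - p" "s = ?r u s'" "t = ?r u t'"
        using st by blast
      then show ?thesis using pc(4) by (intro image_eqI[of _ _ "s' \<otimes>\<^bsub>St z\<^esub> t'"]) auto
    qed
    show "I u \<inter> ?S = {}" using u(2) by (auto simp: J_def)
  qed auto
  have uz: "u \<in> U z" using u(1) Y by blast
  \<comment> \<open>The complement of \<open>W\<close> is closed at \<open>u\<close>, so it contains every prime above its vanishing ideal.\<close>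
  have q0_not: "pt u q0 \<notin> W"
  proof
    assume "pt u q0 \<in> W"
    obtain E where E: "E \<subseteq> carrier (St u)" "trace u W = Spec_open (St u) E"
      using W[OF u(1)] by (auto simp: openin_zariski_iff)
    have "E \<subseteq> I u"
    proof
      fix e assume e: "e \<in> E"
      have "e \<in> q" if q: "q \<in> Spec (St u)" "pt u q \<notin> W" for q
      proof -
        have "q \<notin> Spec_open (St u) E" using q unfolding E(2)[symmetric] by (simp add: trace_def)
        then show ?thesis using q e by (auto simp: Spec_open_def)
      qed
      then show "e \<in> I u" using e E(1) by (auto simp: I_def)
    qed
    then have "q0 \<notin> trace u W" using q0(2) unfolding E(2) Spec_open_def by blast
    then show False using q0(1) \<open>pt u q0 \<in> W\<close> by (simp add: trace_def)
  qed
  have sub: "pull z u q0 \<subseteq> p" using q0(3) by (auto simp: Spec_map_def)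
  obtain v q where v: "v \<in> Y" "q \<in> Spec (St v)" "pt z p = pt v q" using p(3) by (auto simp: part_iff)
  have vz: "v \<in> U z" using v(1) Y by blast
  have "pull z v q = p"
    using pt_inject[OF z pull_Spec[OF z vz v(2)] p(1)] pt_pull[OF z vz v(2)] v(3) by simp
  then obtain q' where q': "q' \<in> Spec (St v)" "q' \<subseteq> q" "pull z v q' = pull z u q0"
    using pull_going_down[OF z vz pull_Spec[OF z uz q0(1)] v(2)] sub by blast
  have "q \<in> trace v W" using v(2,3) p(2) by (simp add: trace_def)
  then have "q' \<in> trace v W" using openin_zariski_generization[OF W[OF v(1)] _ q'(1,2)] by blast
  then have "pt v q' \<in> W" by (simp add: trace_def)
  moreover have "pt v q' = pt u q0" using pt_pull[OF z vz q'(1)] pt_pull[OF z uz q0(1)] q'(3) by simp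
  ultimately show False using q0_not by simp
qed

lemma trace_basic:
  assumes z: "z \<in> topspace S" and v: "v \<in> U z" and E: "E \<subseteq> carrier (St z)"
  shows "trace v (pt z ` Spec_open (St z) E) = Spec_open (St v) (\<rho> (U z) (U v) ` E)"
proof -
  have "pt v q \<in> pt z ` Spec_open (St z) E \<longleftrightarrow> q \<in> Spec_open (St v) (\<rho> (U z) (U v) ` E)"
    if q: "q \<in> Spec (St v)" for q
  proof -
    have "pt v q \<in> pt z ` Spec_open (St z) E \<longleftrightarrow> pull z v q \<in> Spec_open (St z) E"
    proof
      assume "pt v q \<in> pt z ` Spec_open (St z) E"
      then obtain p where p: "p \<in> Spec_open (St z) E" "pt v q = pt z p" by blast
      then have "pull z v q = p"
        using pt_inject[OF z pull_Spec[OF z v q], of p] pt_pull[OF z v q] by (simp add: Spec_open_def)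
      then show "pull z v q \<in> Spec_open (St z) E" using p by simp
    qed (use pt_pull[OF z v q] in \<open>metis image_eqI\<close>)
    also have "\<dots> \<longleftrightarrow> q \<in> Spec_open (St v) (\<rho> (U z) (U v) ` E)"
      using Spec_map_in_Spec_open_iff[OF stalk_cring[OF z] stalk_cring[OF U_topspace[OF z v]]
          stalk_hom[OF z v] q E] .
    finally show ?thesis .
  qed
  then show ?thesis unfolding trace_def by (auto simp: Spec_open_def)
qed

text \<open>For \<open>Y = topspace S\<close> this will turn out to be quasi-compactness and openness of
  \<open>V\<close>; smaller \<open>Y\<close> occur while \<open>V\<close> is being constructed.\<close>

definition quasicompact_over :: "'x set \<Rightarrow> ('x \<times> 'r set) set set \<Rightarrow> bool" where
  "quasicompact_over Y V \<longleftrightarrow>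
     (\<forall>y\<in>Y. openin (zariski (St y)) (trace y V) \<and> compactin (zariski (St y)) (trace y V))"

lemma quasicompact_over_basic:
  assumes z: "z \<in> topspace S" and E: "E \<subseteq> carrier (St z)" "finite E"
  shows "quasicompact_over (U z) (pt z ` Spec_open (St z) E)"
  unfolding quasicompact_over_def
proof
  fix v assume v: "v \<in> U z"
  have "\<rho> (U z) (U v) ` E \<subseteq> carrier (St v)"
    using E(1) ring_hom_closed[OF stalk_hom[OF z v]] by blast
  then have "\<exists>D\<subseteq>carrier (St v). finite D \<and> trace v (pt z ` Spec_open (St z) E) = Spec_open (St v) D"
    using E(2) trace_basic[OF z v E(1)] by blast
  then show "openin (zariski (St v)) (trace v (pt z ` Spec_open (St z) E)) \<and>
      compactin (zariski (St v)) (trace v (pt z ` Spec_open (St z) E))"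
    unfolding openin_compactin_zariski_iff[OF stalk_cring[OF U_topspace[OF z v]]] .
qed

text \<open>Near each point of \<open>V\<close> over \<open>Y \<inter> U z\<close> there is a principal open
  subset of the spectrum at \<open>z\<close> that stays inside \<open>W\<close> and adds nothing to
  \<open>V\<close> over \<open>Y \<inter> U z\<close>. Finitely many of them cover this portion of
  \<open>V\<close>, and their union \<open>N\<close> is glued to \<open>V\<close>. The trace of \<open>V
  \<union> N\<close> is that of \<open>V\<close> at the points of \<open>Y\<close> and that of \<open>N\<close>
  at the points of \<open>U z\<close>.\<close>

lemma quasicompact_extend:
  assumes W: "openin Xt W" and Y: "openin S Y" and V: "V \<subseteq> W" "V \<subseteq> part Y" "quasicompact_over Y V"
    and z: "z \<in> topspace S"
  obtains V' where "V \<subseteq> V'" "V' \<subseteq> W" "V' \<subseteq> part (Y \<union> U z)" "quasicompact_over (Y \<union> U z) V'"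
proof -
  let ?Y = "Y \<inter> U z" and ?r = "\<lambda>u. \<rho> (U z) (U u)"
  interpret Z: cring "St z" using z by (rule stalk_cring)
  define good where "good f \<longleftrightarrow> f \<in> carrier (St z) \<and>
    (\<forall>p\<in>Spec (St z). f \<notin> p \<longrightarrow> pt z p \<in> W \<and> (pt z p \<in> part ?Y \<longrightarrow> pt z p \<in> V))" for f
  have good_ex: "\<exists>f. good f \<and> f \<notin> p" if p: "p \<in> Spec (St z)" "pt z p \<in> V" "pt z p \<in> part ?Y" for p
  proof -
    obtain f where f: "f \<in> carrier (St z)" "f \<notin> p"
      "\<And>p'. p' \<in> Spec (St z) \<Longrightarrow> f \<notin> p' \<Longrightarrow> pt z p' \<in> part ?Y \<Longrightarrow> pt z p' \<in> V"
      using obtain_basic_neighbourhood[OF z, of ?Y V p] V(3) p unfolding quasicompact_over_def by blast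
    obtain E where E: "E \<subseteq> carrier (St z)" "trace z W = Spec_open (St z) E"
      using W z by (auto simp: openin_Xt openin_zariski_iff)
    have "p \<in> Spec_open (St z) E" using p V(1) unfolding E(2)[symmetric] by (auto simp: trace_def)
    then obtain e where e: "e \<in> E" "e \<notin> p" by (auto simp: Spec_open_def)
    have eW: "pt z p' \<in> W" if "p' \<in> Spec (St z)" "e \<notin> p'" for p'
    proof -
      have "p' \<in> trace z W" using that e(1) unfolding E(2) by (auto simp: Spec_open_def)
      then show ?thesis by (simp add: trace_def)
    qed
    have ec: "e \<in> carrier (St z)" using e E by blast
    have "f \<otimes>\<^bsub>St z\<^esub> e \<notin> p" using Z.Spec_closed(4)[OF p(1) f(1) ec] f e by blast
    moreover have "good (f \<otimes>\<^bsub>St z\<^esub> e)"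
      unfolding good_def using f ec eW Z.Spec_closed(4)[OF _ f(1) ec] by simp
    ultimately show ?thesis by blast
  qed
  have "\<exists>D. finite D \<and> (\<forall>f\<in>D. good f) \<and> trace u V \<subseteq> Spec_open (St u) (?r u ` D)" if u: "u \<in> ?Y" for u
  proof -
    let ?C = "(\<lambda>f. Spec_open (St u) {?r u f}) ` {f. good f}"
    have uz: "u \<in> U z" using u by blast
    have opens: "openin (zariski (St u)) C" if "C \<in> ?C" for C
      using that ring_hom_closed[OF stalk_hom[OF z uz]] by (auto simp: good_def intro!: openin_Spec_open)
    have cover: "trace u V \<subseteq> \<Union>?C"
    proof
      fix q assume "q \<in> trace u V"
      then have q: "q \<in> Spec (St u)" "pt u q \<in> V" by (auto simp: trace_def)
      have "pt z (pull z u q) = pt u q" by (rule pt_pull[OF z uz q(1)])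
      moreover have "pt u q \<in> part ?Y" using u q by (auto simp: part_iff)
      ultimately obtain f where f: "good f" "f \<notin> pull z u q"
        using good_ex[OF pull_Spec[OF z uz q(1)]] q(2) by auto
      then have "q \<in> Spec_open (St u) {?r u f}"
        using q(1) by (auto simp: Spec_open_def Spec_map_def good_def)
      then show "q \<in> \<Union>?C" using f(1) by blast
    qed
    have "compactin (zariski (St u)) (trace u V)"
      using V(3) u by (auto simp: quasicompact_over_def)
    then obtain \<F> where \<F>: "finite \<F>" "\<F> \<subseteq> ?C" "trace u V \<subseteq> \<Union>\<F>"
      using compactinD[OF _ opens cover] by blast
    obtain D where D: "D \<subseteq> {f. good f}" "finite D" "\<F> = (\<lambda>f. Spec_open (St u) {?r u f}) ` D"
      using finite_subset_image[OF \<F>(1,2)] by blast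
    have "trace u V \<subseteq> Spec_open (St u) (?r u ` D)"
      using \<F>(3) unfolding D(3) by (auto simp: Spec_open_def)
    then show ?thesis using D by blast
  qed
  then obtain D where D: "\<And>u. u \<in> ?Y \<Longrightarrow> finite (D u)" "\<And>u f. u \<in> ?Y \<Longrightarrow> f \<in> D u \<Longrightarrow> good f"
    "\<And>u. u \<in> ?Y \<Longrightarrow> trace u V \<subseteq> Spec_open (St u) (?r u ` D u)"
    by metis
  define E where "E = (\<Union>u\<in>?Y. D u)"
  have "finite ?Y" using finite_subset[OF _ finite_space, of ?Y] openin_subset[OF Y] by blast
  then have E: "finite E" "E \<subseteq> carrier (St z)" and good: "\<And>f. f \<in> E \<Longrightarrow> good f"
    using D(1,2) unfolding E_def good_def by auto
  let ?N = "pt z ` Spec_open (St z) E"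
  have covered: "pt u q \<in> ?N" if u: "u \<in> ?Y" and q: "q \<in> Spec (St u)" "pt u q \<in> V" for u q
  proof -
    have "q \<in> trace u V" using q by (simp add: trace_def)
    then have "q \<in> Spec_open (St u) (?r u ` E)"
      using D(3)[OF u] u unfolding E_def Spec_open_def by blast
    then have "q \<in> trace u ?N" using trace_basic[OF z _ E(2)] u by auto
    then show ?thesis by (simp add: trace_def)
  qed
  have N: "pt z p \<in> W" "pt z p \<in> part ?Y \<Longrightarrow> pt z p \<in> V" if "p \<in> Spec_open (St z) E" for p
    using that good unfolding Spec_open_def good_def by blast+
  have Nz: "?N \<subseteq> part (U z)" using U_self by (auto simp: Spec_open_def)
  have NW: "?N \<subseteq> W" using N by blast
  have qc: "quasicompact_over (Y \<union> U z) (V \<union> ?N)"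
    unfolding quasicompact_over_def
  proof
    have Yz: "\<And>v. v \<in> U z \<Longrightarrow> v \<in> topspace S" using U_topspace[OF z] by blast
    fix v assume "v \<in> Y \<union> U z"
    then consider "v \<in> U z" | "v \<in> Y" by blast
    then show "openin (zariski (St v)) (trace v (V \<union> ?N)) \<and> compactin (zariski (St v)) (trace v (V \<union> ?N))"
    proof cases
      case 1
      have "pt v q \<in> ?N" if q: "q \<in> Spec (St v)" "pt v q \<in> V" for q
      proof -
        obtain u q' where u: "u \<in> Y" "q' \<in> Spec (St u)" "pt v q = pt u q'"
          using subsetD[OF V(2) q(2)] unfolding part_iff by blast
        obtain t w where t: "t \<in> Y \<inter> U v" "w \<in> Spec (St t)" "pt t w = pt v q"
          using part_Int_U[OF Y u(1) Yz[OF 1] u(2) q(1) u(3)[symmetric]] by blast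
        have "t \<in> ?Y" using t(1) U_mono[OF z 1] by blast
        then show ?thesis using covered[OF _ t(2)] t(3) q(2) by simp
      qed
      then have "trace v (V \<union> ?N) = trace v ?N" by (auto simp: trace_def)
      then show ?thesis
        using quasicompact_over_basic[OF z E(2,1)] 1 by (simp add: quasicompact_over_def)
    next
      case 2
      have "pt v q \<in> V" if q: "q \<in> Spec (St v)" "pt v q \<in> ?N" for q
      proof -
        obtain p where p: "p \<in> Spec_open (St z) E" "pt v q = pt z p" using q(2) by blast
        then have pz: "p \<in> Spec (St z)" by (simp add: Spec_open_def)
        obtain t w where "t \<in> ?Y" "w \<in> Spec (St t)" "pt t w = pt z p"
          using part_Int_U[OF Y 2 z q(1) pz p(2)] by blast
        then have "pt z p \<in> part ?Y" by (auto simp: part_iff)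
        then show ?thesis using N(2)[OF p(1)] p(2) by simp
      qed
      then have "trace v (V \<union> ?N) = trace v V" by (auto simp: trace_def)
      then show ?thesis using V(3) 2 by (simp add: quasicompact_over_def)
    qed
  qed
  have mono: "part Y \<subseteq> part (Y \<union> U z)" "part (U z) \<subseteq> part (Y \<union> U z)"
    unfolding Spec_subset_def by blast+
  have "V \<union> ?N \<subseteq> part (Y \<union> U z)"
    by (intro Un_least subset_trans[OF V(2) mono(1)] subset_trans[OF Nz mono(2)])
  then show thesis by (rule that[OF Un_upper1 Un_least[OF V(1) NW] _ qc])
qed

lemma obtain_quasicompact_neighbourhood:
  assumes W: "openin Xt W" and a: "a \<in> W"
  obtains V where "openin Xt V" "a \<in> V" "V \<subseteq> W" "quasicompact_over (topspace S) V"
proof -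
  have "a \<in> part (topspace S)" using W a by (auto simp: openin_Xt)
  then obtain x p where x: "x \<in> topspace S" and p: "p \<in> Spec (St x)" "a = pt x p"
    by (auto simp: part_iff)
  obtain E where E: "E \<subseteq> carrier (St x)" "trace x W = Spec_open (St x) E"
    using W x by (auto simp: openin_Xt openin_zariski_iff)
  have "p \<in> Spec_open (St x) E" using p a unfolding E(2)[symmetric] by (simp add: trace_def)
  then obtain e where e: "e \<in> E" "e \<notin> p" by (auto simp: Spec_open_def)
  let ?N = "pt x ` Spec_open (St x) {e}"
  have "Spec_open (St x) {e} \<subseteq> trace x W" using e unfolding E(2) by (auto simp: Spec_open_def)
  then have NW: "?N \<subseteq> W" by (auto simp: trace_def)
  have aN: "a \<in> ?N" using p e by (auto simp: Spec_open_def)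
  have Nx: "?N \<subseteq> part (U x)" using U_self by (auto simp: Spec_open_def)
  have Nq: "quasicompact_over (U x) ?N" using e E x by (intro quasicompact_over_basic) auto
  have "\<exists>V. a \<in> V \<and> V \<subseteq> W \<and> V \<subseteq> part (U x \<union> (\<Union>z\<in>Z. U z)) \<and> quasicompact_over (U x \<union> (\<Union>z\<in>Z. U z)) V"
    if "Z \<subseteq> topspace S" for Z
    using finite_subset[OF that finite_space] that
  proof (induction Z rule: finite_induct)
    case empty
    then show ?case using aN NW Nx Nq by (intro exI[of _ ?N]) simp
  next
    case (insert z Z)
    let ?Y = "U x \<union> (\<Union>z\<in>Z. U z)"
    obtain V where V: "a \<in> V" "V \<subseteq> W" "V \<subseteq> part ?Y" "quasicompact_over ?Y V" using insert by auto
    have "openin S ?Y" using x insert.prems by (intro openin_Un openin_Union) auto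
    then obtain V' where V': "V \<subseteq> V'" "V' \<subseteq> W" "V' \<subseteq> part (?Y \<union> U z)" "quasicompact_over (?Y \<union> U z) V'"
      using quasicompact_extend[OF W _ V(2-4), of z] insert.prems by blast
    have "?Y \<union> U z = U x \<union> (\<Union>z\<in>insert z Z. U z)" by blast
    then show ?case using V V' by (intro exI[of _ V']) auto
  qed
  from this[OF order_refl] obtain V where V: "a \<in> V" "V \<subseteq> W"
    "quasicompact_over (U x \<union> (\<Union>z\<in>topspace S. U z)) V" by blast
  have q: "quasicompact_over (topspace S) V"
    using V(3) U_self unfolding quasicompact_over_def by blast
  moreover have "openin Xt V"
    using q V(2) W unfolding openin_Xt quasicompact_over_def by blast
  ultimately show thesis using that V by blast
qed

lemma compactin_part_Int:
  assumes V: "quasicompact_over Y V" and Y: "Y \<subseteq> topspace S"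
  shows "compactin Xt (V \<inter> part Y)"
proof -
  have "V \<inter> part Y = (\<Union>y\<in>Y. pt y ` trace y V)"
    unfolding Spec_subset_def trace_def by blast
  moreover have "compactin Xt (\<Union>y\<in>Y. pt y ` trace y V)"
  proof (rule compactin_Union)
    show "finite ((\<lambda>y. pt y ` trace y V) ` Y)" using finite_subset[OF Y finite_space] by simp
    show "compactin Xt C" if "C \<in> (\<lambda>y. pt y ` trace y V) ` Y" for C
      using that V Y continuous_map_pt unfolding quasicompact_over_def by (auto intro!: image_compactin)
  qed
  ultimately show ?thesis by simp
qed

text \<open>The open sets with quasi-compact traces form a basis, so a quasi-compact open set is a finite union
  of them.\<close>

lemma openin_compactin_Xt_iff:
  "openin Xt V \<and> compactin Xt V \<longleftrightarrow> V \<subseteq> part (topspace S) \<and> quasicompact_over (topspace S) V"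
proof
  assume V: "openin Xt V \<and> compactin Xt V"
  let ?C = "{N. openin Xt N \<and> N \<subseteq> V \<and> quasicompact_over (topspace S) N}"
  have cover: "V \<subseteq> \<Union>?C"
  proof
    fix a assume "a \<in> V"
    then obtain N where "openin Xt N" "a \<in> N" "N \<subseteq> V" "quasicompact_over (topspace S) N"
      using obtain_quasicompact_neighbourhood[OF conjunct1[OF V]] by metis
    then show "a \<in> \<Union>?C" by blast
  qed
  have "\<exists>\<F>. finite \<F> \<and> \<F> \<subseteq> ?C \<and> V \<subseteq> \<Union>\<F>"
    by (rule compactinD[OF conjunct2[OF V] _ cover]) simp
  then obtain \<F> where \<F>: "finite \<F>" "\<F> \<subseteq> ?C" "V \<subseteq> \<Union>\<F>" by (elim exE conjE)
  have "compactin (zariski (St x)) (trace x V)" if x: "x \<in> topspace S" for x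
  proof -
    have "trace x V = (\<Union>N\<in>\<F>. trace x N)" using \<F>(2,3) by (auto simp: trace_def)
    moreover have "compactin (zariski (St x)) (\<Union>N\<in>\<F>. trace x N)"
      by (rule compactin_Union) (use \<F>(1,2) x in \<open>auto simp: quasicompact_over_def\<close>)
    ultimately show ?thesis by simp
  qed
  then show "V \<subseteq> part (topspace S) \<and> quasicompact_over (topspace S) V"
    using V unfolding openin_Xt quasicompact_over_def by blast
next
  assume V: "V \<subseteq> part (topspace S) \<and> quasicompact_over (topspace S) V"
  then have "V \<inter> part (topspace S) = V" by blast
  then show "openin Xt V \<and> compactin Xt V"
    using V compactin_part_Int[of "topspace S" V] unfolding openin_Xt quasicompact_over_def by simp
qed

lemma quasicompact_over_Int:
  assumes "quasicompact_over Y V" "quasicompact_over Y W" "Y \<subseteq> topspace S"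
  shows "quasicompact_over Y (V \<inter> W)"
  unfolding quasicompact_over_def
proof
  fix y assume y: "y \<in> Y"
  then have c: "cring (St y)" using assms(3) by (intro stalk_cring) blast
  note iff = openin_compactin_zariski_iff[OF c]
  obtain D where D: "D \<subseteq> carrier (St y)" "finite D" "trace y V = Spec_open (St y) D"
    using assms(1) y iff[of "trace y V"] unfolding quasicompact_over_def by blast
  obtain E where E: "E \<subseteq> carrier (St y)" "finite E" "trace y W = Spec_open (St y) E"
    using assms(2) y iff[of "trace y W"] unfolding quasicompact_over_def by blast
  have "trace y (V \<inter> W) = trace y V \<inter> trace y W" by (auto simp: trace_def)
  also have "\<dots> = Spec_open (St y) ((\<lambda>(a, b). a \<otimes>\<^bsub>St y\<^esub> b) ` (D \<times> E))"
    unfolding D(3) E(3) by (rule Spec_open_Int[OF c D(1) E(1)])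
  finally have "trace y (V \<inter> W) = Spec_open (St y) ((\<lambda>(a, b). a \<otimes>\<^bsub>St y\<^esub> b) ` (D \<times> E))" .
  moreover have "(\<lambda>(a, b). a \<otimes>\<^bsub>St y\<^esub> b) ` (D \<times> E) \<subseteq> carrier (St y)"
    using D(1) E(1) c by (auto simp: cring_def ring.ring_simprules(5) subset_iff)
  moreover have "finite ((\<lambda>(a, b). a \<otimes>\<^bsub>St y\<^esub> b) ` (D \<times> E))" using D(2) E(2) by simp
  ultimately show "openin (zariski (St y)) (trace y (V \<inter> W)) \<and> compactin (zariski (St y)) (trace y (V \<inter> W))"
    unfolding openin_compactin_zariski_iff[OF c] by blast
qed

end

theorem proposition13p21:
  fixes S :: "'x topology"
    and F :: "'x set \<Rightarrow> 'r ring"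
    and \<rho> :: "'x set \<Rightarrow> 'x set \<Rightarrow> 'r \<Rightarrow> 'r"
  assumes "schematic_finite_space S F \<rho>"
  shows "(\<forall>V W. openin (Spec_space S F \<rho>) V \<and> compactin (Spec_space S F \<rho>) V \<and>
                openin (Spec_space S F \<rho>) W \<and> compactin (Spec_space S F \<rho>) W \<longrightarrow>
                compactin (Spec_space S F \<rho>) (V \<inter> W)) \<and>
         openin (Spec_space S F \<rho>) =
           arbitrary union_of (\<lambda>V. openin (Spec_space S F \<rho>) V \<and> compactin (Spec_space S F \<rho>) V) \<and>
         (\<forall>V U. openin (Spec_space S F \<rho>) V \<and> compactin (Spec_space S F \<rho>) V \<and> openin S U \<longrightarrow>
                compactin (Spec_space S F \<rho>) (V \<inter> Spec_subset S F \<rho> U))"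
proof -
  interpret schematic_space S F \<rho> by (rule schematic_space.intro[OF assms])
  let ?qc = "\<lambda>V. openin (Spec_space S F \<rho>) V \<and> compactin (Spec_space S F \<rho>) V"
  have "compactin (Spec_space S F \<rho>) (V \<inter> W)" if V: "?qc V" and W: "?qc W" for V W
  proof -
    have "?qc (V \<inter> W)"
      using V W quasicompact_over_Int[of "topspace S" V W] unfolding openin_compactin_Xt_iff by blast
    then show ?thesis by blast
  qed
  moreover have "openin (Spec_space S F \<rho>) W \<longleftrightarrow> (arbitrary union_of ?qc) W" for W
  proof
    assume W: "openin (Spec_space S F \<rho>) W"
    show "(arbitrary union_of ?qc) W"
      unfolding arbitrary_union_of_alt
    proof
      fix a assume "a \<in> W"
      then obtain V where V: "openin (Spec_space S F \<rho>) V" "a \<in> V" "V \<subseteq> W" "quasicompact_over (topspace S) V"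
        using obtain_quasicompact_neighbourhood[OF W] by blast
      then have "?qc V" unfolding openin_compactin_Xt_iff by (simp add: openin_Xt)
      then show "\<exists>V. ?qc V \<and> a \<in> V \<and> V \<subseteq> W" using V by blast
    qed
  next
    assume "(arbitrary union_of ?qc) W"
    then show "openin (Spec_space S F \<rho>) W"
      unfolding arbitrary_union_of_alt openin_subopen[of _ W] by blast
  qed
  then have "openin (Spec_space S F \<rho>) = arbitrary union_of ?qc" by blast
  moreover have "compactin (Spec_space S F \<rho>) (V \<inter> Spec_subset S F \<rho> Y)"
    if V: "?qc V" and Y: "openin S Y" for V Y
  proof (rule compactin_part_Int)
    show Y': "Y \<subseteq> topspace S" using Y by (rule openin_subset)
    show "quasicompact_over Y V"
      using V Y' unfolding openin_compactin_Xt_iff quasicompact_over_def by blast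
  qed
  ultimately show ?thesis by blast
qed

end
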